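(* Let $\Psi$ be a bounded set of nonnegative matrices that define operators on $l^2(R)$ and let $r\in\{\rho,\hat\rho\}$. Let $\alpha,\beta$ be nonnegative numbers with $\alpha+\beta\ge1$, and let $r_n=r\big(S_{\alpha,\beta}(\Psi^{2^n})\big)^{2^{-n}}$ for $n\in\mathbb N\cup\{0\}$. Then $$r(S_{\alpha,\beta}(\Psi))=r_0\le r_1\le\cdots\le r_n\le r(\Psi)^{\alpha+\beta}.$$
   Context: $R$ is $\{1,\dots,N\}$ for some $N\in\mathbb N$ or $R=\mathbb N$. A nonnegative matrix $A=[a_{ij}]_{i,j\in R}$ defines an operator on $l^2(R)$ if $Ax\in l^2(R)$ for all $x\in l^2(R)$, where $(Ax)_i=\sum_j a_{ij}x_j$. $A^*$ is the transpose (adjoint) and Hadamard powers/products are entrywise: $(A^{(\alpha)}\circ B^{(\beta)})_{ij}=a_{ij}^{\alpha}b_{ij}^{\beta}$. For a bounded set $\Psi$: $\Psi^*=\{A^*:A\in\Psi\}$, $S_{\alpha,\beta}(\Psi)=\Psi^{(\alpha)}\circ(\Psi^* )^{(\beta)}=\{A^{(\alpha)}\circ(B^* )^{(\beta)}:A,B\in\Psi\}$ (a bounded set of nonnegative matrices defining operators on $l^2(R)$ when $\alpha+\beta\ge1$), $\Psi^k=\{A_1\cdots A_k:A_i\in\Psi\}$. For a bounded set $\Sigma$ of bounded operators: $\rho(\Sigma)=\limsup_k[\sup_{A\in\Sigma^k}\rho(A)]^{1/k}$ and $\hat\rho(\Sigma)=\lim_k[\sup_{A\in\Sigma^k}\|A\|]^{1/k}$.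 *)

theory Defs
  imports "HOL-Analysis.Analysis"
begin

text \<open>Index sets: R = {1..N} (N \<ge> 1) or R = {1..} (a copy of the naturals).
  Matrices are functions nat \<Rightarrow> nat \<Rightarrow> real; only entries indexed by R \<times> R matter.
  Vectors of l^2(R) are complex sequences vanishing outside R with square summable moduli.\<close>

definition index_set :: "nat set \<Rightarrow> bool" where
  "index_set R \<longleftrightarrow> (\<exists>N\<ge>1. R = {1..N}) \<or> R = {1..}"

type_synonym mat = "nat \<Rightarrow> nat \<Rightarrow> real"

definition l2 :: "nat set \<Rightarrow> (nat \<Rightarrow> complex) set" where
  "l2 R = {x. (\<forall>i. i \<notin> R \<longrightarrow> x i = 0) \<and> (\<lambda>i. (cmod (x i))\<^sup>2) summable_on R}"

definition l2norm :: "nat set \<Rightarrow> (nat \<Rightarrow> complex) \<Rightarrow> real" where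
  "l2norm R x = sqrt (\<Sum>\<^sub>\<infinity>i\<in>R. (cmod (x i))\<^sup>2)"

definition matvec :: "nat set \<Rightarrow> mat \<Rightarrow> (nat \<Rightarrow> complex) \<Rightarrow> nat \<Rightarrow> complex" where
  "matvec R A x i = (if i \<in> R then (\<Sum>\<^sub>\<infinity>j\<in>R. complex_of_real (A i j) * x j) else 0)"

definition nonneg_mat :: "nat set \<Rightarrow> mat \<Rightarrow> bool" where
  "nonneg_mat R A \<longleftrightarrow> (\<forall>i\<in>R. \<forall>j\<in>R. 0 \<le> A i j)"

definition defines_op :: "nat set \<Rightarrow> mat \<Rightarrow> bool" where
  "defines_op R A \<longleftrightarrow> (\<forall>x\<in>l2 R. (\<forall>i\<in>R. (\<lambda>j. complex_of_real (A i j) * x j) summable_on R)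
                                    \<and> matvec R A x \<in> l2 R)"

definition opnorm :: "nat set \<Rightarrow> mat \<Rightarrow> real" where
  "opnorm R A = Sup {l2norm R (matvec R A x) | x. x \<in> l2 R \<and> l2norm R x \<le> 1}"

definition spec :: "nat set \<Rightarrow> mat \<Rightarrow> complex set" where
  "spec R A = {c. \<not> bij_betw (\<lambda>x i. matvec R A x i - c * x i) (l2 R) (l2 R)}"

definition specrad :: "nat set \<Rightarrow> mat \<Rightarrow> real" where
  "specrad R A = Sup (cmod ` spec R A)"

definition matmul :: "nat set \<Rightarrow> mat \<Rightarrow> mat \<Rightarrow> mat" where
  "matmul R A B = (\<lambda>i j. \<Sum>\<^sub>\<infinity>k\<in>R. A i k * B k j)"

definition idmat :: mat where
  "idmat = (\<lambda>i j. if i = j then 1 else 0)"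

definition transp :: "mat \<Rightarrow> mat" where
  "transp A = (\<lambda>i j. A j i)"

text \<open>Hadamard power, with the convention 0^0 = 1.\<close>
definition hpow :: "mat \<Rightarrow> real \<Rightarrow> mat" where
  "hpow A a = (\<lambda>i j. if a = 0 then 1 else A i j powr a)"

definition hadamard :: "mat \<Rightarrow> mat \<Rightarrow> mat" where
  "hadamard A B = (\<lambda>i j. A i j * B i j)"

fun setpow :: "nat set \<Rightarrow> mat set \<Rightarrow> nat \<Rightarrow> mat set" where
  "setpow R \<Psi> 0 = {idmat}"
| "setpow R \<Psi> (Suc 0) = \<Psi>"
| "setpow R \<Psi> (Suc k) = {matmul R A B | A B. A \<in> setpow R \<Psi> k \<and> B \<in> \<Psi>}"

definition S_ab :: "real \<Rightarrow> real \<Rightarrow> mat set \<Rightarrow> mat set" where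
  "S_ab a b \<Psi> = {hadamard (hpow A a) (hpow (transp B) b) | A B. A \<in> \<Psi> \<and> B \<in> \<Psi>}"

definition bounded_matset :: "nat set \<Rightarrow> mat set \<Rightarrow> bool" where
  "bounded_matset R \<Psi> \<longleftrightarrow> \<Psi> \<noteq> {} \<and> (\<forall>A\<in>\<Psi>. defines_op R A) \<and> bdd_above (opnorm R ` \<Psi>)"

definition jsr :: "nat set \<Rightarrow> mat set \<Rightarrow> real" where
  "jsr R \<Sigma> = real_of_ereal (limsup (\<lambda>k. ereal (root k (SUP A\<in>setpow R \<Sigma> k. specrad R A))))"

definition gsr :: "nat set \<Rightarrow> mat set \<Rightarrow> real" where
  "gsr R \<Sigma> = lim (\<lambda>k. root k (SUP A\<in>setpow R \<Sigma> k. opnorm R A))"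

end

theory Submission
  imports Defs
begin

text \<open>
  Write \<open>s = \<alpha> + \<beta>\<close>. By the weighted AM-GM inequality, and because \<open>t powr s \<le> t\<close> on \<open>[0, 1]\<close> for
  \<open>s \<ge> 1\<close>, Hadamard products satisfy
  \<open>(A\<^sup>\<alpha> \<circ> B\<^sup>\<beta>) (C\<^sup>\<alpha> \<circ> D\<^sup>\<beta>) \<le> (A C)\<^sup>\<alpha> \<circ> (B D)\<^sup>\<beta>\<close> entrywise, and the norm of \<open>A\<^sup>\<alpha> \<circ> B\<^sup>\<beta>\<close>
  is at most \<open>c powr s\<close> if \<open>A\<close> and \<open>B\<close> have norm at most \<open>c\<close>. Hence every product of \<open>2 k\<close> elements of
  \<open>S (\<Psi> ^ m)\<close> is dominated by a product of \<open>k\<close> elements of \<open>S (\<Psi> ^ (2 m))\<close>, and every product of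
  \<open>k\<close> elements of \<open>S (\<Psi> ^ m)\<close> by an element of \<open>S (\<Psi> ^ (m k))\<close>. Since the operator norm and the
  spectral radius are monotone on nonnegative matrices, this yields both inequalities. Monotonicity
  of the spectral radius follows from Gelfand's formula, which for a nonnegative matrix \<open>A\<close> has an
  elementary proof: the growth rate \<open>L\<close> of the powers of \<open>A\<close> lies in the spectrum. Otherwise the
  resolvent would stay bounded by some \<open>K\<close> as the parameter decreases to \<open>L\<close>, and since its square
  dominates each term \<open>(n + 1) A ^ n / L ^ (n + 2)\<close> of its power series, \<open>n + 1\<close> would be bounded by a
  multiple of \<open>K\<^sup>2\<close>.
\<close>

text \<open>The spectrum is defined through bijectivity on \<open>l2 R\<close> alone, so a point
  outside it comes with no bounded inverse. Surjectivity of \<open>A - L\<close> still bounds the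
  transposed operator from below on nonnegative vectors, and since the powers of
  \<open>transp A\<close> have the norms of those of \<open>A\<close>, the resolvent estimate is
  carried out for the transpose. Nonnegative vectors suffice there, because they already determine
  the norm of a nonnegative matrix. The other half of Gelfand's formula, that no spectral value
  exceeds \<open>L\<close> in modulus, is a Neumann series. The transposes in \<open>S_ab\<close>
  are compatible with products: a product of transposes is the transpose of the product in reverse
  order, and reversing the order does not lead out of a power of \<Psi>. It is replaced by doubling:
  the square of an element of the \<open>k\<close>-th power agrees on \<open>R \<times> R\<close>
  with an element of the \<open>2 * k\<close>-th power.\<close>

section \<open>Bounds on finite sections\<close>

text \<open>For nonnegative \<open>A\<close> and \<open>C\<close> this is equivalent to \<open>defines_op R A\<close> together with
  \<open>opnorm R A \<le> C\<close>, but it involves finite sums only and is symmetric in rows and columns.\<close>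

definition form_bounded :: "nat set \<Rightarrow> mat \<Rightarrow> real \<Rightarrow> bool" where
  "form_bounded R A C \<longleftrightarrow> nonneg_mat R A \<and> 0 \<le> C \<and>
     (\<forall>F G x y. finite F \<and> F \<subseteq> R \<and> finite G \<and> G \<subseteq> R \<longrightarrow>
        (\<Sum>i\<in>F. \<Sum>j\<in>G. \<bar>y i\<bar> * A i j * \<bar>x j\<bar>) \<le> C * L2_set y F * L2_set x G)"

definition mat_le :: "nat set \<Rightarrow> mat \<Rightarrow> mat \<Rightarrow> bool" where
  "mat_le R A B \<longleftrightarrow> (\<forall>i\<in>R. \<forall>j\<in>R. A i j \<le> B i j)"

lemma mat_le_refl [simp]: "mat_le R A A"
  by (simp add: mat_le_def)

lemma mat_le_trans: "mat_le R A B \<Longrightarrow> mat_le R B D \<Longrightarrow> mat_le R A D"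
  unfolding mat_le_def by (meson order_trans)

lemma nonneg_mat_le: "nonneg_mat R A \<Longrightarrow> mat_le R A B \<Longrightarrow> nonneg_mat R B"
  unfolding mat_le_def nonneg_mat_def by (meson order_trans)

lemma form_bounded_nonneg: "form_bounded R A C \<Longrightarrow> nonneg_mat R A"
  by (simp add: form_bounded_def)

lemma form_bounded_const_nonneg: "form_bounded R A C \<Longrightarrow> 0 \<le> C"
  by (simp add: form_bounded_def)

lemma form_boundedD:
  assumes "form_bounded R A C" "finite F" "F \<subseteq> R" "finite G" "G \<subseteq> R"
  shows "(\<Sum>i\<in>F. \<Sum>j\<in>G. \<bar>y i\<bar> * A i j * \<bar>x j\<bar>) \<le> C * L2_set y F * L2_set x G"
  using assms unfolding form_bounded_def by blast

lemma form_bounded_mono: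
  assumes "form_bounded R A C" "C \<le> D"
  shows "form_bounded R A D"
proof -
  have "C * L2_set y F * L2_set x G \<le> D * L2_set y F * L2_set x G" for x y :: "nat \<Rightarrow> real" and F G
    using assms by (intro mult_right_mono) auto
  then show ?thesis
    using assms unfolding form_bounded_def by (meson order_trans)
qed

lemma form_bounded_mat_le:
  assumes "form_bounded R B C" "nonneg_mat R A" "mat_le R A B"
  shows "form_bounded R A C"
proof -
  have "(\<Sum>i\<in>F. \<Sum>j\<in>G. \<bar>y i\<bar> * A i j * \<bar>x j\<bar>) \<le> C * L2_set y F * L2_set x G"
    if "finite F" "F \<subseteq> R" "finite G" "G \<subseteq> R" for F G x y
  proof -
    have "(\<Sum>i\<in>F. \<Sum>j\<in>G. \<bar>y i\<bar> * A i j * \<bar>x j\<bar>) \<le> (\<Sum>i\<in>F. \<Sum>j\<in>G. \<bar>y i\<bar> * B i j * \<bar>x j\<bar>)"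
      using assms that unfolding mat_le_def
      by (intro sum_mono mult_right_mono mult_left_mono) auto
    then show ?thesis
      using form_boundedD[OF assms(1) that] order_trans by blast
  qed
  then show ?thesis
    using assms by (simp add: form_bounded_def)
qed

lemma form_bounded_transp:
  assumes "form_bounded R A C"
  shows "form_bounded R (transp A) C"
proof -
  have "(\<Sum>i\<in>F. \<Sum>j\<in>G. \<bar>y i\<bar> * transp A i j * \<bar>x j\<bar>) \<le> C * L2_set y F * L2_set x G"
    if "finite F" "F \<subseteq> R" "finite G" "G \<subseteq> R" for F G x y
  proof -
    have "(\<Sum>i\<in>F. \<Sum>j\<in>G. \<bar>y i\<bar> * transp A i j * \<bar>x j\<bar>)
        = (\<Sum>j\<in>G. \<Sum>i\<in>F. \<bar>x j\<bar> * A j i * \<bar>y i\<bar>)"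
      by (subst sum.swap) (simp add: transp_def mult_ac)
    also have "\<dots> \<le> C * L2_set x G * L2_set y F"
      using form_boundedD[OF assms] that by blast
    finally show ?thesis by (simp add: mult_ac)
  qed
  then show ?thesis
    using assms by (simp add: form_bounded_def nonneg_mat_def transp_def)
qed

text \<open>The left side of the first assumption is the square of \<open>L2_set y F\<close>, so one
  factor cancels, unless it vanishes and the claim is \<open>0 \<le> K\<close>. This turns a bound
  for a form tested against \<open>y\<close> itself into a bound for the norm of
  \<open>y\<close>.\<close>

lemma L2_set_leI:
  assumes "(\<Sum>i\<in>F. y i * y i) \<le> K * L2_set y F" "0 \<le> K"
  shows "L2_set y F \<le> K"
proof -
  have "L2_set y F * L2_set y F \<le> K * L2_set y F"
    using assms(1) by (simp add: L2_set_def sum_nonneg power2_eq_square)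
  then show ?thesis
    using assms(2) by (metis L2_set_nonneg mult_le_cancel_right_pos order_le_less)
qed

text \<open>Testing the form with the image vector as \<open>y\<close> produces the square of its
  norm. With \<open>form_boundedI\<close>, the converse by Cauchy-Schwarz, boundedness can be used
  as a property of the form or of the operator.\<close>

lemma form_bounded_apply:
  assumes "form_bounded R A C" "finite F" "F \<subseteq> R" "finite G" "G \<subseteq> R"
  shows "L2_set (\<lambda>i. \<Sum>j\<in>G. A i j * \<bar>x j\<bar>) F \<le> C * L2_set x G"
proof -
  define y where "y = (\<lambda>i. \<Sum>j\<in>G. A i j * \<bar>x j\<bar>)"
  have y: "0 \<le> y i" if "i \<in> F" for i
    using that assms unfolding y_def form_bounded_def nonneg_mat_def
    by (intro sum_nonneg mult_nonneg_nonneg) auto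
  have "(\<Sum>i\<in>F. y i * y i) = (\<Sum>i\<in>F. \<Sum>j\<in>G. \<bar>y i\<bar> * A i j * \<bar>x j\<bar>)"
  proof (intro sum.cong refl)
    fix i assume "i \<in> F"
    then have "y i * y i = \<bar>y i\<bar> * (\<Sum>j\<in>G. A i j * \<bar>x j\<bar>)"
      using y by (simp add: y_def)
    then show "y i * y i = (\<Sum>j\<in>G. \<bar>y i\<bar> * A i j * \<bar>x j\<bar>)"
      by (simp add: sum_distrib_left mult.assoc)
  qed
  also have "\<dots> \<le> (C * L2_set x G) * L2_set y F"
    using form_boundedD[OF assms, of y x] by (simp add: mult_ac)
  finally have "L2_set y F \<le> C * L2_set x G"
    using form_bounded_const_nonneg[OF assms(1)] by (intro L2_set_leI) auto
  then show ?thesis by (simp add: y_def)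
qed

lemma form_boundedI:
  assumes "nonneg_mat R A" "0 \<le> C"
    and "\<And>F G x. finite F \<Longrightarrow> F \<subseteq> R \<Longrightarrow> finite G \<Longrightarrow> G \<subseteq> R \<Longrightarrow>
           L2_set (\<lambda>i. \<Sum>j\<in>G. A i j * \<bar>x j\<bar>) F \<le> C * L2_set x G"
  shows "form_bounded R A C"
proof -
  have "(\<Sum>i\<in>F. \<Sum>j\<in>G. \<bar>y i\<bar> * A i j * \<bar>x j\<bar>) \<le> C * L2_set y F * L2_set x G"
    if "finite F" "F \<subseteq> R" "finite G" "G \<subseteq> R" for F G x y
  proof -
    have "(\<Sum>i\<in>F. \<Sum>j\<in>G. \<bar>y i\<bar> * A i j * \<bar>x j\<bar>) = (\<Sum>i\<in>F. \<bar>y i\<bar> * (\<Sum>j\<in>G. A i j * \<bar>x j\<bar>))"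
      by (simp add: sum_distrib_left mult.assoc)
    also have "\<dots> \<le> (\<Sum>i\<in>F. \<bar>y i\<bar> * \<bar>\<Sum>j\<in>G. A i j * \<bar>x j\<bar>\<bar>)"
      by (intro sum_mono mult_left_mono) auto
    also have "\<dots> \<le> L2_set y F * L2_set (\<lambda>i. \<Sum>j\<in>G. A i j * \<bar>x j\<bar>) F"
      by (rule L2_set_mult_ineq)
    also have "\<dots> \<le> L2_set y F * (C * L2_set x G)"
      using assms(3)[OF that] by (intro mult_left_mono) auto
    finally show ?thesis by (simp add: mult_ac)
  qed
  then show ?thesis
    using assms by (simp add: form_bounded_def)
qed

lemma form_bounded_entry:
  assumes "form_bounded R A C" "i \<in> R" "j \<in> R"
  shows "A i j \<le> C"
  using form_boundedD[OF assms(1), of "{i}" "{j}" "\<lambda>_. 1" "\<lambda>_. 1"] assms by simp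

lemma form_bounded_col:
  assumes "form_bounded R A C" "j \<in> R" "finite F" "F \<subseteq> R"
  shows "L2_set (\<lambda>i. A i j) F \<le> C"
  using form_bounded_apply[OF assms(1,3,4), of "{j}" "\<lambda>_. 1"] assms by simp

lemma form_bounded_row:
  assumes "form_bounded R A C" "i \<in> R" "finite F" "F \<subseteq> R"
  shows "L2_set (A i) F \<le> C"
  using form_bounded_col[OF form_bounded_transp[OF assms(1)] assms(2-4)] by (simp add: transp_def)

section \<open>Matrix products and interchange of sums\<close>

lemma mult_le_abs_mult_abs: "a * b \<le> \<bar>a\<bar> * \<bar>b\<bar>" for a b :: real
  by (simp flip: abs_mult)

lemma has_sum_finite_sum:
  fixes f :: "'a \<Rightarrow> 'b \<Rightarrow> 'c::topological_comm_monoid_add"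
  assumes "finite F" "\<And>i. i \<in> F \<Longrightarrow> (f i has_sum s i) A"
  shows "((\<lambda>x. \<Sum>i\<in>F. f i x) has_sum (\<Sum>i\<in>F. s i)) A"
  using assms by (induction F rule: finite_induct) (auto intro: has_sum_add)

lemma matmul_partial_le:
  assumes "form_bounded R A C" "form_bounded R B D" "i \<in> R" "j \<in> R" "finite H" "H \<subseteq> R"
  shows "(\<Sum>k\<in>H. A i k * B k j) \<le> C * D"
proof -
  have "(\<Sum>k\<in>H. A i k * B k j) \<le> (\<Sum>k\<in>H. \<bar>A i k\<bar> * \<bar>B k j\<bar>)"
    by (rule sum_mono) (rule mult_le_abs_mult_abs)
  also have "\<dots> \<le> L2_set (A i) H * L2_set (\<lambda>k. B k j) H"
    by (rule L2_set_mult_ineq)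
  also have "\<dots> \<le> C * D"
    using assms form_bounded_row form_bounded_col form_bounded_const_nonneg by (intro mult_mono) auto
  finally show ?thesis .
qed

lemma matmul_has_sum:
  assumes "form_bounded R A C" "form_bounded R B D" "i \<in> R" "j \<in> R"
  shows "((\<lambda>k. A i k * B k j) has_sum matmul R A B i j) R"
proof -
  have "(\<lambda>k. A i k * B k j) summable_on R"
  proof (rule nonneg_bdd_above_summable_on)
    show "0 \<le> A i k * B k j" if "k \<in> R" for k
      using that assms by (simp add: form_bounded_def nonneg_mat_def)
    show "bdd_above (sum (\<lambda>k. A i k * B k j) ` {F. F \<subseteq> R \<and> finite F})"
      using matmul_partial_le[OF assms] by (auto intro!: bdd_aboveI2)
  qed
  then show ?thesis by (simp add: matmul_def)
qed

lemma nonneg_matmul: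
  assumes "nonneg_mat R A" "nonneg_mat R B"
  shows "nonneg_mat R (matmul R A B)"
  using assms by (auto simp: nonneg_mat_def matmul_def intro!: infsum_nonneg)

text \<open>For a finite set \<open>H\<close> of inner indices the form splits into the pairing of
  \<open>transp A\<close> applied to \<open>y\<close> with \<open>B\<close> applied to
  \<open>x\<close>. Cauchy-Schwarz bounds this independently of \<open>H\<close>, and the form of
  the product is the sum over all inner indices.\<close>

lemma form_bounded_matmul:
  assumes A: "form_bounded R A C" and B: "form_bounded R B D"
  shows "form_bounded R (matmul R A B) (C * D)"
proof -
  have C: "0 \<le> C" "0 \<le> D"
    using assms form_bounded_const_nonneg by blast+
  have "(\<Sum>i\<in>F. \<Sum>j\<in>G. \<bar>y i\<bar> * matmul R A B i j * \<bar>x j\<bar>) \<le> C * D * L2_set y F * L2_set x G"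
    if FG: "finite F" "F \<subseteq> R" "finite G" "G \<subseteq> R" for F G x y
  proof (rule has_sum_le_finite_sums)
    show "((\<lambda>k. \<Sum>i\<in>F. \<Sum>j\<in>G. \<bar>y i\<bar> * (A i k * B k j) * \<bar>x j\<bar>) has_sum
        (\<Sum>i\<in>F. \<Sum>j\<in>G. \<bar>y i\<bar> * matmul R A B i j * \<bar>x j\<bar>)) R"
    proof (rule has_sum_finite_sum[OF FG(1)], rule has_sum_finite_sum[OF FG(3)])
      fix i j assume "i \<in> F" "j \<in> G"
      then have "((\<lambda>k. A i k * B k j) has_sum matmul R A B i j) R"
        using FG matmul_has_sum[OF A B] by auto
      then show "((\<lambda>k. \<bar>y i\<bar> * (A i k * B k j) * \<bar>x j\<bar>) has_sum \<bar>y i\<bar> * matmul R A B i j * \<bar>x j\<bar>) R"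
        by (rule has_sum_cmult_left[OF has_sum_cmult_right])
    qed
    fix H assume H: "finite H" "H \<subseteq> R"
    have "(\<Sum>k\<in>H. \<Sum>i\<in>F. \<Sum>j\<in>G. \<bar>y i\<bar> * (A i k * B k j) * \<bar>x j\<bar>)
        = (\<Sum>k\<in>H. (\<Sum>i\<in>F. transp A k i * \<bar>y i\<bar>) * (\<Sum>j\<in>G. B k j * \<bar>x j\<bar>))"
    proof (rule sum.cong[OF refl])
      fix k
      have "(\<Sum>i\<in>F. transp A k i * \<bar>y i\<bar>) * (\<Sum>j\<in>G. B k j * \<bar>x j\<bar>)
          = (\<Sum>i\<in>F. \<Sum>j\<in>G. (transp A k i * \<bar>y i\<bar>) * (B k j * \<bar>x j\<bar>))"
        by (rule sum_product)
      also have "\<dots> = (\<Sum>i\<in>F. \<Sum>j\<in>G. \<bar>y i\<bar> * (A i k * B k j) * \<bar>x j\<bar>)"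
        by (simp only: transp_def mult_ac)
      finally show "(\<Sum>i\<in>F. \<Sum>j\<in>G. \<bar>y i\<bar> * (A i k * B k j) * \<bar>x j\<bar>)
          = (\<Sum>i\<in>F. transp A k i * \<bar>y i\<bar>) * (\<Sum>j\<in>G. B k j * \<bar>x j\<bar>)" ..
    qed
    also have "\<dots> \<le> (\<Sum>k\<in>H. \<bar>\<Sum>i\<in>F. transp A k i * \<bar>y i\<bar>\<bar> * \<bar>\<Sum>j\<in>G. B k j * \<bar>x j\<bar>\<bar>)"
      by (rule sum_mono) (rule mult_le_abs_mult_abs)
    also have "\<dots> \<le> L2_set (\<lambda>k. \<Sum>i\<in>F. transp A k i * \<bar>y i\<bar>) H * L2_set (\<lambda>k. \<Sum>j\<in>G. B k j * \<bar>x j\<bar>) H"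
      by (rule L2_set_mult_ineq)
    also have "\<dots> \<le> (C * L2_set y F) * (D * L2_set x G)"
      using C by (intro mult_mono form_bounded_apply[OF form_bounded_transp[OF A] H FG(1,2)]
          form_bounded_apply[OF B H FG(3,4)]) auto
    finally show "(\<Sum>k\<in>H. \<Sum>i\<in>F. \<Sum>j\<in>G. \<bar>y i\<bar> * (A i k * B k j) * \<bar>x j\<bar>)
        \<le> C * D * L2_set y F * L2_set x G"
      by (simp add: mult_ac)
  qed
  then show ?thesis
    using C nonneg_matmul assms by (simp add: form_bounded_def)
qed

lemma matmul_mono:
  assumes "mat_le R A A'" "mat_le R B B'" "nonneg_mat R A" "nonneg_mat R B"
    and A': "form_bounded R A' C" and B': "form_bounded R B' D"
  shows "mat_le R (matmul R A B) (matmul R A' B')"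
proof -
  have A: "form_bounded R A C" and B: "form_bounded R B D"
    using assms form_bounded_mat_le by blast+
  have "matmul R A B i j \<le> matmul R A' B' i j" if ij: "i \<in> R" "j \<in> R" for i j
  proof (rule has_sum_mono[OF matmul_has_sum[OF A B ij] matmul_has_sum[OF A' B' ij]])
    fix k assume "k \<in> R"
    then show "A i k * B k j \<le> A' i k * B' k j"
      using assms ij nonneg_mat_le[OF assms(3,1)]
      unfolding mat_le_def nonneg_mat_def by (intro mult_mono) auto
  qed
  then show ?thesis by (simp add: mat_le_def)
qed

lemma transp_matmul:
  "transp (matmul R A B) = matmul R (transp B) (transp A)"
  by (simp add: transp_def matmul_def mult.commute)

text \<open>A finite subset of the product lies in the rectangle spanned by its projections, so
  bounds on finite rectangles, which is what bilinear forms provide, are enough.\<close>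

lemma abs_summable_on_prod:
  fixes f :: "nat \<Rightarrow> nat \<Rightarrow> 'a::real_normed_vector"
  assumes "\<And>F G. finite F \<Longrightarrow> F \<subseteq> X \<Longrightarrow> finite G \<Longrightarrow> G \<subseteq> Y \<Longrightarrow> (\<Sum>i\<in>F. \<Sum>j\<in>G. norm (f i j)) \<le> M"
  shows "(\<lambda>(i, j). f i j) abs_summable_on X \<times> Y"
proof -
  have "sum (\<lambda>z. norm (case z of (i, j) \<Rightarrow> f i j)) H \<le> M" if "finite H" "H \<subseteq> X \<times> Y" for H
  proof -
    have "sum (\<lambda>z. norm (case z of (i, j) \<Rightarrow> f i j)) H
        \<le> sum (\<lambda>z. norm (case z of (i, j) \<Rightarrow> f i j)) (fst ` H \<times> snd ` H)"
    proof (rule sum_mono2)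
      show "finite (fst ` H \<times> snd ` H)" "H \<subseteq> fst ` H \<times> snd ` H"
        using that by force+
    qed simp
    also have "\<dots> = (\<Sum>i\<in>fst ` H. \<Sum>j\<in>snd ` H. norm (f i j))"
      by (simp add: sum.cartesian_product case_prod_unfold)
    also have "\<dots> \<le> M"
      using that by (intro assms) auto
    finally show ?thesis .
  qed
  then show ?thesis
    unfolding abs_summable_iff_bdd_above by (auto intro!: bdd_aboveI2)
qed

lemma infsum_swap_bounded:
  fixes f :: "nat \<Rightarrow> nat \<Rightarrow> 'a::banach"
  assumes "\<And>F G. finite F \<Longrightarrow> F \<subseteq> X \<Longrightarrow> finite G \<Longrightarrow> G \<subseteq> Y \<Longrightarrow> (\<Sum>i\<in>F. \<Sum>j\<in>G. norm (f i j)) \<le> M"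
  shows "(\<Sum>\<^sub>\<infinity>i\<in>X. \<Sum>\<^sub>\<infinity>j\<in>Y. f i j) = (\<Sum>\<^sub>\<infinity>j\<in>Y. \<Sum>\<^sub>\<infinity>i\<in>X. f i j)"
  using infsum_swap_banach[OF abs_summable_summable[OF abs_summable_on_prod[OF assms]]] .

text \<open>Associativity is an interchange of two sums. The absolute double sum is the form of
  \<open>B\<close> at row \<open>i\<close> of \<open>A\<close> and column \<open>j\<close> of
  \<open>E\<close>, and rows and columns of bounded matrices are square summable.\<close>

lemma matmul_assoc:
  assumes A: "form_bounded R A C" and B: "form_bounded R B D" and E: "form_bounded R E M"
    and ij: "i \<in> R" "j \<in> R"
  shows "matmul R (matmul R A B) E i j = matmul R A (matmul R B E) i j"
proof -
  have "matmul R (matmul R A B) E i j = (\<Sum>\<^sub>\<infinity>k\<in>R. \<Sum>\<^sub>\<infinity>l\<in>R. A i l * B l k * E k j)"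
    unfolding matmul_def by (simp add: infsum_cmult_left')
  also have "\<dots> = (\<Sum>\<^sub>\<infinity>l\<in>R. \<Sum>\<^sub>\<infinity>k\<in>R. A i l * B l k * E k j)"
  proof (rule infsum_swap_bounded)
    fix F G assume FG: "finite F" "F \<subseteq> R" "finite G" "G \<subseteq> R"
    have "(\<Sum>k\<in>F. \<Sum>l\<in>G. norm (A i l * B l k * E k j))
        = (\<Sum>l\<in>G. \<Sum>k\<in>F. \<bar>A i l\<bar> * B l k * \<bar>E k j\<bar>)"
      using form_bounded_nonneg[OF B] FG
      by (subst sum.swap) (auto intro!: sum.cong simp: abs_mult nonneg_mat_def subset_iff)
    also have "\<dots> \<le> D * L2_set (A i) G * L2_set (\<lambda>k. E k j) F"
      using FG by (intro form_boundedD[OF B])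
    also have "\<dots> \<le> D * C * M"
      using FG ij form_bounded_row[OF A] form_bounded_col[OF E] A B E
      by (intro mult_mono mult_left_mono mult_nonneg_nonneg) (auto dest: form_bounded_const_nonneg)
    finally show "(\<Sum>k\<in>F. \<Sum>l\<in>G. norm (A i l * B l k * E k j)) \<le> D * C * M" .
  qed
  also have "\<dots> = matmul R A (matmul R B E) i j"
    unfolding matmul_def by (simp add: infsum_cmult_right'[symmetric] mult.assoc)
  finally show ?thesis .
qed

lemma form_bounded_idmat: "form_bounded R idmat 1"
proof (rule form_boundedI)
  show "nonneg_mat R idmat"
    by (simp add: nonneg_mat_def idmat_def)
  fix F G :: "nat set" and x :: "nat \<Rightarrow> real"
  assume fin: "finite F" "finite G"
  have *: "(\<Sum>j\<in>G. idmat i j * \<bar>x j\<bar>) = (if i \<in> G then \<bar>x i\<bar> else 0)" for i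
    using fin by (simp add: idmat_def sum.delta if_distrib[of "\<lambda>c. c * _"] cong: if_cong)
  have "(\<Sum>i\<in>F. (if i \<in> G then \<bar>x i\<bar> else 0)\<^sup>2) = (\<Sum>i\<in>F \<inter> G. (x i)\<^sup>2)"
    using fin by (auto simp: sum.inter_restrict intro!: sum.cong)
  also have "\<dots> \<le> (\<Sum>i\<in>G. (x i)\<^sup>2)"
    using fin by (intro sum_mono2) auto
  finally show "L2_set (\<lambda>i. \<Sum>j\<in>G. idmat i j * \<bar>x j\<bar>) F \<le> 1 * L2_set x G"
    by (simp add: * L2_set_def)
qed simp

section \<open>Bounded matrices as operators on square summable vectors\<close>

lemma l2I:
  assumes "\<And>i. i \<notin> R \<Longrightarrow> x i = 0"
    and "\<And>F. finite F \<Longrightarrow> F \<subseteq> R \<Longrightarrow> L2_set (\<lambda>i. cmod (x i)) F \<le> M"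
  shows "x \<in> l2 R" "l2norm R x \<le> M"
proof -
  have M: "0 \<le> M"
    using assms(2)[of "{}"] by simp
  have sq: "(\<Sum>i\<in>F. (cmod (x i))\<^sup>2) \<le> M\<^sup>2" if "finite F" "F \<subseteq> R" for F
    using assms(2)[OF that] M by (auto simp: L2_set_def dest: sqrt_le_D)
  have sm: "(\<lambda>i. (cmod (x i))\<^sup>2) summable_on R"
    using sq by (intro nonneg_bdd_above_summable_on) (auto intro!: bdd_aboveI2)
  then show "x \<in> l2 R"
    using assms(1) by (simp add: l2_def)
  have "(\<Sum>\<^sub>\<infinity>i\<in>R. (cmod (x i))\<^sup>2) \<le> M\<^sup>2"
    using sm sq by (rule infsum_le_finite_sums)
  then show "l2norm R x \<le> M"
    unfolding l2norm_def using M by (simp add: real_le_lsqrt)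
qed

lemma L2_set_le_l2norm:
  assumes "x \<in> l2 R" "finite F" "F \<subseteq> R"
  shows "L2_set (\<lambda>i. cmod (x i)) F \<le> l2norm R x"
proof -
  have "(\<lambda>i. (cmod (x i))\<^sup>2) summable_on R"
    using assms(1) by (simp add: l2_def)
  then have "(\<Sum>i\<in>F. (cmod (x i))\<^sup>2) \<le> (\<Sum>\<^sub>\<infinity>i\<in>R. (cmod (x i))\<^sup>2)"
    using assms by (intro finite_sum_le_infsum) auto
  then show ?thesis
    by (simp add: L2_set_def l2norm_def)
qed

lemma l2_outside: "x \<in> l2 R \<Longrightarrow> i \<notin> R \<Longrightarrow> x i = 0"
  by (simp add: l2_def)

lemma l2norm_nonneg: "0 \<le> l2norm R x"
  by (simp add: l2norm_def infsum_nonneg)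

lemma l2_mono:
  assumes "y \<in> l2 R" "\<And>i. cmod (x i) \<le> cmod (y i)"
  shows "x \<in> l2 R" "l2norm R x \<le> l2norm R y"
proof -
  have 1: "x i = 0" if "i \<notin> R" for i
    using assms(2)[of i] l2_outside[OF assms(1) that] by simp
  have 2: "L2_set (\<lambda>i. cmod (x i)) F \<le> l2norm R y" if "finite F" "F \<subseteq> R" for F
    using L2_set_mono[of F "\<lambda>i. cmod (x i)" "\<lambda>i. cmod (y i)"] assms(2)
      L2_set_le_l2norm[OF assms(1) that] by fastforce
  show "x \<in> l2 R" "l2norm R x \<le> l2norm R y"
    using l2I[OF 1 2] by blast+
qed

lemma l2_add:
  assumes "x \<in> l2 R" "y \<in> l2 R"
  shows "(\<lambda>i. x i + y i) \<in> l2 R" "l2norm R (\<lambda>i. x i + y i) \<le> l2norm R x + l2norm R y"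
proof -
  have 1: "x i + y i = 0" if "i \<notin> R" for i
    using assms that by (simp add: l2_outside)
  have 2: "L2_set (\<lambda>i. cmod (x i + y i)) F \<le> l2norm R x + l2norm R y" if "finite F" "F \<subseteq> R" for F
  proof -
    have "L2_set (\<lambda>i. cmod (x i + y i)) F \<le> L2_set (\<lambda>i. cmod (x i) + cmod (y i)) F"
      by (rule L2_set_mono) (auto simp: norm_triangle_ineq)
    also have "\<dots> \<le> L2_set (\<lambda>i. cmod (x i)) F + L2_set (\<lambda>i. cmod (y i)) F"
      by (rule L2_set_triangle_ineq)
    also have "\<dots> \<le> l2norm R x + l2norm R y"
      using L2_set_le_l2norm[OF assms(1) that] L2_set_le_l2norm[OF assms(2) that] by simp
    finally show ?thesis .
  qed
  show "(\<lambda>i. x i + y i) \<in> l2 R" "l2norm R (\<lambda>i. x i + y i) \<le> l2norm R x + l2norm R y"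
    using l2I[OF 1 2] by blast+
qed

lemma l2_scale:
  assumes "x \<in> l2 R"
  shows "(\<lambda>i. c * x i) \<in> l2 R" "l2norm R (\<lambda>i. c * x i) = cmod c * l2norm R x"
proof -
  have "(\<lambda>i. (cmod (c * x i))\<^sup>2) = (\<lambda>i. (cmod c)\<^sup>2 * (cmod (x i))\<^sup>2)"
    by (simp add: norm_mult power_mult_distrib)
  then show "(\<lambda>i. c * x i) \<in> l2 R" "l2norm R (\<lambda>i. c * x i) = cmod c * l2norm R x"
    using assms by (auto simp: l2_def l2norm_def summable_on_cmult_right infsum_cmult_right' real_sqrt_mult)
qed

lemma l2_diff:
  assumes "x \<in> l2 R" "y \<in> l2 R"
  shows "(\<lambda>i. x i - y i) \<in> l2 R" "l2norm R (\<lambda>i. x i - y i) \<le> l2norm R x + l2norm R y"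
  using l2_add[OF assms(1) l2_scale(1)[OF assms(2), of "-1"]] l2_scale(2)[OF assms(2), of "-1"]
  by simp_all

lemma l2_zero: "(\<lambda>_. 0) \<in> l2 R" "l2norm R (\<lambda>_. 0) = 0"
  by (simp_all add: l2_def l2norm_def)

lemma l2_sum:
  assumes "finite K" "\<And>k. k \<in> K \<Longrightarrow> x k \<in> l2 R"
  shows "(\<lambda>i. \<Sum>k\<in>K. x k i) \<in> l2 R \<and> l2norm R (\<lambda>i. \<Sum>k\<in>K. x k i) \<le> (\<Sum>k\<in>K. l2norm R (x k))"
  using assms
proof (induction K rule: finite_induct)
  case empty
  then show ?case by (simp add: l2_zero)
next
  case (insert k K)
  then have IH: "(\<lambda>i. \<Sum>k\<in>K. x k i) \<in> l2 R"
    "l2norm R (\<lambda>i. \<Sum>k\<in>K. x k i) \<le> (\<Sum>k\<in>K. l2norm R (x k))" and k: "x k \<in> l2 R"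
    by auto
  show ?case
    using l2_add[OF k IH(1)] IH(2) insert(1,2) by simp
qed

lemma cmod_le_l2norm:
  assumes "x \<in> l2 R" shows "cmod (x i) \<le> l2norm R x"
proof (cases "i \<in> R")
  case True
  then show ?thesis using L2_set_le_l2norm[OF assms, of "{i}"] by simp
next
  case False
  then show ?thesis using assms by (simp add: l2_outside l2norm_nonneg)
qed

lemma matvec_abs_summable:
  assumes "form_bounded R A C" "x \<in> l2 R" "i \<in> R"
  shows "(\<lambda>j. A i j * cmod (x j)) summable_on R"
    and "(\<lambda>j. complex_of_real (A i j) * x j) summable_on R"
proof -
  have nn: "0 \<le> A i j" if "j \<in> R" for j
    using assms that by (simp add: form_bounded_def nonneg_mat_def)
  show sm: "(\<lambda>j. A i j * cmod (x j)) summable_on R"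
  proof (rule nonneg_bdd_above_summable_on)
    show "0 \<le> A i j * cmod (x j)" if "j \<in> R" for j
      using nn that by simp
    have "(\<Sum>j\<in>G. A i j * cmod (x j)) \<le> C * l2norm R x" if G: "finite G" "G \<subseteq> R" for G
    proof -
      have "(\<Sum>j\<in>G. A i j * cmod (x j)) \<le> C * L2_set (\<lambda>j. cmod (x j)) G"
        using form_bounded_apply[OF assms(1), of "{i}" G "\<lambda>j. cmod (x j)"] assms(3) G by simp
      also have "\<dots> \<le> C * l2norm R x"
        using L2_set_le_l2norm[OF assms(2) G] form_bounded_const_nonneg[OF assms(1)]
        by (rule mult_left_mono)
      finally show ?thesis .
    qed
    then show "bdd_above (sum (\<lambda>j. A i j * cmod (x j)) ` {F. F \<subseteq> R \<and> finite F})"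
      by (auto intro!: bdd_aboveI2)
  qed
  have "(\<lambda>j. norm (complex_of_real (A i j) * x j)) summable_on R
      \<longleftrightarrow> (\<lambda>j. A i j * cmod (x j)) summable_on R"
    by (rule summable_on_cong) (simp add: norm_mult nn)
  then show "(\<lambda>j. complex_of_real (A i j) * x j) summable_on R"
    using sm abs_summable_summable[of "\<lambda>j. complex_of_real (A i j) * x j" R] by blast
qed

lemma cmod_matvec_le:
  assumes "form_bounded R A C" "x \<in> l2 R" "i \<in> R"
  shows "cmod (matvec R A x i) \<le> (\<Sum>\<^sub>\<infinity>j\<in>R. A i j * cmod (x j))"
proof -
  have "0 \<le> A i j" if "j \<in> R" for j
    using assms that by (simp add: form_bounded_def nonneg_mat_def)
  then have eq: "norm (complex_of_real (A i j) * x j) = A i j * cmod (x j)" if "j \<in> R" for j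
    using that by (simp add: norm_mult)
  have "(\<lambda>j. norm (complex_of_real (A i j) * x j)) summable_on R"
    using summable_on_cong[of R "\<lambda>j. norm (complex_of_real (A i j) * x j)"] eq
      matvec_abs_summable(1)[OF assms] by simp
  then have "cmod (matvec R A x i) \<le> (\<Sum>\<^sub>\<infinity>j\<in>R. norm (complex_of_real (A i j) * x j))"
    unfolding matvec_def using assms(3) norm_infsum_bound by auto
  then show ?thesis
    using infsum_cong[of R "\<lambda>j. norm (complex_of_real (A i j) * x j)"] eq by simp
qed

text \<open>Moduli reduce complex vectors to nonnegative ones: a finite section of the image is
  tested against its own moduli \<open>y\<close>, each coordinate is replaced by the sum of the
  moduli of its terms, and the form bound applies to every finite set of columns.\<close>

lemma matvec_l2:
  assumes A: "form_bounded R A C" and x: "x \<in> l2 R"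
  shows "matvec R A x \<in> l2 R" "l2norm R (matvec R A x) \<le> C * l2norm R x"
proof -
  note C = form_bounded_const_nonneg[OF A]
  define y where "y = (\<lambda>i. cmod (matvec R A x i))"
  have 2: "L2_set y F \<le> C * l2norm R x" if F: "finite F" "F \<subseteq> R" for F
  proof (rule L2_set_leI)
    have "(\<Sum>i\<in>F. y i * y i) \<le> (\<Sum>i\<in>F. y i * (\<Sum>\<^sub>\<infinity>j\<in>R. A i j * cmod (x j)))"
      unfolding y_def using cmod_matvec_le[OF A x] F
      by (intro sum_mono[of F] mult_left_mono) auto
    also have "\<dots> \<le> C * l2norm R x * L2_set y F"
    proof (rule has_sum_le_finite_sums)
      show "((\<lambda>j. \<Sum>i\<in>F. y i * (A i j * cmod (x j))) has_sum
          (\<Sum>i\<in>F. y i * (\<Sum>\<^sub>\<infinity>j\<in>R. A i j * cmod (x j)))) R"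
      proof (rule has_sum_finite_sum[OF F(1)])
        fix i assume "i \<in> F"
        then have "((\<lambda>j. A i j * cmod (x j)) has_sum (\<Sum>\<^sub>\<infinity>j\<in>R. A i j * cmod (x j))) R"
          using matvec_abs_summable(1)[OF A x] F by auto
        then show "((\<lambda>j. y i * (A i j * cmod (x j))) has_sum
            y i * (\<Sum>\<^sub>\<infinity>j\<in>R. A i j * cmod (x j))) R"
          by (rule has_sum_cmult_right)
      qed
      fix G assume G: "finite G" "G \<subseteq> R"
      have "(\<Sum>j\<in>G. \<Sum>i\<in>F. y i * (A i j * cmod (x j)))
          = (\<Sum>i\<in>F. \<Sum>j\<in>G. \<bar>y i\<bar> * A i j * \<bar>cmod (x j)\<bar>)"
        by (subst sum.swap) (simp add: y_def mult.assoc)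
      also have "\<dots> \<le> C * L2_set y F * L2_set (\<lambda>j. cmod (x j)) G"
        using F G by (rule form_boundedD[OF A])
      also have "\<dots> \<le> C * L2_set y F * l2norm R x"
        using L2_set_le_l2norm[OF x G] C by (intro mult_left_mono) auto
      finally show "(\<Sum>j\<in>G. \<Sum>i\<in>F. y i * (A i j * cmod (x j))) \<le> C * l2norm R x * L2_set y F"
        by (simp add: mult_ac)
    qed
    finally show "(\<Sum>i\<in>F. y i * y i) \<le> C * l2norm R x * L2_set y F" .
    show "0 \<le> C * l2norm R x"
      using C by (simp add: l2norm_nonneg)
  qed
  have 1: "matvec R A x i = 0" if "i \<notin> R" for i
    using that by (simp add: matvec_def)
  show "matvec R A x \<in> l2 R" "l2norm R (matvec R A x) \<le> C * l2norm R x"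
    using l2I[OF 1 2[unfolded y_def]] by blast+
qed

section \<open>The operator norm as the least bound\<close>

lemma opnorm_le:
  assumes "form_bounded R A C"
  shows "opnorm R A \<le> C"
  unfolding opnorm_def
proof (rule cSup_least)
  show "{l2norm R (matvec R A x) |x. x \<in> l2 R \<and> l2norm R x \<le> 1} \<noteq> {}"
    using l2_zero[of R] by (metis (mono_tags, lifting) empty_iff mem_Collect_eq zero_le_one)
  fix v assume "v \<in> {l2norm R (matvec R A x) |x. x \<in> l2 R \<and> l2norm R x \<le> 1}"
  then obtain x where x: "x \<in> l2 R" "l2norm R x \<le> 1" "v = l2norm R (matvec R A x)"
    by blast
  show "v \<le> C"
    using matvec_l2(2)[OF assms x(1)] x form_bounded_const_nonneg[OF assms]
    by (meson mult_left_le order_trans)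
qed

lemma l2norm_matvec_le_opnorm:
  assumes "form_bounded R A C" "x \<in> l2 R" "l2norm R x \<le> 1"
  shows "l2norm R (matvec R A x) \<le> opnorm R A"
  unfolding opnorm_def
proof (rule cSup_upper)
  show "l2norm R (matvec R A x) \<in> {l2norm R (matvec R A x) |x. x \<in> l2 R \<and> l2norm R x \<le> 1}"
    using assms by blast
  have "l2norm R (matvec R A x) \<le> C" if "x \<in> l2 R" "l2norm R x \<le> 1" for x
    using matvec_l2(2)[OF assms(1) that(1)] that(2) form_bounded_const_nonneg[OF assms(1)]
    by (meson mult_left_le order_trans)
  then show "bdd_above {l2norm R (matvec R A x) |x. x \<in> l2 R \<and> l2norm R x \<le> 1}"
    by (auto intro!: bdd_aboveI)
qed

lemma l2_real_vector:
  fixes w :: "nat \<Rightarrow> real"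
  assumes "\<And>F. finite F \<Longrightarrow> F \<subseteq> R \<Longrightarrow> L2_set w F \<le> M"
  defines "v \<equiv> (\<lambda>i. if i \<in> R then complex_of_real (w i) else 0)"
  shows "v \<in> l2 R" "l2norm R v \<le> M"
proof -
  have 2: "L2_set (\<lambda>i. cmod (v i)) F \<le> M" if "finite F" "F \<subseteq> R" for F
  proof -
    have "L2_set (\<lambda>i. cmod (v i)) F = L2_set w F"
      using that(2) by (auto simp: L2_set_def v_def subset_iff intro!: sum.cong)
    then show ?thesis using assms(1)[OF that] by simp
  qed
  have 1: "v i = 0" if "i \<notin> R" for i
    using that by (simp add: v_def)
  show "v \<in> l2 R" "l2norm R v \<le> M"
    using l2I[OF 1 2] by blast+
qed

lemma L2_set_supported:
  assumes "finite F" "finite G" "\<And>i. i \<notin> G \<Longrightarrow> w i = 0"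
  shows "L2_set w F \<le> L2_set w G"
proof -
  have "(\<Sum>i\<in>F. (w i)\<^sup>2) = (\<Sum>i\<in>F \<inter> G. (w i)\<^sup>2)"
    using assms by (intro sum.mono_neutral_right) auto
  also have "\<dots> \<le> (\<Sum>i\<in>G. (w i)\<^sup>2)"
    using assms by (intro sum_mono2) auto
  finally show ?thesis by (simp add: L2_set_def)
qed

lemma L2_set_normalize:
  assumes "L2_set x G > 0"
  shows "L2_set (\<lambda>i. \<bar>x i\<bar> / L2_set x G) G = 1"
proof -
  have "L2_set (\<lambda>i. \<bar>x i\<bar> * (1 / L2_set x G)) G = L2_set (\<lambda>i. \<bar>x i\<bar>) G * (1 / L2_set x G)"
    using assms by (intro L2_set_left_distrib[symmetric]) auto
  also have "L2_set (\<lambda>i. \<bar>x i\<bar>) G = L2_set x G"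
    by (simp add: L2_set_def)
  finally show ?thesis using assms by simp
qed

lemma matvec_scale:
  assumes "form_bounded R A C" "x \<in> l2 R"
  shows "matvec R A (\<lambda>i. c * x i) = (\<lambda>i. c * matvec R A x i)"
  by (auto simp: matvec_def fun_eq_iff mult.left_commute[of _ c] infsum_cmult_right')

text \<open>The moduli of a finitely supported vector already realize the form, so testing
  nonnegative vectors is enough. This is why the resolvent has to be estimated on nonnegative
  vectors only.\<close>

lemma form_bounded_if_vector_bound:
  assumes nn: "nonneg_mat R A" and K: "0 \<le> K"
    and bd: "\<And>z. z \<in> l2 R \<Longrightarrow> (\<And>i. 0 \<le> z i) \<Longrightarrow>
          matvec R A z \<in> l2 R \<and> l2norm R (matvec R A z) \<le> K * l2norm R z"
  shows "form_bounded R A K"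
proof (rule form_boundedI[OF nn K])
  fix F G :: "nat set" and x :: "nat \<Rightarrow> real"
  assume FG: "finite F" "F \<subseteq> R" "finite G" "G \<subseteq> R"
  define w where "w = (\<lambda>j. if j \<in> G then \<bar>x j\<bar> else 0)"
  define z where "z = (\<lambda>i. if i \<in> R then complex_of_real (w i) else 0)"
  have "L2_set w G = L2_set x G"
    by (auto simp: w_def L2_set_def intro!: sum.cong)
  then have "L2_set w F \<le> L2_set x G" if "finite F" for F
    using L2_set_supported[OF that FG(3), of w] by (simp add: w_def)
  then have z: "z \<in> l2 R" "l2norm R z \<le> L2_set x G"
    unfolding z_def by (intro l2_real_vector; blast)+
  have z0: "0 \<le> z i" for i
    by (simp add: z_def w_def less_eq_complex_def)
  note Az = bd[OF z(1) z0]
  have mv: "matvec R A z i = complex_of_real (\<Sum>j\<in>G. A i j * \<bar>x j\<bar>)" if "i \<in> F" for i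
  proof -
    have "matvec R A z i = (\<Sum>\<^sub>\<infinity>j\<in>R. complex_of_real (A i j) * z j)"
      using that FG by (auto simp: matvec_def)
    also have "\<dots> = (\<Sum>\<^sub>\<infinity>j\<in>G. complex_of_real (A i j) * z j)"
      using FG by (intro infsum_cong_neutral) (auto simp: z_def w_def)
    also have "\<dots> = (\<Sum>j\<in>G. complex_of_real (A i j) * z j)"
      using FG by simp
    also have "\<dots> = (\<Sum>j\<in>G. complex_of_real (A i j * \<bar>x j\<bar>))"
      using FG by (intro sum.cong) (auto simp: z_def w_def)
    finally show ?thesis by simp
  qed
  have s0: "0 \<le> (\<Sum>j\<in>G. A i j * \<bar>x j\<bar>)" if "i \<in> F" for i
    using that FG nn unfolding nonneg_mat_def
    by (intro sum_nonneg mult_nonneg_nonneg) auto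
  have "L2_set (\<lambda>i. \<Sum>j\<in>G. A i j * \<bar>x j\<bar>) F = L2_set (\<lambda>i. cmod (matvec R A z i)) F"
    using s0 by (intro L2_set_cong refl) (simp add: mv del: of_real_sum)
  also have "\<dots> \<le> l2norm R (matvec R A z)"
    using Az FG by (intro L2_set_le_l2norm) auto
  also have "\<dots> \<le> K * L2_set x G"
    using Az z(2) K by (meson mult_left_mono order_trans)
  finally show "L2_set (\<lambda>i. \<Sum>j\<in>G. A i j * \<bar>x j\<bar>) F \<le> K * L2_set x G" .
qed

text \<open>Together with \<open>opnorm_le\<close> this makes the operator norm the least admissible
  constant, so that norm inequalities can be proved as statements about \<open>form_bounded\<close>
  and read back.\<close>

lemma form_bounded_opnorm:
  assumes A: "form_bounded R A C"
  shows "form_bounded R A (opnorm R A)"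
proof (rule form_bounded_if_vector_bound)
  show "nonneg_mat R A"
    using A by (rule form_bounded_nonneg)
  have "l2norm R (matvec R A (\<lambda>_. 0)) \<le> opnorm R A"
    by (rule l2norm_matvec_le_opnorm[OF A]) (auto simp: l2_zero)
  then show "0 \<le> opnorm R A"
    using l2norm_nonneg order_trans by blast
  fix z assume z: "z \<in> l2 R"
  have "l2norm R (matvec R A z) \<le> opnorm R A * l2norm R z"
  proof (cases "l2norm R z = 0")
    case True
    then show ?thesis using matvec_l2(2)[OF A z] by simp
  next
    case False
    then have pos: "l2norm R z > 0"
      using l2norm_nonneg[of R z] by simp
    define c where "c = complex_of_real (1 / l2norm R z)"
    have "l2norm R (matvec R A (\<lambda>i. c * z i)) \<le> opnorm R A"
      using l2_scale[OF z, of c] pos by (intro l2norm_matvec_le_opnorm[OF A]) (auto simp: c_def norm_divide)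
    then have "cmod c * l2norm R (matvec R A z) \<le> opnorm R A"
      using l2_scale(2)[OF matvec_l2(1)[OF A z]] matvec_scale[OF A z] by simp
    then show ?thesis
      using pos by (simp add: c_def norm_divide field_simps)
  qed
  then show "matvec R A z \<in> l2 R \<and> l2norm R (matvec R A z) \<le> opnorm R A * l2norm R z"
    using matvec_l2(1)[OF A z] by blast
qed

lemma opnorm_nonneg: "form_bounded R A C \<Longrightarrow> 0 \<le> opnorm R A"
  using form_bounded_opnorm form_bounded_const_nonneg by blast

section \<open>Automatic boundedness of nonnegative matrices\<close>

text \<open>Nonnegative vectors cannot cancel, so a weighted square mean replaces the gliding hump.\<close>

lemma dominating_vector:
  fixes w :: "nat \<Rightarrow> nat \<Rightarrow> real"
  assumes w: "\<And>n F. finite F \<Longrightarrow> F \<subseteq> R \<Longrightarrow> L2_set (w n) F \<le> 1"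
  obtains y :: "nat \<Rightarrow> real" where "\<And>i. 0 \<le> y i"
    "\<And>F. finite F \<Longrightarrow> F \<subseteq> R \<Longrightarrow> L2_set y F \<le> 2"
    "\<And>n i. i \<in> R \<Longrightarrow> \<bar>w n i\<bar> \<le> 2 ^ n * y i"
proof -
  have w1: "(w n i)\<^sup>2 \<le> 1" if "i \<in> R" for n i
    using w[of "{i}" n] that by (simp add: abs_square_le_1)
  \<comment> \<open>The weights sum to 4/3, which keeps the square norm of \<open>y\<close> below
    \<open>2\<^sup>2\<close>, and their square roots \<open>1 / 2 ^ n\<close> are the loss in the
    domination of \<open>w n\<close>.\<close>
  define q where "q = (\<lambda>i n. (w n i)\<^sup>2 * (1/4) ^ n)"
  have geo: "(\<lambda>n. (1/4::real) ^ n) sums (4/3)"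
    using geometric_sums[of "1/4::real"] by simp
  have sm: "summable (q i)" if "i \<in> R" for i
  proof (rule summable_comparison_test')
    show "summable (\<lambda>n. (1/4::real) ^ n)" using geo by (simp add: sums_iff)
    show "norm (q i n) \<le> (1/4) ^ n" for n
      using w1[OF that, of n] by (simp add: q_def mult_left_le_one_le)
  qed
  define y where "y = (\<lambda>i. if i \<in> R then sqrt (suminf (q i)) else 0)"
  have q0: "0 \<le> q i n" for i n by (simp add: q_def)
  have s0: "0 \<le> suminf (q i)" if "i \<in> R" for i
    using sm[OF that] q0 by (simp add: suminf_nonneg)
  show thesis
  proof (rule that[of y])
    show "0 \<le> y i" for i using s0 by (simp add: y_def)
    show "L2_set y F \<le> 2" if F: "finite F" "F \<subseteq> R" for F
    proof -
      have "(\<Sum>i\<in>F. (y i)\<^sup>2) = (\<Sum>i\<in>F. suminf (q i))"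
        using F s0 by (intro sum.cong) (auto simp: y_def)
      also have "\<dots> = (\<Sum>n. \<Sum>i\<in>F. q i n)"
        using F sm by (intro suminf_sum[symmetric]) auto
      also have "\<dots> \<le> (\<Sum>n. (1/4) ^ n)"
      proof (rule suminf_le)
        show "summable (\<lambda>n. \<Sum>i\<in>F. q i n)"
          using F sm by (intro summable_sum) auto
        show "summable (\<lambda>n. (1/4::real) ^ n)" using geo by (simp add: sums_iff)
        fix n
        have "(\<Sum>i\<in>F. (w n i)\<^sup>2) \<le> 1"
          using w[OF F, of n] by (simp add: L2_set_def)
        then show "(\<Sum>i\<in>F. q i n) \<le> (1/4) ^ n"
          by (simp add: q_def mult_left_le_one_le sum_nonneg flip: sum_distrib_right)
      qed
      also have "\<dots> \<le> 4"
        using geo by (simp add: sums_iff)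
      finally show ?thesis
        by (simp add: L2_set_def real_le_lsqrt)
    qed
    fix n i assume i: "i \<in> R"
    have "q i n \<le> suminf (q i)"
      using sum_le_suminf[OF sm[OF i], of "{n}"] q0 by simp
    moreover have "q i n = (w n i / 2 ^ n)\<^sup>2"
      by (simp add: q_def power_divide power2_eq_square flip: power_mult_distrib)
    ultimately have "\<bar>w n i\<bar> / 2 ^ n \<le> y i"
      using i by (simp add: y_def real_le_rsqrt power_divide)
    then show "\<bar>w n i\<bar> \<le> 2 ^ n * y i"
      by (simp add: field_simps)
  qed
qed

text \<open>If no constant \<open>4 ^ n\<close> works, there are finitely supported nonnegative unit
  vectors \<open>w n\<close> with images of norm beyond \<open>4 ^ n\<close>. One square summable
  vector dominates all of them up to the factors \<open>2 ^ n\<close>, so its image has norm beyond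
  \<open>2 ^ n\<close> for every \<open>n\<close>, although it lies in \<open>l2 R\<close>.\<close>

lemma defines_op_imp_form_bounded:
  assumes nn: "nonneg_mat R A" and A: "defines_op R A"
  obtains C where "form_bounded R A C"
proof (rule ccontr)
  assume "\<not> thesis"
  then have no: "\<not> form_bounded R A (4 ^ n)" for n
    using that by blast
  have "\<exists>F G x. finite F \<and> F \<subseteq> R \<and> finite G \<and> G \<subseteq> R \<and>
      4 ^ n * L2_set x G < L2_set (\<lambda>i. \<Sum>j\<in>G. A i j * \<bar>x j\<bar>) F" for n :: nat
  proof (rule ccontr)
    assume "\<not> ?thesis"
    then have "form_bounded R A (4 ^ n)"
      by (intro form_boundedI[OF nn]) (simp_all add: not_less)
    with no show False by blast
  qed
  then have "\<forall>n. \<exists>F G x. finite F \<and> F \<subseteq> R \<and> finite G \<and> G \<subseteq> R \<and>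
      4 ^ n * L2_set x G < L2_set (\<lambda>i. \<Sum>j\<in>G. A i j * \<bar>x j\<bar>) F" ..
  from choice[OF this] obtain F where "\<forall>n. \<exists>G x. finite (F n) \<and> F n \<subseteq> R \<and> finite G \<and> G \<subseteq> R \<and>
      4 ^ n * L2_set x G < L2_set (\<lambda>i. \<Sum>j\<in>G. A i j * \<bar>x j\<bar>) (F n)" ..
  from choice[OF this] obtain G where "\<forall>n. \<exists>x. finite (F n) \<and> F n \<subseteq> R \<and> finite (G n) \<and> G n \<subseteq> R \<and>
      4 ^ n * L2_set x (G n) < L2_set (\<lambda>i. \<Sum>j\<in>G n. A i j * \<bar>x j\<bar>) (F n)" ..
  from choice[OF this] obtain x where
    FG: "\<And>n. finite (F n)" "\<And>n. F n \<subseteq> R" "\<And>n. finite (G n)" "\<And>n. G n \<subseteq> R" and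
    big: "\<And>n. 4 ^ n * L2_set (x n) (G n) < L2_set (\<lambda>i. \<Sum>j\<in>G n. A i j * \<bar>x n j\<bar>) (F n)"
    by blast
  \<comment> \<open>If \<open>x n\<close> vanished on \<open>G n\<close>, so would its image,
    against the strict inequality \<open>big\<close>.\<close>
  have L: "L2_set (x n) (G n) > 0" for n
  proof (rule ccontr)
    assume "\<not> ?thesis"
    then have "L2_set (x n) (G n) = 0"
      by (simp add: antisym not_less)
    then have "x n j = 0" if "j \<in> G n" for j
      using L2_set_eq_0_iff[OF FG(3)] that by auto
    then show False
      using big[of n] by (simp add: L2_set_0')
  qed
  define w where "w = (\<lambda>n j. if j \<in> G n then \<bar>x n j\<bar> / L2_set (x n) (G n) else 0)"
  have "L2_set (w n) (G n) = 1" for n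
    using L2_set_normalize[OF L] by (simp add: w_def cong: L2_set_cong_simp)
  then have "L2_set (w n) F' \<le> 1" if "finite F'" "F' \<subseteq> R" for F' n
    using L2_set_supported[OF that(1) FG(3), of n "w n"] by (simp add: w_def)
  from dominating_vector[of R w, OF this] obtain y where y: "\<And>i. 0 \<le> y i" "\<And>F. finite F \<Longrightarrow> F \<subseteq> R \<Longrightarrow> L2_set y F \<le> 2"
    "\<And>n i. i \<in> R \<Longrightarrow> \<bar>w n i\<bar> \<le> 2 ^ n * y i"
    by metis
  define v where "v = (\<lambda>i. if i \<in> R then complex_of_real (y i) else 0)"
  have v: "v \<in> l2 R"
    unfolding v_def using y(2) by (rule l2_real_vector)
  then have Av: "matvec R A v \<in> l2 R"
    and sm: "\<And>i. i \<in> R \<Longrightarrow> (\<lambda>j. complex_of_real (A i j) * v j) summable_on R"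
    using A by (auto simp: defines_op_def)
  \<comment> \<open>Nothing cancels in a sum of nonnegative terms, so a coordinate of the image
    bounds all of its finite partial sums.\<close>
  have part: "(\<Sum>j\<in>H. A i j * y j) \<le> cmod (matvec R A v i)" if "i \<in> R" "finite H" "H \<subseteq> R" for i H
  proof -
    have Re: "Re (complex_of_real (A i j) * v j) = A i j * y j" if "j \<in> R" for j
      using that by (simp add: v_def)
    have sm': "(\<lambda>j. A i j * y j) summable_on R"
      using summable_on_Re[OF sm[OF that(1)]]
        summable_on_cong[of R "\<lambda>j. Re (complex_of_real (A i j) * v j)" "\<lambda>j. A i j * y j"] Re by simp
    have "(\<Sum>j\<in>H. A i j * y j) \<le> (\<Sum>\<^sub>\<infinity>j\<in>R. A i j * y j)"
      using sm' that nn y(1) by (intro finite_sum_le_infsum) (auto simp: nonneg_mat_def)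
    also have "\<dots> = Re (matvec R A v i)"
      unfolding matvec_def using that infsum_Re[OF sm[OF that(1)]]
        infsum_cong[of R "\<lambda>j. Re (complex_of_real (A i j) * v j)" "\<lambda>j. A i j * y j"] Re by simp
    also have "\<dots> \<le> cmod (matvec R A v i)"
      by (rule complex_Re_le_cmod)
    finally show ?thesis .
  qed
  have "2 ^ n < l2norm R (matvec R A v)" for n :: nat
  proof -
    have "4 ^ n < L2_set (\<lambda>i. \<Sum>j\<in>G n. A i j * \<bar>x n j\<bar>) (F n) * (1 / L2_set (x n) (G n))"
      using big[of n] L[of n] by (simp add: field_simps)
    also have "\<dots> = L2_set (\<lambda>i. (\<Sum>j\<in>G n. A i j * \<bar>x n j\<bar>) * (1 / L2_set (x n) (G n))) (F n)"
      using L[of n] by (intro L2_set_left_distrib) auto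
    also have "\<dots> \<le> L2_set (\<lambda>i. 2 ^ n * cmod (matvec R A v i)) (F n)"
    proof (rule L2_set_mono)
      fix i assume i: "i \<in> F n"
      have A0: "0 \<le> A i j" if "j \<in> G n" for j
        using nn i FG(2,4)[of n] that by (auto simp: nonneg_mat_def)
      show "0 \<le> (\<Sum>j\<in>G n. A i j * \<bar>x n j\<bar>) * (1 / L2_set (x n) (G n))"
        using A0 L[of n] by (intro mult_nonneg_nonneg sum_nonneg) auto
      have "(\<Sum>j\<in>G n. A i j * \<bar>x n j\<bar>) * (1 / L2_set (x n) (G n)) = (\<Sum>j\<in>G n. A i j * w n j)"
        by (simp add: w_def sum_divide_distrib)
      also have "\<dots> \<le> (\<Sum>j\<in>G n. A i j * (2 ^ n * y j))"
      proof (rule sum_mono)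
        fix j assume j: "j \<in> G n"
        then have "w n j \<le> 2 ^ n * y j"
          using y(3)[of j n] FG(4)[of n] by auto
        then show "A i j * w n j \<le> A i j * (2 ^ n * y j)"
          using A0[OF j] by (rule mult_left_mono)
      qed
      also have "\<dots> = 2 ^ n * (\<Sum>j\<in>G n. A i j * y j)"
        by (simp add: sum_distrib_left mult.left_commute)
      also have "\<dots> \<le> 2 ^ n * cmod (matvec R A v i)"
        using part[of i "G n"] i FG(2-4)[of n] by auto
      finally show "(\<Sum>j\<in>G n. A i j * \<bar>x n j\<bar>) * (1 / L2_set (x n) (G n)) \<le> 2 ^ n * cmod (matvec R A v i)" .
    qed
    also have "\<dots> = 2 ^ n * L2_set (\<lambda>i. cmod (matvec R A v i)) (F n)"
      by (rule L2_set_right_distrib[symmetric]) simp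
    also have "\<dots> \<le> 2 ^ n * l2norm R (matvec R A v)"
      using L2_set_le_l2norm[OF Av] FG by simp
    finally have "(2 * 2) ^ n < 2 ^ n * l2norm R (matvec R A v)"
      by simp
    then show ?thesis
      by (simp only: power_mult_distrib mult_less_cancel_left_pos zero_less_power zero_less_numeral)
  qed
  moreover obtain n :: nat where "l2norm R (matvec R A v) < 2 ^ n"
    using real_arch_pow[of 2] by auto
  ultimately show False
    by (metis less_asym)
qed

section \<open>Products and powers\<close>

lemma opnorm_mono:
  assumes "nonneg_mat R A" "form_bounded R B C" "mat_le R A B"
  shows "opnorm R A \<le> opnorm R B"
  using assms form_bounded_mat_le form_bounded_opnorm opnorm_le by blast

lemma opnorm_matmul_le:
  assumes "form_bounded R A C" "form_bounded R B D"
  shows "opnorm R (matmul R A B) \<le> opnorm R A * opnorm R B"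
  using assms by (intro opnorm_le form_bounded_matmul form_bounded_opnorm)

lemma l2norm_matvec_le:
  assumes "form_bounded R A C" "x \<in> l2 R"
  shows "l2norm R (matvec R A x) \<le> opnorm R A * l2norm R x"
  using matvec_l2(2)[OF form_bounded_opnorm[OF assms(1)] assms(2)] .

lemma matvec_has_sum:
  assumes "form_bounded R A C" "x \<in> l2 R" "i \<in> R"
  shows "((\<lambda>j. complex_of_real (A i j) * x j) has_sum matvec R A x i) R"
  using matvec_abs_summable(2)[OF assms] assms(3) by (simp add: matvec_def)

lemma matvec_sum:
  assumes A: "form_bounded R A C" and "finite K" "\<And>k. k \<in> K \<Longrightarrow> x k \<in> l2 R"
  shows "matvec R A (\<lambda>i. \<Sum>k\<in>K. x k i) = (\<lambda>i. \<Sum>k\<in>K. matvec R A (x k) i)"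
proof
  fix i
  show "matvec R A (\<lambda>i. \<Sum>k\<in>K. x k i) i = (\<Sum>k\<in>K. matvec R A (x k) i)"
  proof (cases "i \<in> R")
    case True
    have "((\<lambda>j. \<Sum>k\<in>K. complex_of_real (A i j) * x k j) has_sum (\<Sum>k\<in>K. matvec R A (x k) i)) R"
      by (rule has_sum_finite_sum[OF assms(2)], rule matvec_has_sum[OF A assms(3) True])
    then show ?thesis
      using True by (simp add: matvec_def infsumI flip: sum_distrib_left)
  next
    case False
    then show ?thesis by (simp add: matvec_def)
  qed
qed

lemma matvec_diff:
  assumes A: "form_bounded R A C" and "x \<in> l2 R" "y \<in> l2 R"
  shows "matvec R A (\<lambda>i. x i - y i) = (\<lambda>i. matvec R A x i - matvec R A y i)"
proof -
  \<comment> \<open>The difference is written as a sum over the two booleans, to which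
    \<open>matvec_sum\<close> applies.\<close>
  have "(\<lambda>i. if k then x i else (-1) * y i) \<in> l2 R" for k
    using assms l2_scale(1)[of y R "-1"] by (cases k) auto
  then have "matvec R A (\<lambda>i. \<Sum>k\<in>{True, False}. if k then x i else (-1) * y i)
      = (\<lambda>i. \<Sum>k\<in>{True, False}. matvec R A (\<lambda>i. if k then x i else (-1) * y i) i)"
    by (intro matvec_sum[OF A]) auto
  then show ?thesis
    using matvec_scale[OF A assms(3), of "-1"] by simp
qed

lemma matvec_nonneg:
  assumes "form_bounded R A C" "x \<in> l2 R" "\<And>i. 0 \<le> x i"
  shows "0 \<le> matvec R A x i"
proof (cases "i \<in> R")
  case True
  have "0 \<le> complex_of_real (A i j) * x j" if "j \<in> R" for j
    using form_bounded_nonneg[OF assms(1)] True that assms(3)[of j]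
    by (simp add: nonneg_mat_def less_eq_complex_def)
  then show ?thesis
    using True matvec_abs_summable(2)[OF assms(1,2)] by (simp add: matvec_def infsum_nonneg_complex)
qed (simp add: matvec_def)

lemma matvec_mono:
  assumes "form_bounded R A C" "x \<in> l2 R" "y \<in> l2 R" "\<And>i. x i \<le> y i"
  shows "matvec R A x i \<le> matvec R A y i"
  using matvec_nonneg[OF assms(1) l2_diff(1)[OF assms(3,2)], of i] assms(4)
  by (simp add: matvec_diff[OF assms(1,3,2)])

lemma matvec_idmat:
  assumes "x \<in> l2 R"
  shows "matvec R idmat x = x"
proof
  fix i
  show "matvec R idmat x i = x i"
  proof (cases "i \<in> R")
    case True
    then have "(\<Sum>\<^sub>\<infinity>j\<in>R. complex_of_real (idmat i j) * x j)
        = (\<Sum>\<^sub>\<infinity>j\<in>{i}. complex_of_real (idmat i j) * x j)"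
      by (intro infsum_cong_neutral) (auto simp: idmat_def)
    then show ?thesis
      using True by (simp add: matvec_def idmat_def)
  next
    case False
    then show ?thesis using assms by (simp add: matvec_def l2_outside)
  qed
qed

text \<open>The same interchange of sums as for associativity, with the vector \<open>x\<close> in
  the place of a column of the third matrix.\<close>

lemma matvec_matmul:
  assumes A: "form_bounded R A C" and B: "form_bounded R B D" and x: "x \<in> l2 R"
  shows "matvec R (matmul R A B) x = matvec R A (matvec R B x)"
proof
  fix i
  show "matvec R (matmul R A B) x i = matvec R A (matvec R B x) i"
  proof (cases "i \<in> R")
    case False
    then show ?thesis by (simp add: matvec_def)
  next
    case i: True
    have "matvec R (matmul R A B) x i = (\<Sum>\<^sub>\<infinity>j\<in>R. complex_of_real (matmul R A B i j) * x j)"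
      using i by (simp add: matvec_def)
    also have "\<dots> = (\<Sum>\<^sub>\<infinity>j\<in>R. \<Sum>\<^sub>\<infinity>k\<in>R. complex_of_real (A i k * B k j) * x j)"
    proof (rule infsum_cong)
      fix j assume "j \<in> R"
      then have "((\<lambda>k. complex_of_real (A i k * B k j)) has_sum complex_of_real (matmul R A B i j)) R"
        by (intro has_sum_of_real matmul_has_sum[OF A B i])
      then show "complex_of_real (matmul R A B i j) * x j
          = (\<Sum>\<^sub>\<infinity>k\<in>R. complex_of_real (A i k * B k j) * x j)"
        using has_sum_cmult_left infsumI by metis
    qed
    also have "\<dots> = (\<Sum>\<^sub>\<infinity>k\<in>R. \<Sum>\<^sub>\<infinity>j\<in>R. complex_of_real (A i k * B k j) * x j)"
    proof (rule infsum_swap_bounded)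
      fix F G assume FG: "finite F" "F \<subseteq> R" "finite G" "G \<subseteq> R"
      have "(\<Sum>j\<in>F. \<Sum>k\<in>G. norm (complex_of_real (A i k * B k j) * x j))
          = (\<Sum>k\<in>G. \<Sum>j\<in>F. \<bar>A i k\<bar> * B k j * \<bar>cmod (x j)\<bar>)"
        using form_bounded_nonneg[OF B] FG
        by (subst sum.swap) (auto intro!: sum.cong simp: norm_mult nonneg_mat_def subset_iff)
      also have "\<dots> \<le> D * L2_set (A i) G * L2_set (\<lambda>j. cmod (x j)) F"
        using FG by (intro form_boundedD[OF B])
      also have "\<dots> \<le> D * C * l2norm R x"
        using FG form_bounded_row[OF A i] L2_set_le_l2norm[OF x] A B
        by (intro mult_mono mult_left_mono mult_nonneg_nonneg) (auto dest: form_bounded_const_nonneg)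
      finally show "(\<Sum>j\<in>F. \<Sum>k\<in>G. norm (complex_of_real (A i k * B k j) * x j)) \<le> D * C * l2norm R x" .
    qed
    also have "\<dots> = (\<Sum>\<^sub>\<infinity>k\<in>R. complex_of_real (A i k) * matvec R B x k)"
      by (rule infsum_cong) (simp add: matvec_def mult.assoc infsum_cmult_right')
    also have "\<dots> = matvec R A (matvec R B x) i"
      using i by (simp add: matvec_def)
    finally show ?thesis .
  qed
qed

text \<open>The pairing is bilinear, without conjugation, so matrices move across it as plain
  transposes with no conjugates to keep track of.\<close>

lemma l2_pairing:
  assumes x: "x \<in> l2 R" and y: "y \<in> l2 R"
  shows "(\<lambda>i. x i * y i) summable_on R" "cmod (\<Sum>\<^sub>\<infinity>i\<in>R. x i * y i) \<le> l2norm R x * l2norm R y"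
proof -
  have bd: "(\<Sum>i\<in>F. norm (x i * y i)) \<le> l2norm R x * l2norm R y" if F: "finite F" "F \<subseteq> R" for F
  proof -
    have "(\<Sum>i\<in>F. norm (x i * y i)) = (\<Sum>i\<in>F. \<bar>cmod (x i)\<bar> * \<bar>cmod (y i)\<bar>)"
      by (simp add: norm_mult)
    also have "\<dots> \<le> L2_set (\<lambda>i. cmod (x i)) F * L2_set (\<lambda>i. cmod (y i)) F"
      by (rule L2_set_mult_ineq)
    also have "\<dots> \<le> l2norm R x * l2norm R y"
      by (intro mult_mono L2_set_le_l2norm[OF x F] L2_set_le_l2norm[OF y F]) (auto simp: l2norm_nonneg)
    finally show ?thesis .
  qed
  then have abs: "(\<lambda>i. norm (x i * y i)) summable_on R"
    unfolding abs_summable_iff_bdd_above by (auto intro!: bdd_aboveI2)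
  then show "(\<lambda>i. x i * y i) summable_on R"
    by (rule abs_summable_summable)
  have "cmod (\<Sum>\<^sub>\<infinity>i\<in>R. x i * y i) \<le> (\<Sum>\<^sub>\<infinity>i\<in>R. norm (x i * y i))"
    using abs by (rule norm_infsum_bound)
  also have "\<dots> \<le> l2norm R x * l2norm R y"
    using abs bd by (rule infsum_le_finite_sums)
  finally show "cmod (\<Sum>\<^sub>\<infinity>i\<in>R. x i * y i) \<le> l2norm R x * l2norm R y" .
qed

lemma matvec_transp_pairing:
  assumes A: "form_bounded R A C" and x: "x \<in> l2 R" and w: "w \<in> l2 R"
  shows "(\<Sum>\<^sub>\<infinity>i\<in>R. w i * matvec R A x i) = (\<Sum>\<^sub>\<infinity>j\<in>R. matvec R (transp A) w j * x j)"
proof -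
  have "(\<Sum>\<^sub>\<infinity>i\<in>R. w i * matvec R A x i) = (\<Sum>\<^sub>\<infinity>i\<in>R. \<Sum>\<^sub>\<infinity>j\<in>R. w i * (complex_of_real (A i j) * x j))"
    by (rule infsum_cong) (simp add: matvec_def infsum_cmult_right')
  also have "\<dots> = (\<Sum>\<^sub>\<infinity>j\<in>R. \<Sum>\<^sub>\<infinity>i\<in>R. w i * (complex_of_real (A i j) * x j))"
  proof (rule infsum_swap_bounded)
    fix F G assume FG: "finite F" "F \<subseteq> R" "finite G" "G \<subseteq> R"
    have "(\<Sum>i\<in>F. \<Sum>j\<in>G. norm (w i * (complex_of_real (A i j) * x j)))
        = (\<Sum>i\<in>F. \<Sum>j\<in>G. \<bar>cmod (w i)\<bar> * A i j * \<bar>cmod (x j)\<bar>)"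
      using form_bounded_nonneg[OF A] FG
      by (auto intro!: sum.cong simp: norm_mult nonneg_mat_def subset_iff)
    also have "\<dots> \<le> C * L2_set (\<lambda>i. cmod (w i)) F * L2_set (\<lambda>j. cmod (x j)) G"
      using FG by (intro form_boundedD[OF A])
    also have "\<dots> \<le> C * l2norm R w * l2norm R x"
      using FG L2_set_le_l2norm[OF x] L2_set_le_l2norm[OF w] form_bounded_const_nonneg[OF A]
      by (intro mult_mono mult_left_mono mult_nonneg_nonneg) (auto simp: l2norm_nonneg)
    finally show "(\<Sum>i\<in>F. \<Sum>j\<in>G. norm (w i * (complex_of_real (A i j) * x j))) \<le> C * l2norm R w * l2norm R x" .
  qed
  also have "\<dots> = (\<Sum>\<^sub>\<infinity>j\<in>R. matvec R (transp A) w j * x j)"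
    by (rule infsum_cong) (simp add: matvec_def transp_def mult_ac flip: infsum_cmult_right')
  finally show ?thesis .
qed

text \<open>Entries outside \<open>R \<times> R\<close> are junk: the sums there need not converge, so not even associativity
  holds for them.\<close>

definition mat_eq :: "nat set \<Rightarrow> mat \<Rightarrow> mat \<Rightarrow> bool" where
  "mat_eq R A B \<longleftrightarrow> (\<forall>i\<in>R. \<forall>j\<in>R. A i j = B i j)"

lemma mat_eq_refl [simp]: "mat_eq R A A"
  by (simp add: mat_eq_def)

lemma mat_eq_sym: "mat_eq R A B \<Longrightarrow> mat_eq R B A"
  by (simp add: mat_eq_def)

lemma mat_eq_trans [trans]: "mat_eq R A B \<Longrightarrow> mat_eq R B D \<Longrightarrow> mat_eq R A D"
  by (simp add: mat_eq_def)

lemma mat_eq_imp_le: "mat_eq R A B \<Longrightarrow> mat_le R A B"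
  by (simp add: mat_eq_def mat_le_def)

lemma matmul_cong:
  assumes "mat_eq R A A'" "mat_eq R B B'"
  shows "mat_eq R (matmul R A B) (matmul R A' B')"
  using assms by (auto simp: mat_eq_def matmul_def intro!: infsum_cong)

lemma matmul_assoc_eq:
  assumes "form_bounded R A C" "form_bounded R B D" "form_bounded R E M"
  shows "mat_eq R (matmul R (matmul R A B) E) (matmul R A (matmul R B E))"
  using matmul_assoc[OF assms] by (simp add: mat_eq_def)

lemma idmat_matmul: "mat_eq R (matmul R idmat A) A"
proof -
  have "(\<Sum>\<^sub>\<infinity>k\<in>R. idmat i k * A k j) = A i j" if "i \<in> R" for i j
  proof -
    have "(\<Sum>\<^sub>\<infinity>k\<in>R. idmat i k * A k j) = (\<Sum>\<^sub>\<infinity>k\<in>{i}. idmat i k * A k j)"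
      using that by (intro infsum_cong_neutral) (auto simp: idmat_def)
    then show ?thesis by (simp add: idmat_def)
  qed
  then show ?thesis by (simp add: mat_eq_def matmul_def)
qed

lemma matmul_idmat: "mat_eq R (matmul R A idmat) A"
proof -
  have "transp idmat = idmat"
    by (intro ext) (simp add: transp_def idmat_def)
  then show ?thesis
    using idmat_matmul[of R "transp A"] transp_matmul[of R A idmat]
    by (simp add: mat_eq_def transp_def fun_eq_iff)
qed

section \<open>Powers of a matrix and their growth rate\<close>

primrec mpow :: "nat set \<Rightarrow> mat \<Rightarrow> nat \<Rightarrow> mat" where
  "mpow R A 0 = idmat"
| "mpow R A (Suc k) = matmul R A (mpow R A k)"

lemma form_bounded_mpow:
  assumes "form_bounded R A C"
  shows "form_bounded R (mpow R A k) (C ^ k)"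
  by (induction k) (auto intro: form_bounded_idmat form_bounded_matmul[OF assms])

lemma mpow_add:
  assumes A: "form_bounded R A C"
  shows "mat_eq R (mpow R A (m + n)) (matmul R (mpow R A m) (mpow R A n))"
proof (induction m)
  case 0
  show ?case by (simp add: mat_eq_sym idmat_matmul)
next
  case (Suc m)
  have "mat_eq R (mpow R A (Suc m + n)) (matmul R A (matmul R (mpow R A m) (mpow R A n)))"
    using matmul_cong[OF mat_eq_refl Suc] by simp
  also have "mat_eq R (matmul R A (matmul R (mpow R A m) (mpow R A n)))
      (matmul R (mpow R A (Suc m)) (mpow R A n))"
    using mat_eq_sym[OF matmul_assoc_eq[OF A form_bounded_mpow[OF A] form_bounded_mpow[OF A]]] by simp
  finally show ?case .
qed

lemma mpow_Suc_right:
  assumes A: "form_bounded R A C"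
  shows "mat_eq R (mpow R A (Suc n)) (matmul R (mpow R A n) A)"
proof -
  have "mat_eq R (mpow R A (Suc n)) (matmul R (mpow R A n) (mpow R A (Suc 0)))"
    using mpow_add[OF A, of n "Suc 0"] by simp
  also have "mat_eq R (matmul R (mpow R A n) (mpow R A (Suc 0))) (matmul R (mpow R A n) A)"
    by (intro matmul_cong) (simp_all add: matmul_idmat)
  finally show ?thesis .
qed

text \<open>Transposition reverses the factors, so the recursion of \<open>mpow\<close> on the left
  has to be matched with one on the right, which is \<open>mpow_Suc_right\<close>.\<close>

lemma mpow_transp:
  assumes A: "form_bounded R A C"
  shows "mat_eq R (mpow R (transp A) n) (transp (mpow R A n))"
proof (induction n)
  case 0
  show ?case by (auto simp: mat_eq_def transp_def idmat_def)
next
  case (Suc n)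
  have "mat_eq R (mpow R (transp A) (Suc n)) (matmul R (transp A) (transp (mpow R A n)))"
    using matmul_cong[OF mat_eq_refl Suc] by simp
  also have "mat_eq R (matmul R (transp A) (transp (mpow R A n))) (transp (mpow R A (Suc n)))"
    using mpow_Suc_right[OF A, of n] unfolding transp_matmul[symmetric]
    by (simp add: mat_eq_def transp_def)
  finally show ?case .
qed

lemma mpow_mult:
  assumes A: "form_bounded R A C"
  shows "mat_eq R (mpow R (mpow R A m) n) (mpow R A (m * n))"
proof (induction n)
  case 0
  show ?case by simp
next
  case (Suc n)
  have "mat_eq R (mpow R (mpow R A m) (Suc n)) (matmul R (mpow R A m) (mpow R A (m * n)))"
    using matmul_cong[OF mat_eq_refl Suc] by simp
  also have "mat_eq R (matmul R (mpow R A m) (mpow R A (m * n))) (mpow R A (m * Suc n))"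
    using mat_eq_sym[OF mpow_add[OF A, of m "m * n"]] by simp
  finally show ?case .
qed

lemma mpow_mono:
  assumes "nonneg_mat R A" "form_bounded R B C" "mat_le R A B"
  shows "mat_le R (mpow R A k) (mpow R B k)"
proof (induction k)
  case 0
  show ?case by simp
next
  case (Suc k)
  have "form_bounded R A C"
    using assms form_bounded_mat_le by blast
  then have "nonneg_mat R (mpow R A k)"
    using form_bounded_mpow form_bounded_nonneg by blast
  then show ?case
    using matmul_mono[OF assms(3) Suc assms(1) _ assms(2) form_bounded_mpow[OF assms(2)]] by simp
qed

lemma opnorm_mpow_add:
  assumes A: "form_bounded R A C"
  shows "opnorm R (mpow R A (m + n)) \<le> opnorm R (mpow R A m) * opnorm R (mpow R A n)"
proof -
  note fb = form_bounded_mpow[OF A]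
  have "opnorm R (mpow R A (m + n)) \<le> opnorm R (matmul R (mpow R A m) (mpow R A n))"
    by (rule opnorm_mono[OF form_bounded_nonneg[OF fb] form_bounded_matmul[OF fb fb]
          mat_eq_imp_le[OF mpow_add[OF A]]])
  also have "\<dots> \<le> opnorm R (mpow R A m) * opnorm R (mpow R A n)"
    by (rule opnorm_matmul_le[OF fb fb])
  finally show ?thesis .
qed

text \<open>Fekete's lemma in multiplicative form: the limit is the infimum of the roots. Index 0
  stays outside the infimum because \<open>root 0\<close> is 0 by convention.\<close>

lemma root_submultiplicative_tendsto:
  fixes c :: "nat \<Rightarrow> real"
  assumes nn: "\<And>n. 0 \<le> c n"
    and sub: "\<And>m n. 1 \<le> m \<Longrightarrow> 1 \<le> n \<Longrightarrow> c (m + n) \<le> c m * c n"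
  obtains L where "0 \<le> L" "\<And>n. 1 \<le> n \<Longrightarrow> L \<le> root n (c n)" "(\<lambda>n. root n (c n)) \<longlonglongrightarrow> L"
proof -
  define L where "L = (INF n\<in>{1..}. root n (c n))"
  have bdd: "bdd_below ((\<lambda>n. root n (c n)) ` {1..})"
    using nn by (intro bdd_belowI2[of _ 0]) simp
  have L0: "0 \<le> L"
    unfolding L_def using nn by (intro cINF_greatest) auto
  have Lle: "L \<le> root n (c n)" if "1 \<le> n" for n
    unfolding L_def using bdd that by (intro cINF_lower) auto
  have "\<forall>\<^sub>F n in sequentially. root n (c n) < L + e" if e: "e > 0" for e
  proof -
    have "L < L + e / 2" using e by simp
    then obtain m where m: "1 \<le> m" "root m (c m) < L + e / 2"
      using cINF_less_iff[of "{1..}" "\<lambda>n. root n (c n)" "L + e / 2"] bdd unfolding L_def by auto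
    define b where "b = L + e / 2"
    have b: "b > 0" using L0 e by (simp add: b_def)
    have cm: "c m \<le> b ^ m"
      using m nn[of m] b by (smt (verit) b_def power_mono real_root_ge_zero real_root_pow_pos2 less_le_trans zero_less_one
          not_one_le_zero neq0_conv)
    have blk: "c (m * q + r) \<le> (b ^ m) ^ q * c r" if "1 \<le> r" for q r
    proof (induction q)
      case (Suc q)
      have "c (m * Suc q + r) \<le> c m * c (m * q + r)"
        using sub[of m "m * q + r"] m that by (simp add: add_ac)
      also have "\<dots> \<le> b ^ m * ((b ^ m) ^ q * c r)"
        using Suc cm nn b by (intro mult_mono) auto
      finally show ?case by (simp add: mult_ac)
    qed simp
    \<comment> \<open>\<open>K\<close> absorbs the finitely many possible remainders. The summand 1
      keeps it positive, so that its \<open>n\<close>-th root tends to 1.\<close>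
    define K where "K = 1 + (\<Sum>r\<in>{1..m}. c r / b ^ r)"
    have K1: "K \<ge> 1"
      using nn b by (simp add: K_def sum_nonneg)
    have bound: "c n \<le> K * b ^ n" if n: "1 \<le> n" for n
    proof -
      \<comment> \<open>The remainder is taken in \<open>{1..m}\<close> rather than
        \<open>{0..<m}\<close>, so that \<open>sub\<close> is only ever applied to positive
        indices.\<close>
      define q r where "q = (n - 1) div m" and "r = (n - 1) mod m + 1"
      have nqr: "n = m * q + r" and r: "1 \<le> r" "r \<le> m"
        using n m(1) by (simp_all add: q_def r_def) (simp add: Suc_leI)
      have "c r / b ^ r \<le> (\<Sum>r\<in>{1..m}. c r / b ^ r)"
        using r nn b by (intro member_le_sum) auto
      then have "c r / b ^ r \<le> K" by (simp add: K_def)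
      then have cr: "c r \<le> K * b ^ r" using b by (simp add: field_simps)
      have "c n \<le> (b ^ m) ^ q * c r" using blk[OF r(1)] nqr by simp
      also have "\<dots> \<le> (b ^ m) ^ q * (K * b ^ r)" using cr b by simp
      also have "\<dots> = K * b ^ n" by (simp add: nqr power_add power_mult)
      finally show ?thesis .
    qed
    have "(\<lambda>n. root n K * b) \<longlonglongrightarrow> 1 * b"
      using K1 by (intro tendsto_intros LIMSEQ_root_const) auto
    then have "\<forall>\<^sub>F n in sequentially. root n K * b < L + e"
      using e by (intro order_tendstoD(2)) (auto simp: b_def)
    then show ?thesis
      using eventually_ge_at_top[of "1::nat"]
    proof eventually_elim
      case (elim n)
      have "root n (c n) \<le> root n (K * b ^ n)"
        using bound elim by (intro real_root_le_mono) auto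
      also have "\<dots> = root n K * b"
        using elim b by (simp add: real_root_mult real_root_power_cancel)
      finally show ?case using elim by simp
    qed
  qed
  note up = this
  have "(\<lambda>n. root n (c n)) \<longlonglongrightarrow> L"
  proof (rule order_tendstoI)
    fix a assume "a < L"
    then show "\<forall>\<^sub>F n in sequentially. a < root n (c n)"
      by (intro eventually_sequentiallyI[of 1] less_le_trans[OF _ Lle])
  next
    fix a assume "L < a"
    then show "\<forall>\<^sub>F n in sequentially. root n (c n) < a"
      using up[of "a - L"] by simp
  qed
  with L0 Lle show thesis by (rule that)
qed

section \<open>Neumann series\<close>

lemma matvec_mpow_Suc:
  assumes "form_bounded R A C" "x \<in> l2 R"
  shows "matvec R (mpow R A (Suc k)) x = matvec R A (matvec R (mpow R A k) x)"
  using matvec_matmul[OF assms(1) form_bounded_mpow[OF assms(1)] assms(2)] by simp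

lemma matvec_cong:
  assumes "mat_eq R A B" shows "matvec R A x = matvec R B x"
  using assms by (auto simp: matvec_def mat_eq_def fun_eq_iff intro!: infsum_cong)

lemma matvec_mpow_add:
  assumes A: "form_bounded R A C" and x: "x \<in> l2 R"
  shows "matvec R (mpow R A (k + l)) x = matvec R (mpow R A k) (matvec R (mpow R A l) x)"
  using matvec_cong[OF mpow_add[OF A]] matvec_matmul[OF form_bounded_mpow[OF A] form_bounded_mpow[OF A] x]
  by metis

lemma geometric_bound:
  fixes c :: "nat \<Rightarrow> real"
  assumes nn: "\<And>n. 0 \<le> c n" and lim: "(\<lambda>n. root n (c n)) \<longlonglongrightarrow> L" and q: "L < q" "0 < q"
  obtains K where "0 \<le> K" "\<And>n. c n \<le> K * q ^ n"
proof -
  have "\<forall>\<^sub>F n in sequentially. root n (c n) < q"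
    using order_tendstoD(2)[OF lim q(1)] .
  then obtain N where N: "\<And>n. n \<ge> N \<Longrightarrow> root n (c n) < q"
    by (auto simp: eventually_sequentially)
  define K where "K = 1 + (\<Sum>n\<le>N. c n / q ^ n)"
  have s0: "0 \<le> (\<Sum>n\<le>N. c n / q ^ n)"
    using nn q by (intro sum_nonneg) auto
  have "c n \<le> K * q ^ n" for n
  proof (cases "n \<le> N")
    case True
    then have "c n / q ^ n \<le> (\<Sum>n\<le>N. c n / q ^ n)"
      using nn q by (intro member_le_sum) auto
    then have "c n / q ^ n \<le> K" by (simp add: K_def)
    then show ?thesis using q by (simp add: field_simps)
  next
    case False
    then have n: "n > 0" "root n (c n) < q" using N[of n] by auto
    have "c n = root n (c n) ^ n"
      using n nn by simp
    also have "\<dots> \<le> q ^ n"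
      using n nn by (intro power_mono) auto
    also have "\<dots> \<le> K * q ^ n"
      using s0 q by (simp add: K_def)
    finally show ?thesis .
  qed
  moreover have "0 \<le> K" using s0 by (simp add: K_def)
  ultimately show thesis using that by blast
qed

text \<open>Injectivity: a vector with \<open>A z = c z\<close> satisfies
  \<open>A ^ k z = c ^ k z\<close>, and the powers of \<open>A\<close> grow more slowly than those
  of \<open>cmod c\<close>. Surjectivity: the Neumann series converges absolutely because
  \<open>q < cmod c\<close>. It is summed coordinatewise, and bounds on finite sections show that
  the sum lies in \<open>l2 R\<close>.\<close>

lemma notin_spec:
  assumes A: "form_bounded R A C" and q: "0 < q" "q < cmod c" and K: "0 \<le> K"
    and pw: "\<And>n. opnorm R (mpow R A n) \<le> K * q ^ n"
  shows "c \<notin> spec R A"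
proof -
  define T where "T = (\<lambda>k. matvec R (mpow R A k))"
  have T_l2: "T k x \<in> l2 R" if "x \<in> l2 R" for k x
    using matvec_l2(1)[OF form_bounded_mpow[OF A] that] by (simp add: T_def)
  have T_norm: "l2norm R (T k x) \<le> K * q ^ k * l2norm R x" if "x \<in> l2 R" for k x
  proof -
    have "l2norm R (T k x) \<le> opnorm R (mpow R A k) * l2norm R x"
      using l2norm_matvec_le[OF form_bounded_mpow[OF A] that] by (simp add: T_def)
    also have "\<dots> \<le> K * q ^ k * l2norm R x"
      using pw l2norm_nonneg by (rule mult_right_mono)
    finally show ?thesis .
  qed
  have T_Suc: "T (Suc k) x = matvec R A (T k x)" if "x \<in> l2 R" for k x
    using matvec_mpow_Suc[OF A that] by (simp add: T_def)
  have T_0: "T 0 x = x" if "x \<in> l2 R" for x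
    using matvec_idmat[OF that] by (simp add: T_def)
  have c0: "c \<noteq> 0" "0 < cmod c" using q by auto
  define t where "t = q / cmod c"
  have t: "0 < t" "t < 1" using q c0 by (auto simp: t_def)
  have kernel: "z = (\<lambda>_. 0)" if z: "z \<in> l2 R" and eig: "matvec R A z = (\<lambda>i. c * z i)" for z
  proof -
    have Tz: "T k z = (\<lambda>i. c ^ k * z i)" for k
    proof (induction k)
      case 0
      then show ?case using T_0[OF z] by simp
    next
      case (Suc k)
      have "T (Suc k) z = matvec R A (\<lambda>i. c ^ k * z i)"
        using T_Suc[OF z] Suc by simp
      also have "\<dots> = (\<lambda>i. c ^ k * (c * z i))"
        unfolding matvec_scale[OF A z] eig ..
      finally show ?case by (simp add: mult_ac)
    qed
    have le: "l2norm R z \<le> (K * l2norm R z) * t ^ k" for k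
    proof -
      have "cmod c ^ k * l2norm R z \<le> K * q ^ k * l2norm R z"
        using T_norm[OF z, of k] l2_scale(2)[OF z, of "c ^ k"] Tz by (simp add: norm_power)
      then show ?thesis
        using c0 by (simp add: t_def power_divide field_simps)
    qed
    have "(\<lambda>k. (K * l2norm R z) * t ^ k) \<longlonglongrightarrow> (K * l2norm R z) * 0"
      using t by (intro tendsto_intros LIMSEQ_power_zero) auto
    then have "l2norm R z \<le> (K * l2norm R z) * 0"
      using le by (intro LIMSEQ_le_const) auto
    then have "z i = 0" for i
      using cmod_le_l2norm[OF z, of i] l2norm_nonneg[of R z] by simp
    then show ?thesis by blast
  qed
  have inj: "inj_on (\<lambda>x i. matvec R A x i - c * x i) (l2 R)"
  proof (rule inj_onI)
    fix x y assume x: "x \<in> l2 R" and y: "y \<in> l2 R"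
      and eq: "(\<lambda>i. matvec R A x i - c * x i) = (\<lambda>i. matvec R A y i - c * y i)"
    have "matvec R A (\<lambda>i. x i - y i) = (\<lambda>i. c * (x i - y i))"
      using fun_cong[OF eq] by (simp add: matvec_diff[OF A x y] fun_eq_iff algebra_simps)
    then have "(\<lambda>i. x i - y i) = (\<lambda>_. 0)"
      using kernel l2_diff(1)[OF x y] by blast
    then show "x = y" by (simp add: fun_eq_iff)
  qed
  have closed: "(\<lambda>i. matvec R A x i - c * x i) \<in> l2 R" if "x \<in> l2 R" for x
    using l2_diff(1)[OF matvec_l2(1)[OF A that] l2_scale(1)[OF that]] .
  have surj: "y \<in> (\<lambda>x i. matvec R A x i - c * x i) ` l2 R" if y: "y \<in> l2 R" for y
  proof -
    \<comment> \<open>These are the terms of the series for the inverse of \<open>c - A\<close>,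
      hence the sign in the preimage \<open>x\<close> below.\<close>
    define u where "u = (\<lambda>k i. T k y i / c ^ Suc k)"
    have u_scale: "u k = (\<lambda>i. inverse (c ^ Suc k) * T k y i)" for k
      by (simp add: u_def divide_inverse mult.commute)
    have u_l2: "u k \<in> l2 R" for k
      unfolding u_scale using T_l2[OF y] by (rule l2_scale)
    define M where "M = K * l2norm R y / cmod c / (1 - t)"
    have u_norm: "l2norm R (u k) \<le> K * l2norm R y / cmod c * t ^ k" for k
    proof -
      have "l2norm R (u k) = inverse (cmod c ^ Suc k) * l2norm R (T k y)"
        unfolding u_scale l2_scale(2)[OF T_l2[OF y]] by (simp add: norm_inverse norm_power norm_mult)
      also have "\<dots> \<le> inverse (cmod c ^ Suc k) * (K * q ^ k * l2norm R y)"
        using T_norm[OF y] c0 by (intro mult_left_mono) auto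
      also have "\<dots> = K * l2norm R y / cmod c * t ^ k"
        using c0 by (simp add: t_def power_divide field_simps)
      finally show ?thesis .
    qed
    have u_sum: "(\<Sum>k\<in>G. l2norm R (u k)) \<le> M" if "finite G" for G
    proof -
      have "(\<Sum>k\<in>G. l2norm R (u k)) \<le> (\<Sum>k\<in>G. K * l2norm R y / cmod c * t ^ k)"
        using u_norm by (rule sum_mono)
      also have "\<dots> = K * l2norm R y / cmod c * (\<Sum>k\<in>G. t ^ k)"
        by (rule sum_distrib_left[symmetric])
      also have "\<dots> \<le> K * l2norm R y / cmod c * (\<Sum>k. t ^ k)"
        using t K c0 that l2norm_nonneg
        by (intro mult_left_mono sum_le_suminf summable_geometric) auto
      also have "\<dots> = M"
        using t by (simp add: M_def suminf_geometric)
      finally show ?thesis .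
    qed
    \<comment> \<open>Used twice: with the conjugates of the sum \<open>s\<close> as weights it
      shows that \<open>s\<close> lies in \<open>l2 R\<close>, and with row \<open>i\<close> of
      \<open>A\<close> it permits applying \<open>A\<close> to the series term by term.\<close>
    have bd: "(\<Sum>i\<in>F. \<Sum>k\<in>G. norm (w i * u k i)) \<le> M * L2_set w' F"
      if F: "finite F" "F \<subseteq> R" and G: "finite G" and w: "\<And>i. i \<in> F \<Longrightarrow> cmod (w i) = \<bar>w' i\<bar>" for F G w w'
    proof -
      have "(\<Sum>i\<in>F. \<Sum>k\<in>G. norm (w i * u k i)) = (\<Sum>k\<in>G. \<Sum>i\<in>F. \<bar>w' i\<bar> * \<bar>cmod (u k i)\<bar>)"
        using w by (subst sum.swap) (simp add: norm_mult)
      also have "\<dots> \<le> (\<Sum>k\<in>G. L2_set w' F * L2_set (\<lambda>i. cmod (u k i)) F)"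
        by (rule sum_mono) (rule L2_set_mult_ineq)
      also have "\<dots> \<le> (\<Sum>k\<in>G. L2_set w' F * l2norm R (u k))"
        by (rule sum_mono, rule mult_left_mono) (simp_all add: L2_set_le_l2norm[OF u_l2 F])
      also have "\<dots> = (\<Sum>k\<in>G. l2norm R (u k)) * L2_set w' F"
        by (subst sum_distrib_left[symmetric]) (rule mult.commute)
      also have "\<dots> \<le> M * L2_set w' F"
        using u_sum[OF G] by (rule mult_right_mono) simp
      finally show ?thesis .
    qed
    have u_sm: "(\<lambda>k. u k i) summable_on UNIV" if "i \<in> R" for i
    proof -
      have "(\<Sum>k\<in>G. norm (u k i)) \<le> M" if G: "finite G" for G
      proof -
        have "(\<Sum>k\<in>G. norm (u k i)) \<le> (\<Sum>k\<in>G. l2norm R (u k))"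
          by (rule sum_mono) (rule cmod_le_l2norm[OF u_l2])
        with u_sum[OF G] show ?thesis by linarith
      qed
      then have "(\<lambda>k. norm (u k i)) summable_on UNIV"
        unfolding abs_summable_iff_bdd_above by (auto intro!: bdd_aboveI2)
      then show ?thesis by (rule abs_summable_summable)
    qed
    define s where "s = (\<lambda>i. \<Sum>\<^sub>\<infinity>k. u k i)"
    have s_out: "s i = 0" if "i \<notin> R" for i
      using l2_outside[OF u_l2 that] by (simp add: s_def)
    have s_has: "((\<lambda>k. u k i) has_sum s i) UNIV" if "i \<in> R" for i
      using u_sm[OF that] by (simp add: s_def)
    have M0: "0 \<le> M" using u_sum[of "{}"] by simp
    have s_le: "L2_set (\<lambda>i. cmod (s i)) F \<le> M" if F: "finite F" "F \<subseteq> R" for F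
    proof (rule L2_set_leI[OF _ M0])
      have "((\<lambda>k. \<Sum>i\<in>F. cnj (s i) * u k i) has_sum (\<Sum>i\<in>F. cnj (s i) * s i)) UNIV"
        using F by (intro has_sum_finite_sum has_sum_cmult_right s_has) auto
      then have "((\<lambda>k. Re (\<Sum>i\<in>F. cnj (s i) * u k i)) has_sum Re (\<Sum>i\<in>F. cnj (s i) * s i)) UNIV"
        by (rule has_sum_Re)
      moreover have "(\<Sum>k\<in>G. Re (\<Sum>i\<in>F. cnj (s i) * u k i)) \<le> M * L2_set (\<lambda>i. cmod (s i)) F"
        if G: "finite G" for G
      proof -
        have "(\<Sum>k\<in>G. Re (\<Sum>i\<in>F. cnj (s i) * u k i)) \<le> (\<Sum>k\<in>G. \<Sum>i\<in>F. norm (cnj (s i) * u k i))"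
          unfolding Re_sum by (rule sum_mono, rule sum_mono) (rule complex_Re_le_cmod)
        also have "\<dots> = (\<Sum>i\<in>F. \<Sum>k\<in>G. norm (cnj (s i) * u k i))"
          by (rule sum.swap)
        also have "\<dots> \<le> M * L2_set (\<lambda>i. cmod (s i)) F"
          by (rule bd[OF F G]) simp_all
        finally show ?thesis .
      qed
      ultimately have "Re (\<Sum>i\<in>F. cnj (s i) * s i) \<le> M * L2_set (\<lambda>i. cmod (s i)) F"
        by (rule has_sum_le_finite_sums)
      moreover have "Re (cnj z * z) = cmod z * cmod z" for z
        unfolding power2_eq_square[symmetric, of "cmod z"] cmod_power2 by (simp add: power2_eq_square)
      ultimately show "(\<Sum>i\<in>F. cmod (s i) * cmod (s i)) \<le> M * L2_set (\<lambda>i. cmod (s i)) F"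
        by simp
    qed
    have s_l2: "s \<in> l2 R"
      using s_out s_le by (rule l2I(1))
    have key: "matvec R A s i - c * s i = - y i" if i: "i \<in> R" for i
    proof -
      have sm: "(\<lambda>(j, k). complex_of_real (A i j) * u k j) summable_on R \<times> UNIV"
      proof -
        have "(\<Sum>j\<in>F. \<Sum>k\<in>G. norm (complex_of_real (A i j) * u k j)) \<le> M * C"
          if F: "finite F" "F \<subseteq> R" and G: "finite G" "G \<subseteq> UNIV" for F G
        proof -
          have "(\<Sum>j\<in>F. \<Sum>k\<in>G. norm (complex_of_real (A i j) * u k j)) \<le> M * L2_set (A i) F"
            using F G by (intro bd) auto
          also have "\<dots> \<le> M * C"
            using form_bounded_row[OF A i F] M0 by (rule mult_left_mono)
          finally show ?thesis .
        qed
        from abs_summable_summable[OF abs_summable_on_prod[OF this]] show ?thesis .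
      qed
      have "matvec R A s i = (\<Sum>\<^sub>\<infinity>j\<in>R. \<Sum>\<^sub>\<infinity>k. complex_of_real (A i j) * u k j)"
        using i by (simp add: matvec_def s_def infsum_cmult_right')
      also have "\<dots> = (\<Sum>\<^sub>\<infinity>k. \<Sum>\<^sub>\<infinity>j\<in>R. complex_of_real (A i j) * u k j)"
        using sm by (rule infsum_swap_banach)
      also have "\<dots> = (\<Sum>\<^sub>\<infinity>k. T (Suc k) y i / c ^ Suc k)"
      proof (rule infsum_cong)
        fix k
        have "(\<Sum>\<^sub>\<infinity>j\<in>R. complex_of_real (A i j) * u k j) = matvec R A (u k) i"
          using i by (simp add: matvec_def)
        also have "\<dots> = inverse (c ^ Suc k) * matvec R A (T k y) i"
          unfolding u_scale matvec_scale[OF A T_l2[OF y]] ..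
        finally show "(\<Sum>\<^sub>\<infinity>j\<in>R. complex_of_real (A i j) * u k j) = T (Suc k) y i / c ^ Suc k"
          using T_Suc[OF y, of k] by (simp add: divide_inverse mult.commute)
      qed
      finally have As: "matvec R A s i = (\<Sum>\<^sub>\<infinity>k. T (Suc k) y i / c ^ Suc k)" .
      \<comment> \<open>Applying \<open>A\<close> and multiplying by \<open>c\<close> give the same
        series up to an index shift; the term that \<open>c * s\<close> has in addition is the
        zeroth one, \<open>y i\<close>.\<close>
      have s1: "(\<lambda>k. u k i) sums s i"
        using has_sum_imp_sums[OF s_has[OF i]] .
      have "(\<lambda>k. c * u k i) sums (c * s i)"
        using s1 by (rule sums_mult)
      then have s2: "(\<lambda>k. T k y i / c ^ k) sums (c * s i)"
        using c0 by (simp add: u_def)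
      then have s3: "(\<lambda>k. T (Suc k) y i / c ^ Suc k) sums (c * s i - y i)"
        using sums_Suc_iff[of "\<lambda>k. T k y i / c ^ k" "c * s i - y i"] T_0[OF y] by simp
      have "(\<lambda>k. c * u k i) summable_on UNIV"
        using u_sm[OF i] by (rule summable_on_cmult_right)
      then have "(\<lambda>k. T k y i / c ^ k) summable_on UNIV"
        using c0 by (simp add: u_def)
      then have "(\<lambda>k. T k y i / c ^ k) summable_on range Suc"
        by (rule summable_on_subset_banach) simp
      then have "(\<lambda>k. T (Suc k) y i / c ^ Suc k) summable_on UNIV"
        by (subst (asm) summable_on_reindex) (simp_all add: o_def)
      then have "((\<lambda>k. T (Suc k) y i / c ^ Suc k) has_sum matvec R A s i) UNIV"
        unfolding As by (rule has_sum_infsum)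
      then have "(\<lambda>k. T (Suc k) y i / c ^ Suc k) sums matvec R A s i"
        by (rule has_sum_imp_sums)
      with s3 have "matvec R A s i = c * s i - y i"
        using sums_unique2 by blast
      then show ?thesis by simp
    qed
    define x where "x = (\<lambda>i. (-1) * s i)"
    have x: "x \<in> l2 R"
      unfolding x_def using s_l2 by (rule l2_scale)
    have "matvec R A x i - c * x i = y i" for i
    proof (cases "i \<in> R")
      case True
      then show ?thesis
        using key[OF True] unfolding x_def matvec_scale[OF A s_l2] by (simp add: algebra_simps)
    next
      case False
      then show ?thesis
        using l2_outside[OF x False] l2_outside[OF y False] by (simp add: matvec_def)
    qed
    then have "y = (\<lambda>i. matvec R A x i - c * x i)"
      by (simp add: fun_eq_iff)
    then show ?thesis using x by (rule image_eqI)
  qed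
  have "bij_betw (\<lambda>x i. matvec R A x i - c * x i) (l2 R) (l2 R)"
    unfolding bij_betw_def using inj closed surj by blast
  then show ?thesis by (simp add: spec_def)
qed

section \<open>The spectral radius formula for nonnegative matrices\<close>

lemma cmod_nonneg_mono: "0 \<le> a \<Longrightarrow> a \<le> b \<Longrightarrow> cmod a \<le> cmod b" for a b :: complex
  by (simp add: less_eq_complex_def cmod_eq_Re)

lemma has_sum_diff:
  fixes f g :: "'a \<Rightarrow> complex"
  assumes "(f has_sum a) X" "(g has_sum b) X"
  shows "((\<lambda>i. f i - g i) has_sum (a - b)) X"
  using has_sum_add[OF assms(1) has_sum_uminusI[OF assms(2)]] by simp

lemma nonneg_complex_eq: "0 \<le> z \<Longrightarrow> z = complex_of_real (cmod z)"
  by (auto simp: less_eq_complex_def cmod_eq_Re complex_eq_iff)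

text \<open>Pairing with the dominating vector of a sequence of counterexamples takes the place of the open
  mapping theorem and the uniform boundedness principle.\<close>

lemma transp_bounded_below:
  assumes A: "form_bounded R A C"
    and surj: "\<And>y. y \<in> l2 R \<Longrightarrow> \<exists>x\<in>l2 R. (\<lambda>i. matvec R A x i - complex_of_real L * x i) = y"
  obtains M where "0 < M"
    "\<And>w. w \<in> l2 R \<Longrightarrow> (\<And>i. 0 \<le> w i) \<Longrightarrow>
        l2norm R w \<le> M * l2norm R (\<lambda>i. matvec R (transp A) w i - complex_of_real L * w i)"
proof (rule ccontr)
  define S where "S = (\<lambda>w i. matvec R (transp A) w i - complex_of_real L * w i)"
  assume "\<not> thesis"
  note no_bound = this and bound = that
  have no: "\<not> (\<forall>w. w \<in> l2 R \<longrightarrow> (\<forall>i. 0 \<le> w i) \<longrightarrow> l2norm R w \<le> M * l2norm R (S w))"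
    if "0 < M" for M
    using no_bound bound[OF that] unfolding S_def by blast
  have "\<forall>n. \<exists>w. w \<in> l2 R \<and> (\<forall>i. 0 \<le> w i) \<and> 4 ^ n * l2norm R (S w) < l2norm R w"
    using no[of "4 ^ n" for n] by (simp add: not_le)
  from choice[OF this] obtain w where w: "\<And>n. w n \<in> l2 R" "\<And>n i. 0 \<le> w n i"
    and big: "\<And>n. 4 ^ n * l2norm R (S (w n)) < l2norm R (w n)"
    by blast
  have pos: "0 < l2norm R (w n)" for n
    using big[of n] l2norm_nonneg[of R "S (w n)"] by (meson less_le_trans mult_nonneg_nonneg
      not_less order_le_less_trans zero_le_numeral zero_le_power)
  define u where "u = (\<lambda>n i. cmod (w n i) * (1 / l2norm R (w n)))"
  have "L2_set (u n) F \<le> 1" if F: "finite F" "F \<subseteq> R" for n F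
  proof -
    have "L2_set (u n) F = L2_set (\<lambda>i. cmod (w n i)) F * (1 / l2norm R (w n))"
      unfolding u_def using pos[of n] by (intro L2_set_left_distrib[symmetric]) simp
    also have "\<dots> \<le> l2norm R (w n) * (1 / l2norm R (w n))"
      using L2_set_le_l2norm[OF w(1) F] pos[of n] by (intro mult_right_mono) auto
    finally show ?thesis using pos[of n] by simp
  qed
  from dominating_vector[of R u, OF this] obtain y where y: "\<And>i. 0 \<le> y i"
    "\<And>F. finite F \<Longrightarrow> F \<subseteq> R \<Longrightarrow> L2_set y F \<le> 2"
    "\<And>n i. i \<in> R \<Longrightarrow> \<bar>u n i\<bar> \<le> 2 ^ n * y i"
    by metis
  define v where "v = (\<lambda>i. if i \<in> R then complex_of_real (y i) else 0)"
  have v: "v \<in> l2 R"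
    unfolding v_def using y(2) by (rule l2_real_vector)
  from surj[OF v] obtain x where x: "x \<in> l2 R"
    and xv: "(\<lambda>i. matvec R A x i - complex_of_real L * x i) = v" by blast
  \<comment> \<open>The vector \<open>v\<close> is the image of \<open>x\<close> under
    \<open>A - L\<close>. Its pairing with \<open>w n\<close> is therefore the pairing of
    \<open>S (w n)\<close> with \<open>x\<close>, which is at most the norm of \<open>x\<close>
    times that of \<open>w n\<close> over \<open>4 ^ n\<close>. Domination of \<open>w n\<close> by
    \<open>v\<close> bounds the same pairing from below by the norm of \<open>w n\<close> over
    \<open>2 ^ n\<close>.\<close>
  have "2 ^ n \<le> l2norm R x" for n
  proof -
    note wn = w(1)[of n]
    have AT: "form_bounded R (transp A) C" using A by (rule form_bounded_transp)
    have Sw: "S (w n) \<in> l2 R"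
      unfolding S_def by (intro l2_diff(1) matvec_l2(1)[OF AT] l2_scale(1) wn)
    have "(\<Sum>\<^sub>\<infinity>i\<in>R. w n i * v i)
        = (\<Sum>\<^sub>\<infinity>i\<in>R. w n i * matvec R A x i - w n i * (complex_of_real L * x i))"
      unfolding xv[symmetric] by (simp add: right_diff_distrib)
    also have "\<dots> = (\<Sum>\<^sub>\<infinity>i\<in>R. w n i * matvec R A x i) - (\<Sum>\<^sub>\<infinity>i\<in>R. w n i * (complex_of_real L * x i))"
      using has_sum_diff[OF has_sum_infsum[OF l2_pairing(1)[OF wn matvec_l2(1)[OF A x]]]
          has_sum_infsum[OF l2_pairing(1)[OF wn l2_scale(1)[OF x]]]]
      by (rule infsumI)
    also have "\<dots> = (\<Sum>\<^sub>\<infinity>i\<in>R. matvec R (transp A) (w n) i * x i) - (\<Sum>\<^sub>\<infinity>i\<in>R. (complex_of_real L * w n i) * x i)"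
      unfolding matvec_transp_pairing[OF A x wn] by (simp add: mult_ac)
    also have "\<dots> = (\<Sum>\<^sub>\<infinity>i\<in>R. matvec R (transp A) (w n) i * x i - (complex_of_real L * w n i) * x i)"
      using has_sum_diff[OF has_sum_infsum[OF l2_pairing(1)[OF matvec_l2(1)[OF AT wn] x]]
          has_sum_infsum[OF l2_pairing(1)[OF l2_scale(1)[OF wn] x]]]
      by (rule infsumI[symmetric])
    also have "\<dots> = (\<Sum>\<^sub>\<infinity>i\<in>R. S (w n) i * x i)"
      by (simp add: S_def left_diff_distrib)
    finally have "cmod (\<Sum>\<^sub>\<infinity>i\<in>R. w n i * v i) \<le> l2norm R (S (w n)) * l2norm R x"
      using l2_pairing(2)[OF Sw x] by simp
    moreover have "l2norm R (w n) / 2 ^ n \<le> cmod (\<Sum>\<^sub>\<infinity>i\<in>R. w n i * v i)"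
    proof -
      have sq: "(\<lambda>i. (cmod (w n i))\<^sup>2) summable_on R"
        using wn by (simp add: l2_def)
      have "l2norm R (w n) * l2norm R (w n) = (\<Sum>\<^sub>\<infinity>i\<in>R. (cmod (w n i))\<^sup>2)"
        by (simp add: l2norm_def infsum_nonneg)
      also have "\<dots> \<le> (\<Sum>\<^sub>\<infinity>i\<in>R. 2 ^ n * l2norm R (w n) * Re (w n i * v i))"
      proof (rule infsum_mono[OF sq])
        show "(\<lambda>i. 2 ^ n * l2norm R (w n) * Re (w n i * v i)) summable_on R"
          by (intro summable_on_cmult_right summable_on_Re l2_pairing(1) wn v)
        fix i assume i: "i \<in> R"
        have "cmod (w n i) \<le> 2 ^ n * l2norm R (w n) * y i"
          using y(3)[OF i, of n] pos[of n] by (simp add: u_def field_simps)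
        then have "cmod (w n i) * cmod (w n i) \<le> cmod (w n i) * (2 ^ n * l2norm R (w n) * y i)"
          by (rule mult_left_mono) simp
        moreover have "Re (w n i * v i) = cmod (w n i) * y i"
          using i nonneg_complex_eq[OF w(2)[of n i]] by (simp add: v_def) (metis Re_complex_of_real)
        ultimately show "(cmod (w n i))\<^sup>2 \<le> 2 ^ n * l2norm R (w n) * Re (w n i * v i)"
          by (simp add: power2_eq_square mult_ac)
      qed
      also have "\<dots> = 2 ^ n * l2norm R (w n) * Re (\<Sum>\<^sub>\<infinity>i\<in>R. w n i * v i)"
        using infsum_Re[OF l2_pairing(1)[OF wn v]] by (simp add: infsum_cmult_right')
      also have "\<dots> \<le> 2 ^ n * l2norm R (w n) * cmod (\<Sum>\<^sub>\<infinity>i\<in>R. w n i * v i)"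
        using pos[of n] by (intro mult_left_mono complex_Re_le_cmod) auto
      finally show ?thesis
        using pos[of n] by (simp add: field_simps)
    qed
    ultimately have "l2norm R (w n) / 2 ^ n \<le> l2norm R (S (w n)) * l2norm R x"
      by linarith
    also have "\<dots> \<le> (l2norm R (w n) / 4 ^ n) * l2norm R x"
      using big[of n] l2norm_nonneg by (intro mult_right_mono) (auto simp: field_simps)
    finally have "4 ^ n / 2 ^ n \<le> l2norm R x"
      using pos[of n] by (simp add: field_simps)
    then show ?thesis
      by (simp flip: power_divide)
  qed
  moreover obtain n :: nat where "l2norm R x < 2 ^ n"
    using real_arch_pow[of 2] by auto
  ultimately show False
    by (meson not_less)
qed

text \<open>Truncations \<open>P\<close> of the resolvent at \<open>l > L\<close> are bounded uniformly in \<open>l\<close>; the \<open>N\<close>-th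
  power occurs \<open>N + 1\<close> times in \<open>P\<^sup>2\<close>, which forces its norm below the growth rate \<open>L\<close>.\<close>

lemma mpow_bound_if_bounded_below:
  assumes B: "form_bounded R B C"
    and L: "0 \<le> L" and lim: "(\<lambda>n. root n (opnorm R (mpow R B n))) \<longlonglongrightarrow> L"
    and M: "0 < M"
    and below: "\<And>w. w \<in> l2 R \<Longrightarrow> (\<And>i. 0 \<le> w i) \<Longrightarrow>
        l2norm R w \<le> M * l2norm R (\<lambda>i. matvec R B w i - complex_of_real L * w i)"
    and l: "L < l" "M * (l - L) \<le> 1 / 2"
  shows "real (N + 1) * opnorm R (mpow R B N) \<le> (4 * M)\<^sup>2 * l ^ (N + 2)"
proof -
  define T where "T = (\<lambda>k. matvec R (mpow R B k))"
  have l0: "0 < l" using L l by simp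
  have fb: "form_bounded R (mpow R B k) (C ^ k)" for k
    using form_bounded_mpow[OF B] .
  have T_l2: "T k x \<in> l2 R" if "x \<in> l2 R" for k x
    using matvec_l2(1)[OF fb that] by (simp add: T_def)
  have T_nn: "0 \<le> T k x i" if "x \<in> l2 R" "\<And>i. 0 \<le> x i" for k x i
    using matvec_nonneg[OF fb that] by (simp add: T_def)
  have T_0: "T 0 x = x" if "x \<in> l2 R" for x
    using matvec_idmat[OF that] by (simp add: T_def)
  define q where "q = (\<lambda>k. complex_of_real (1 / l ^ Suc k))"
  have q_nn: "0 \<le> q k" for k
    using l0 by (simp add: q_def less_eq_complex_def)
  define P where "P = (\<lambda>N x i. \<Sum>k\<le>N. q k * T k x i)"
  have P_l2: "P N x \<in> l2 R" if "x \<in> l2 R" for N x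
    using l2_sum[of "{..N}" "\<lambda>k i. q k * T k x i" R] l2_scale(1)[OF T_l2[OF that]]
    by (simp add: P_def)
  have P_nn: "0 \<le> P N x i" if "x \<in> l2 R" "\<And>i. 0 \<le> x i" for N x i
    unfolding P_def using q_nn T_nn[OF that] by (intro sum_nonneg mult_nonneg_nonneg) auto
  have term_le_P: "q k * T k x i \<le> P N x i" if "x \<in> l2 R" "\<And>i. 0 \<le> x i" "k \<le> N" for k N x i
  proof -
    have "(\<Sum>k\<in>{k}. q k * T k x i) \<le> (\<Sum>k\<le>N. q k * T k x i)"
      using that q_nn T_nn[OF that(1,2)] by (intro sum_mono2 mult_nonneg_nonneg) auto
    then show ?thesis by (simp add: P_def)
  qed
  have P_bound: "l2norm R (P N x) \<le> 4 * M * l2norm R x" if x: "x \<in> l2 R" "\<And>i. 0 \<le> x i" for N x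
  proof -
    have "\<forall>\<^sub>F n in sequentially. root n (opnorm R (mpow R B n)) < l"
      using order_tendstoD(2)[OF lim l(1)] .
    then obtain n0 where n0: "\<And>n. n \<ge> n0 \<Longrightarrow> root n (opnorm R (mpow R B n)) < l"
      by (auto simp: eventually_sequentially)
    \<comment> \<open>Powers are known to have norm at most \<open>l ^ k\<close> for late
      \<open>k\<close> only, so the remainder is controlled at a late index \<open>K\<close>. The
      truncation at \<open>N\<close> lies below the one at \<open>K\<close>, since all terms are
      nonnegative.\<close>
    define K where "K = max N n0"
    have "n0 \<le> Suc K" by (simp add: K_def)
    from less_imp_le[OF n0[OF this]]
    have "root (Suc K) (opnorm R (mpow R B (Suc K))) \<le> l" .
    then have "root (Suc K) (opnorm R (mpow R B (Suc K))) ^ Suc K \<le> l ^ Suc K"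
      by (intro power_mono real_root_ge_zero opnorm_nonneg[OF fb])
    then have "opnorm R (mpow R B (Suc K)) \<le> l ^ Suc K"
      using opnorm_nonneg[OF fb] by (simp del: mpow.simps power_Suc)
    then have "opnorm R (mpow R B (Suc K)) * l2norm R x \<le> l ^ Suc K * l2norm R x"
      by (rule mult_right_mono) (rule l2norm_nonneg)
    then have TK: "l2norm R (T (Suc K) x) \<le> l ^ Suc K * l2norm R x"
      using l2norm_matvec_le[OF fb x(1), of "Suc K"] by (simp add: T_def)
    define w where "w = P K x"
    have w: "w \<in> l2 R" "\<And>i. 0 \<le> w i"
      using P_l2[OF x(1)] P_nn[OF x] by (auto simp: w_def)
    have Bw: "matvec R B w i = (\<Sum>k\<le>K. q k * T (Suc k) x i)" for i
    proof -
      have "matvec R B w = (\<lambda>i. \<Sum>k\<le>K. matvec R B (\<lambda>i. q k * T k x i) i)"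
        unfolding w_def P_def by (intro matvec_sum[OF B] l2_scale(1) T_l2 x(1)) simp
      also have "\<dots> = (\<lambda>i. \<Sum>k\<le>K. q k * T (Suc k) x i)"
        using matvec_scale[OF B T_l2[OF x(1)]] matvec_mpow_Suc[OF B x(1)]
        by (simp add: T_def del: mpow.simps)
      finally show ?thesis by simp
    qed
    \<comment> \<open>Telescoping: \<open>l - B\<close> maps the truncated resolvent of
      \<open>x\<close> to \<open>x\<close> minus a remainder, whose norm is at most that of
      \<open>x\<close> by \<open>TK\<close>.\<close>
    have res: "complex_of_real l * w i - matvec R B w i = x i - complex_of_real (1 / l ^ Suc K) * T (Suc K) x i" for i
    proof -
      define f where "f = (\<lambda>k. complex_of_real (1 / l ^ k) * T k x i)"
      have "complex_of_real l * w i - matvec R B w i = (\<Sum>k\<le>K. f k - f (Suc k))"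
        unfolding Bw unfolding w_def P_def sum_distrib_left sum_subtractf[symmetric]
        using l0 by (intro sum.cong) (auto simp: q_def f_def)
      also have "\<dots> = f 0 - f (Suc K)"
        by (rule sum_telescope)
      finally show ?thesis
        using T_0[OF x(1)] by (simp add: f_def)
    qed
    have lw_l2: "(\<lambda>i. complex_of_real l * w i - matvec R B w i) \<in> l2 R"
      by (intro l2_diff(1) l2_scale(1) matvec_l2(1)[OF B] w)
    have "l2norm R (\<lambda>i. complex_of_real l * w i - matvec R B w i)
        \<le> l2norm R x + cmod (complex_of_real (1 / l ^ Suc K)) * l2norm R (T (Suc K) x)"
      unfolding res l2_scale(2)[OF T_l2[OF x(1)], symmetric]
      by (intro l2_diff(2) l2_scale(1) T_l2 x(1))
    also have "\<dots> \<le> l2norm R x + 1 / l ^ Suc K * (l ^ Suc K * l2norm R x)"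
      using TK l0 by (intro add_left_mono mult_mono) (auto simp: norm_divide norm_mult norm_power l2norm_nonneg)
    also have "\<dots> = 2 * l2norm R x"
      using l0 by simp
    finally have r2: "l2norm R (\<lambda>i. complex_of_real l * w i - matvec R B w i) \<le> 2 * l2norm R x" .
    have "(\<lambda>i. matvec R B w i - complex_of_real L * w i)
        = (\<lambda>i. complex_of_real (l - L) * w i - (complex_of_real l * w i - matvec R B w i))"
      by (simp add: fun_eq_iff algebra_simps)
    then have "l2norm R (\<lambda>i. matvec R B w i - complex_of_real L * w i)
        \<le> l2norm R (\<lambda>i. complex_of_real (l - L) * w i)
          + l2norm R (\<lambda>i. complex_of_real l * w i - matvec R B w i)"
      using l2_diff(2)[OF l2_scale(1)[OF w(1), of "complex_of_real (l - L)"] lw_l2] by simp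
    also have "\<dots> \<le> (l - L) * l2norm R w + 2 * l2norm R x"
      using r2 l l2_scale(2)[OF w(1), of "complex_of_real (l - L)"] by (simp del: of_real_diff)
    finally have "l2norm R w \<le> M * ((l - L) * l2norm R w + 2 * l2norm R x)"
      using below[OF w] M by (meson less_imp_le mult_left_mono order_trans)
    also have "\<dots> = (M * (l - L)) * l2norm R w + 2 * M * l2norm R x"
      by (simp add: algebra_simps)
    \<comment> \<open>Half of the norm of \<open>w\<close> is absorbed on the left, which turns the
      constant \<open>2 * M\<close> into \<open>4 * M\<close>, whatever the value of
      \<open>l\<close>.\<close>
    also have "\<dots> \<le> 1 / 2 * l2norm R w + 2 * M * l2norm R x"
      using l(2) l2norm_nonneg by (intro add_right_mono mult_right_mono) auto
    finally have "l2norm R w \<le> 4 * M * l2norm R x" by simp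
    moreover have "l2norm R (P N x) \<le> l2norm R w"
    proof (rule l2_mono(2)[OF w(1)], rule cmod_nonneg_mono)
      show "0 \<le> P N x i" for i using P_nn[OF x] .
      show "P N x i \<le> w i" for i
        unfolding P_def w_def using q_nn T_nn[OF x]
        by (intro sum_mono2 mult_nonneg_nonneg) (auto simp: K_def)
    qed
    ultimately show ?thesis by linarith
  qed
  have PP: "l2norm R (T N x) \<le> (4 * M)\<^sup>2 * l ^ (N + 2) / real (N + 1) * l2norm R x"
    if x: "x \<in> l2 R" "\<And>i. 0 \<le> x i" for x
  proof -
    define c where "c = complex_of_real (real (N + 1) / l ^ (N + 2))"
    have c_norm: "cmod c = real (N + 1) / l ^ (N + 2)"
      using l0 by (simp only: c_def norm_of_real) simp
    \<comment> \<open>Of the double sum on the right only the pairs of indices \<open>k\<close> and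
      \<open>N - k\<close> are kept. The coefficients of a pair multiply to the exponent
      \<open>(k + 1) + (N - k + 1) = N + 2\<close>.\<close>
    have le: "c * T N x i \<le> P N (P N x) i" for i
    proof -
      have "c * T N x i = (\<Sum>k\<le>N. complex_of_real (1 / l ^ (N + 2)) * T N x i)"
        by (simp add: c_def)
      also have "\<dots> \<le> (\<Sum>k\<le>N. q k * T k (P N x) i)"
      proof (rule sum_mono)
        fix k assume "k \<in> {..N}"
        then have k: "k \<le> N" by simp
        have "matvec R (mpow R B k) (\<lambda>i. q (N - k) * T (N - k) x i) i
            \<le> matvec R (mpow R B k) (P N x) i"
          by (rule matvec_mono[OF fb l2_scale(1)[OF T_l2[OF x(1)]] P_l2[OF x(1)]])
            (rule term_le_P[OF x], simp)
        then have "T k (\<lambda>i. q (N - k) * T (N - k) x i) i \<le> T k (P N x) i"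
          by (simp only: T_def)
        moreover have "T k (\<lambda>i. q (N - k) * T (N - k) x i) i = q (N - k) * T N x i"
          unfolding T_def matvec_scale[OF fb T_l2[OF x(1), unfolded T_def]]
          using matvec_mpow_add[OF B x(1), of k "N - k"] k by simp
        ultimately have "q k * (q (N - k) * T N x i) \<le> q k * T k (P N x) i"
          using q_nn[of k] by (simp add: mult_left_mono)
        moreover have "q k * q (N - k) = complex_of_real (1 / l ^ (N + 2))"
          unfolding q_def using k by (simp flip: power_add of_real_mult power_Suc)
        ultimately show "complex_of_real (1 / l ^ (N + 2)) * T N x i \<le> q k * T k (P N x) i"
          by (simp only: mult.assoc[symmetric])
      qed
      finally show ?thesis by (simp add: P_def)
    qed
    have c_nn: "0 \<le> c * T N x i" for i
      using T_nn[OF x, of N i] l0 by (simp add: c_def less_eq_complex_def)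
    have "cmod c * l2norm R (T N x) = l2norm R (\<lambda>i. c * T N x i)"
      by (rule l2_scale(2)[OF T_l2[OF x(1)], symmetric])
    also have "\<dots> \<le> l2norm R (P N (P N x))"
      by (rule l2_mono(2)[OF P_l2[OF P_l2[OF x(1)]] cmod_nonneg_mono[OF c_nn le]])
    also have "\<dots> \<le> 4 * M * l2norm R (P N x)"
      by (rule P_bound[OF P_l2[OF x(1)] P_nn[OF x]])
    also have "\<dots> \<le> 4 * M * (4 * M * l2norm R x)"
      using P_bound[OF x] M by (intro mult_left_mono) auto
    finally show ?thesis
      using l0 unfolding c_norm by (simp add: field_simps power2_eq_square)
  qed
  have "form_bounded R (mpow R B N) ((4 * M)\<^sup>2 * l ^ (N + 2) / real (N + 1))"
    using PP T_l2 l0 form_bounded_nonneg[OF fb]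
    by (intro form_bounded_if_vector_bound) (auto simp: T_def)
  then have "opnorm R (mpow R B N) \<le> (4 * M)\<^sup>2 * l ^ (N + 2) / real (N + 1)"
    by (rule opnorm_le)
  then show ?thesis by (simp add: field_simps)
qed

lemma opnorm_cong:
  assumes "mat_eq R A B" "form_bounded R B C"
  shows "opnorm R A = opnorm R B"
proof -
  have "nonneg_mat R A"
    using assms form_bounded_nonneg by (auto simp: mat_eq_def nonneg_mat_def)
  then have "form_bounded R A C"
    using form_bounded_mat_le[OF assms(2) _ mat_eq_imp_le[OF assms(1)]] by blast
  then show ?thesis
    using assms opnorm_mono mat_eq_imp_le mat_eq_sym form_bounded_nonneg by (meson antisym)
qed

lemma opnorm_transp:
  assumes "form_bounded R A C"
  shows "opnorm R (transp A) = opnorm R A"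
proof -
  have "transp (transp A) = A" by (simp add: transp_def)
  then show ?thesis
    using opnorm_le[OF form_bounded_transp[OF form_bounded_opnorm[OF assms]]]
      opnorm_le[OF form_bounded_transp[OF form_bounded_opnorm[OF form_bounded_transp[OF assms]]]]
    by simp
qed

lemma opnorm_mpow_transp:
  assumes A: "form_bounded R A C"
  shows "opnorm R (mpow R (transp A) n) = opnorm R (mpow R A n)"
  using opnorm_cong[OF mpow_transp[OF A] form_bounded_transp[OF form_bounded_mpow[OF A]]]
    opnorm_transp[OF form_bounded_mpow[OF A]]
  by simp

text \<open>The contradiction needs the exact growth rate: \<open>L\<close> is the infimum of the
  roots, so the norm of the \<open>N\<close>-th power is at least \<open>L ^ N\<close>, and
  \<open>main\<close> would bound \<open>N + 1\<close> by a constant. For \<open>L = 0\<close>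
  nothing can be divided out, but there \<open>N = 0\<close> gives the identity norm 0, which is
  absurd for nonempty \<open>R\<close>.\<close>

lemma growth_rate_in_spec:
  assumes ne: "R \<noteq> {}" and A: "form_bounded R A C" and L0: "0 \<le> L"
    and low: "\<And>n. 1 \<le> n \<Longrightarrow> L \<le> root n (opnorm R (mpow R A n))"
    and lim: "(\<lambda>n. root n (opnorm R (mpow R A n))) \<longlonglongrightarrow> L"
  shows "complex_of_real L \<in> spec R A"
proof (rule ccontr)
  assume "complex_of_real L \<notin> spec R A"
  then have bij: "bij_betw (\<lambda>x i. matvec R A x i - complex_of_real L * x i) (l2 R) (l2 R)"
    by (simp add: spec_def)
  have surj: "\<exists>x\<in>l2 R. (\<lambda>i. matvec R A x i - complex_of_real L * x i) = y" if "y \<in> l2 R" for y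
  proof -
    have "y \<in> (\<lambda>x i. matvec R A x i - complex_of_real L * x i) ` l2 R"
      using bij_betw_imp_surj_on[OF bij] that by simp
    then show ?thesis by (elim imageE) (simp add: bexI)
  qed
  obtain M where M: "0 < M" and below: "\<And>w. w \<in> l2 R \<Longrightarrow> (\<And>i. 0 \<le> w i) \<Longrightarrow>
      l2norm R w \<le> M * l2norm R (\<lambda>i. matvec R (transp A) w i - complex_of_real L * w i)"
    using transp_bounded_below[OF A surj] by metis
  note AT = form_bounded_transp[OF A]
  have lim': "(\<lambda>n. root n (opnorm R (mpow R (transp A) n))) \<longlonglongrightarrow> L"
    using lim by (simp add: opnorm_mpow_transp[OF A])
  have main: "real (N + 1) * opnorm R (mpow R A N) \<le> (4 * M)\<^sup>2 * L ^ (N + 2)" for N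
  proof (rule tendsto_lowerbound)
    show "((\<lambda>l. (4 * M)\<^sup>2 * l ^ (N + 2)) \<longlongrightarrow> (4 * M)\<^sup>2 * L ^ (N + 2)) (at_right L)"
      by (intro tendsto_intros)
    \<comment> \<open>The width \<open>1 / (2 * M)\<close> is the range in which
      \<open>M * (l - L) \<le> 1 / 2\<close>; the constant does not depend on \<open>l\<close>, so
      the bound survives the passage to \<open>L\<close>.\<close>
    have "real (N + 1) * opnorm R (mpow R A N) \<le> (4 * M)\<^sup>2 * l ^ (N + 2)"
      if "L < l" "l < L + 1 / (2 * M)" for l
    proof -
      have "M * (l - L) \<le> 1 / 2"
        using that M by (simp add: field_simps)
      from mpow_bound_if_bounded_below[OF AT L0 lim' M below that(1) this]
      show ?thesis by (simp add: opnorm_mpow_transp[OF A])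
    qed
    then show "\<forall>\<^sub>F l in at_right L. real (N + 1) * opnorm R (mpow R A N) \<le> (4 * M)\<^sup>2 * l ^ (N + 2)"
      unfolding eventually_at_right_field using M by (intro exI[of _ "L + 1 / (2 * M)"]) auto
  qed simp
  show False
  proof (cases "L = 0")
    case True
    obtain i where i: "i \<in> R" using ne by blast
    have "idmat i i \<le> opnorm R idmat"
      by (rule form_bounded_entry[OF form_bounded_opnorm[OF form_bounded_idmat] i i])
    with main[of 0] True show False by (simp add: idmat_def)
  next
    case False
    then have L: "0 < L" using L0 by simp
    obtain N :: nat where N: "(4 * M)\<^sup>2 * L\<^sup>2 < real N" "1 \<le> N"
      using reals_Archimedean2[of "max 1 ((4 * M)\<^sup>2 * L\<^sup>2)"] by force
    have "L ^ N \<le> root N (opnorm R (mpow R A N)) ^ N"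
      using low[OF N(2)] L by (intro power_mono) auto
    also have "\<dots> = opnorm R (mpow R A N)"
      using N(2) opnorm_nonneg[OF form_bounded_mpow[OF A]] by simp
    finally have "real (N + 1) * L ^ N \<le> real (N + 1) * opnorm R (mpow R A N)"
      by (rule mult_left_mono) simp
    also have "\<dots> \<le> (4 * M)\<^sup>2 * L\<^sup>2 * L ^ N"
      using main[of N] by (simp add: power_add power2_eq_square mult_ac)
    finally have "real (N + 1) \<le> (4 * M)\<^sup>2 * L\<^sup>2"
      using L by simp
    with N(1) show False by simp
  qed
qed

text \<open>The Fekete limit \<open>L\<close> is itself a spectral value, and a Neumann series at
  some rate \<open>q\<close> between \<open>L\<close> and \<open>cmod c\<close> excludes everything
  of larger modulus. So the \<open>Sup\<close> in \<open>specrad\<close> is a maximum, and no case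
  of an empty or unbounded set remains.\<close>

lemma
  assumes ne: "R \<noteq> {}" and A: "form_bounded R A C"
  shows specrad_tendsto: "(\<lambda>n. root n (opnorm R (mpow R A n))) \<longlonglongrightarrow> specrad R A"
    and specrad_le_root: "1 \<le> n \<Longrightarrow> specrad R A \<le> root n (opnorm R (mpow R A n))"
    and specrad_nonneg: "0 \<le> specrad R A"
proof -
  note nn = opnorm_nonneg[OF form_bounded_mpow[OF A]]
  obtain L where L0: "0 \<le> L" and low: "\<And>n. 1 \<le> n \<Longrightarrow> L \<le> root n (opnorm R (mpow R A n))"
    and lim: "(\<lambda>n. root n (opnorm R (mpow R A n))) \<longlonglongrightarrow> L"
    using root_submultiplicative_tendsto[of "\<lambda>n. opnorm R (mpow R A n)", OF nn opnorm_mpow_add[OF A]]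
    by metis
  have "specrad R A = L"
    unfolding specrad_def
  proof (rule cSup_eq_maximum)
    show "L \<in> cmod ` spec R A"
      using growth_rate_in_spec[OF ne A L0 low lim] L0 by (force simp: image_iff)
    fix a assume "a \<in> cmod ` spec R A"
    then obtain c where c: "c \<in> spec R A" "a = cmod c" by blast
    show "a \<le> L"
    proof (rule ccontr)
      assume "\<not> a \<le> L"
      then obtain q where q: "L < q" "q < cmod c"
        using c dense[of L "cmod c"] by auto
      then have q0: "0 < q" using L0 by simp
      obtain K where "0 \<le> K" "\<And>n. opnorm R (mpow R A n) \<le> K * q ^ n"
        using geometric_bound[of "\<lambda>n. opnorm R (mpow R A n)", OF nn lim q(1) q0] by metis
      then have "c \<notin> spec R A"
        by (rule notin_spec[OF A q0 q(2)])
      with c show False by simp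
    qed
  qed
  with L0 low lim show "(\<lambda>n. root n (opnorm R (mpow R A n))) \<longlonglongrightarrow> specrad R A"
    "1 \<le> n \<Longrightarrow> specrad R A \<le> root n (opnorm R (mpow R A n))" "0 \<le> specrad R A"
    by simp_all
qed

section \<open>Hadamard weighted products\<close>

text \<open>\<open>hpow\<close> has \<open>0 ^ 0 = 1\<close>, whereas \<open>0 powr 0 = 0\<close>.\<close>

definition hpowr :: "real \<Rightarrow> real \<Rightarrow> real" where
  "hpowr x a = (if a = 0 then 1 else x powr a)"

text \<open>For \<open>a + b = 1\<close> this is the weighted geometric mean. The second matrix
  becomes a transpose only in \<open>S_ab\<close>; leaving it arbitrary lets products be compared
  without reversing any order.\<close>

definition hmean :: "real \<Rightarrow> real \<Rightarrow> mat \<Rightarrow> mat \<Rightarrow> mat" where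
  "hmean a b A B = hadamard (hpow A a) (hpow B b)"

lemma hmean_apply: "hmean a b A B i j = hpowr (A i j) a * hpowr (B i j) b"
  by (simp add: hmean_def hadamard_def hpow_def hpowr_def)

lemma hpowr_nonneg: "0 \<le> hpowr x a"
  by (simp add: hpowr_def)

lemma hpowr_mono: "0 \<le> a \<Longrightarrow> 0 \<le> x \<Longrightarrow> x \<le> y \<Longrightarrow> hpowr x a \<le> hpowr y a"
  by (simp add: hpowr_def powr_mono2)

lemma hpowr_mult: "0 \<le> x \<Longrightarrow> 0 \<le> y \<Longrightarrow> hpowr (x * y) a = hpowr x a * hpowr y a"
  by (simp add: hpowr_def powr_mult)

lemma hpowr_mult_hpowr: "0 < a + b \<Longrightarrow> 0 \<le> C \<Longrightarrow> hpowr C a * hpowr C b = C powr (a + b)"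
  by (auto simp: hpowr_def powr_add)

text \<open>For \<open>a + b = 1\<close> this is weighted AM-GM. A larger sum only helps, since the mean is at most 1.\<close>

lemma hpowr_le_mean:
  assumes ab: "0 \<le> a" "0 \<le> b" "1 \<le> a + b" and x: "0 \<le> x" "x \<le> 1" and y: "0 \<le> y" "y \<le> 1"
  shows "hpowr x a * hpowr y b \<le> (a * x + b * y) / (a + b)"
proof -
  have one: "z powr c \<le> z" if "0 \<le> z" "z \<le> 1" "1 \<le> c" for z c :: real
    using powr_mono'[of 1 c z] that by simp
  consider "a = 0" | "b = 0" | "x = 0 \<or> y = 0" "a > 0" "b > 0" | "a > 0" "b > 0" "x > 0" "y > 0"
    using ab x y by fastforce
  then show ?thesis
  proof cases
    case 1
    then show ?thesis using one[of y b] ab y by (simp add: hpowr_def)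
  next
    case 2
    then show ?thesis using one[of x a] ab x by (simp add: hpowr_def)
  next
    case 3
    then show ?thesis using x y by (auto simp: hpowr_def)
  next
    case 4
    define s m where "s = a + b" and "m = (a * x + b * y) / (a + b)"
    have s: "1 \<le> s" using ab by (simp add: s_def)
    have m0: "0 < m" using 4 by (simp add: m_def add_pos_pos)
    have "a * x + b * y \<le> a * 1 + b * 1"
      using 4 x y by (intro add_mono mult_left_mono) auto
    then have m1: "m \<le> 1" using 4 by (simp add: m_def)
    \<comment> \<open>The tangent to the logarithm at the weighted mean \<open>m\<close>. In the sum
      with weights \<open>a\<close> and \<open>b\<close> the linear terms cancel.\<close>
    have lnx: "ln z \<le> ln m + (z / m - 1)" if "0 < z" for z
      using ln_le_minus_one[of "z / m"] that m0 by (simp add: ln_div)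
    have "a * ln x + b * ln y \<le> a * (ln m + (x / m - 1)) + b * (ln m + (y / m - 1))"
      using 4 lnx by (intro add_mono mult_left_mono) auto
    also have "\<dots> = s * ln m + ((a * x + b * y) / m - s)"
      by (simp add: s_def algebra_simps add_divide_distrib)
    also have "(a * x + b * y) / m = s"
      using 4 by (simp add: m_def s_def add_pos_pos) (metis add_pos_pos less_irrefl mult_pos_pos)
    finally have "a * ln x + b * ln y \<le> s * ln m" by simp
    also have "\<dots> \<le> 1 * ln m"
      using s m0 m1 by (intro mult_right_mono_neg) auto
    finally have "exp (a * ln x + b * ln y) \<le> exp (ln m)" by simp
    then show ?thesis
      using 4 m0 by (simp add: hpowr_def powr_def exp_add m_def)
  qed
qed

text \<open>Dividing by upper bounds reduces to numbers in \<open>{0..1}\<close>. The gain is a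
  right side linear in \<open>p\<close> and \<open>q\<close>, which can be summed: with a norm bound
  as \<open>P\<close> and \<open>Q\<close> it bounds the norm, with entries of products as
  \<open>P\<close> and \<open>Q\<close> it bounds products. If a bound is 0 and its exponent
  positive, both sides vanish.\<close>

lemma hpowr_le_scaled_mean:
  assumes ab: "0 \<le> a" "0 \<le> b" "1 \<le> a + b" and p: "0 \<le> p" "p \<le> P" and q: "0 \<le> q" "q \<le> Q"
  shows "hpowr p a * hpowr q b \<le> hpowr P a * hpowr Q b * ((a * (p / P) + b * (q / Q)) / (a + b))"
proof (cases "(P = 0 \<and> a > 0) \<or> (Q = 0 \<and> b > 0)")
  case True
  then show ?thesis using p q by (auto simp: hpowr_def)
next
  case False
  have scale: "hpowr z c = hpowr Z c * hpowr (z / Z) c"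
    if "0 \<le> z" "z \<le> Z" "0 \<le> c" "\<not> (Z = 0 \<and> c > 0)" for z Z c :: real
    using that by (cases "c = 0") (auto simp: hpowr_def powr_divide)
  have "hpowr p a * hpowr q b = (hpowr P a * hpowr (p / P) a) * (hpowr Q b * hpowr (q / Q) b)"
    using scale[OF p ab(1)] scale[OF q ab(2)] False by simp
  also have "\<dots> = hpowr P a * hpowr Q b * (hpowr (p / P) a * hpowr (q / Q) b)"
    by simp
  also have "\<dots> \<le> hpowr P a * hpowr Q b * ((a * (p / P) + b * (q / Q)) / (a + b))"
    using p q by (intro mult_left_mono hpowr_le_mean ab mult_nonneg_nonneg hpowr_nonneg)
      (auto simp: divide_le_eq_1)
  finally show ?thesis .
qed

lemma nonneg_hmean: "nonneg_mat R (hmean a b A B)"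
  by (simp add: nonneg_mat_def hmean_apply hpowr_nonneg)

lemma hmean_mono:
  assumes "0 \<le> a" "0 \<le> b" "nonneg_mat R A" "nonneg_mat R B" "mat_le R A A'" "mat_le R B B'"
  shows "mat_le R (hmean a b A B) (hmean a b A' B')"
  using assms unfolding mat_le_def nonneg_mat_def hmean_apply
  by (auto intro!: mult_mono hpowr_mono hpowr_nonneg)

text \<open>Entries are bounded by the norm bound \<open>C\<close>, so entrywise
  \<open>hmean\<close> is at most \<open>C powr (a + b)\<close> times the weighted mean of
  \<open>A / C\<close> and \<open>B / C\<close>, whose form is bounded by 1.\<close>

lemma form_bounded_hmean:
  assumes ab: "0 \<le> a" "0 \<le> b" "1 \<le> a + b" and A: "form_bounded R A C" and B: "form_bounded R B C"
  shows "form_bounded R (hmean a b A B) (C powr (a + b))"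
proof -
  note C = form_bounded_const_nonneg[OF A]
  define K where "K = C powr (a + b)"
  have "(\<Sum>i\<in>F. \<Sum>j\<in>G. \<bar>y i\<bar> * hmean a b A B i j * \<bar>x j\<bar>) \<le> K * L2_set y F * L2_set x G"
    if FG: "finite F" "F \<subseteq> R" "finite G" "G \<subseteq> R" for F G x y
  proof -
    define U where "U = (\<lambda>D. \<Sum>i\<in>F. \<Sum>j\<in>G. \<bar>y i\<bar> * (D i j :: real) * \<bar>x j\<bar>)"
    \<comment> \<open>Division by \<open>C\<close> covers \<open>C = 0\<close> as well: the quotient
      is then 0 and the right side nonnegative.\<close>
    have U_le: "U D / C \<le> L2_set y F * L2_set x G" if "form_bounded R D C" for D
      using form_boundedD[OF that FG, of y x] C by (cases "C = 0") (auto simp: U_def field_simps)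
    have "U (hmean a b A B) \<le> (\<Sum>i\<in>F. \<Sum>j\<in>G. \<bar>y i\<bar> * (K * ((a * (A i j / C) + b * (B i j / C)) / (a + b))) * \<bar>x j\<bar>)"
      unfolding U_def
    proof (rule sum_mono, rule sum_mono)
      fix i j assume "i \<in> F" "j \<in> G"
      then have ij: "i \<in> R" "j \<in> R" using FG by auto
      have "hmean a b A B i j \<le> hpowr C a * hpowr C b * ((a * (A i j / C) + b * (B i j / C)) / (a + b))"
        unfolding hmean_apply using ij form_bounded_nonneg[OF A] form_bounded_nonneg[OF B]
        by (intro hpowr_le_scaled_mean ab form_bounded_entry[OF A] form_bounded_entry[OF B])
          (auto simp: nonneg_mat_def)
      then have "hmean a b A B i j \<le> K * ((a * (A i j / C) + b * (B i j / C)) / (a + b))"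
        using hpowr_mult_hpowr[of a b C] ab C by (simp add: K_def)
      then show "\<bar>y i\<bar> * hmean a b A B i j * \<bar>x j\<bar>
          \<le> \<bar>y i\<bar> * (K * ((a * (A i j / C) + b * (B i j / C)) / (a + b))) * \<bar>x j\<bar>"
        by (intro mult_right_mono mult_left_mono) auto
    qed
    also have "\<dots> = (\<Sum>i\<in>F. \<Sum>j\<in>G. (K * a / (a + b) / C) * (\<bar>y i\<bar> * A i j * \<bar>x j\<bar>)
        + (K * b / (a + b) / C) * (\<bar>y i\<bar> * B i j * \<bar>x j\<bar>))"
      by (rule sum.cong[OF refl], rule sum.cong[OF refl])
        (simp add: algebra_simps add_divide_distrib)
    also have "\<dots> = (K * a / (a + b)) * (U A / C) + (K * b / (a + b)) * (U B / C)"
      unfolding sum.distrib U_def sum_distrib_left[symmetric] by simp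
    also have "\<dots> \<le> (K * a / (a + b)) * (L2_set y F * L2_set x G) + (K * b / (a + b)) * (L2_set y F * L2_set x G)"
      using ab by (intro add_mono mult_left_mono U_le A B) (auto simp: K_def)
    also have "\<dots> = (K * a / (a + b) + K * b / (a + b)) * (L2_set y F * L2_set x G)"
      by (rule distrib_right[symmetric])
    also have "K * a / (a + b) + K * b / (a + b) = K"
      using ab by (simp flip: add_divide_distrib distrib_left)
    also have "K * (L2_set y F * L2_set x G) = K * L2_set y F * L2_set x G"
      by simp
    finally show ?thesis by (simp add: U_def)
  qed
  then show ?thesis
    by (simp add: form_bounded_def nonneg_hmean K_def)
qed

lemma form_bounded_max:
  assumes "form_bounded R A C" "form_bounded R B D"
  shows "form_bounded R A (max C D)" "form_bounded R B (max C D)"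
  using form_bounded_mono assms by auto

text \<open>Hoelder's inequality for one entry. With \<open>P\<close> and \<open>Q\<close> the
  entries of \<open>A A'\<close> and \<open>B B'\<close>, each summand is bounded by a scaled mean;
  the normalized summands add up to at most 1, and so do their weighted means.\<close>

lemma matmul_hmean_le:
  assumes ab: "0 \<le> a" "0 \<le> b" "1 \<le> a + b"
    and A: "form_bounded R A C" and A': "form_bounded R A' C"
    and B: "form_bounded R B C" and B': "form_bounded R B' C"
  shows "mat_le R (matmul R (hmean a b A B) (hmean a b A' B')) (hmean a b (matmul R A A') (matmul R B B'))"
proof -
  have "matmul R (hmean a b A B) (hmean a b A' B') i j \<le> hmean a b (matmul R A A') (matmul R B B') i j"
    if ij: "i \<in> R" "j \<in> R" for i j
  proof (rule has_sum_le_finite_sums)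
    show "((\<lambda>k. hmean a b A B i k * hmean a b A' B' k j) has_sum
        matmul R (hmean a b A B) (hmean a b A' B') i j) R"
      using matmul_has_sum[OF form_bounded_hmean[OF ab A B] form_bounded_hmean[OF ab A' B'] ij] .
    fix H assume H: "finite H" "H \<subseteq> R"
    define P Q where "P = matmul R A A' i j" and "Q = matmul R B B' i j"
    have nn: "0 \<le> A i k" "0 \<le> A' k j" "0 \<le> B i k" "0 \<le> B' k j" if "k \<in> R" for k
      using that ij A A' B B' by (auto simp: form_bounded_def nonneg_mat_def)
    have sub: "(\<Sum>k\<in>G. A i k * A' k j) \<le> P" "(\<Sum>k\<in>G. B i k * B' k j) \<le> Q"
      if "finite G" "G \<subseteq> R" for G
      unfolding P_def Q_def using that nn
      by (auto intro!: finite_sum_le_has_sum[OF matmul_has_sum[OF A A' ij]]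
            finite_sum_le_has_sum[OF matmul_has_sum[OF B B' ij]])
    have P0: "0 \<le> P" "0 \<le> Q" using sub[of "{}"] by auto
    have "(\<Sum>k\<in>H. hmean a b A B i k * hmean a b A' B' k j)
        \<le> (\<Sum>k\<in>H. hpowr P a * hpowr Q b * ((a * ((A i k * A' k j) / P) + b * ((B i k * B' k j) / Q)) / (a + b)))"
    proof (rule sum_mono)
      fix k assume "k \<in> H"
      then have k: "k \<in> R" using H by auto
      have "hmean a b A B i k * hmean a b A' B' k j = hpowr (A i k * A' k j) a * hpowr (B i k * B' k j) b"
        using nn[OF k] by (simp add: hmean_apply hpowr_mult)
      also have "\<dots> \<le> hpowr P a * hpowr Q b * ((a * ((A i k * A' k j) / P) + b * ((B i k * B' k j) / Q)) / (a + b))"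
        using nn[OF k] sub[of "{k}"] k by (intro hpowr_le_scaled_mean ab) auto
      finally show "hmean a b A B i k * hmean a b A' B' k j
          \<le> hpowr P a * hpowr Q b * ((a * ((A i k * A' k j) / P) + b * ((B i k * B' k j) / Q)) / (a + b))" .
    qed
    also have "\<dots> = hpowr P a * hpowr Q b *
        ((a * ((\<Sum>k\<in>H. A i k * A' k j) / P) + b * ((\<Sum>k\<in>H. B i k * B' k j) / Q)) / (a + b))"
      by (simp add: sum.distrib flip: sum_distrib_left sum_divide_distrib)
    also have "\<dots> \<le> hpowr P a * hpowr Q b * ((a * 1 + b * 1) / (a + b))"
    proof -
      have "(\<Sum>k\<in>H. A i k * A' k j) / P \<le> 1" "(\<Sum>k\<in>H. B i k * B' k j) / Q \<le> 1"
        using sub[OF H] P0 by (auto simp: divide_le_eq_1)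
      then show ?thesis
        using ab by (intro mult_left_mono divide_right_mono add_mono mult_nonneg_nonneg hpowr_nonneg) auto
    qed
    also have "\<dots> = hmean a b (matmul R A A') (matmul R B B') i j"
      using ab by (simp add: hmean_apply P_def Q_def)
    finally show "(\<Sum>k\<in>H. hmean a b A B i k * hmean a b A' B' k j)
        \<le> hmean a b (matmul R A A') (matmul R B B') i j" .
  qed
  then show ?thesis by (simp add: mat_le_def)
qed

lemma mpow_hmean_le:
  assumes ab: "0 \<le> a" "0 \<le> b" "1 \<le> a + b"
    and A: "form_bounded R A C" and B: "form_bounded R B C"
  shows "mat_le R (mpow R (hmean a b A B) n) (hmean a b (mpow R A n) (mpow R B n))"
proof (induction n)
  case 0
  show ?case
    by (auto simp: mat_le_def hmean_apply idmat_def hpowr_nonneg) (simp add: hpowr_def)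
next
  case (Suc n)
  \<comment> \<open>\<open>matmul_hmean_le\<close> takes one bound for all four matrices.\<close>
  define D where "D = max C (C ^ n)"
  have AD: "form_bounded R A D" "form_bounded R (mpow R A n) D"
    and BD: "form_bounded R B D" "form_bounded R (mpow R B n) D"
    unfolding D_def by (rule form_bounded_max[OF A form_bounded_mpow[OF A]]
        form_bounded_max[OF B form_bounded_mpow[OF B]])+
  note fb = form_bounded_hmean[OF ab A B]
  have "mat_le R (mpow R (hmean a b A B) (Suc n))
      (matmul R (hmean a b A B) (hmean a b (mpow R A n) (mpow R B n)))"
    using matmul_mono[OF mat_le_refl Suc nonneg_hmean form_bounded_nonneg[OF form_bounded_mpow[OF fb]]
        fb form_bounded_hmean[OF ab AD(2) BD(2)]]
    by simp
  then show ?case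
    using matmul_hmean_le[OF ab AD BD] mat_le_trans by simp
qed

section \<open>Comparison of spectral radii\<close>

lemma specrad_le_opnorm:
  assumes "R \<noteq> {}" "form_bounded R A C"
  shows "specrad R A \<le> C"
proof -
  have "specrad R A \<le> root 1 (opnorm R (mpow R A 1))"
    by (rule specrad_le_root[OF assms]) simp
  also have "\<dots> \<le> C"
    using opnorm_le[OF form_bounded_mpow[OF assms(2), of 1]] by simp
  finally show ?thesis .
qed

lemma specrad_mono:
  assumes ne: "R \<noteq> {}" and "nonneg_mat R A" and B: "form_bounded R B C" and "mat_le R A B"
  shows "specrad R A \<le> specrad R B"
proof -
  have A: "form_bounded R A C"
    using assms form_bounded_mat_le by blast
  show ?thesis
  proof (rule LIMSEQ_le[OF specrad_tendsto[OF ne A] specrad_tendsto[OF ne B]], intro exI[of _ 1] allI impI)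
    fix n :: nat assume "1 \<le> n"
    then show "root n (opnorm R (mpow R A n)) \<le> root n (opnorm R (mpow R B n))"
      using opnorm_mono[OF form_bounded_nonneg[OF form_bounded_mpow[OF A]] form_bounded_mpow[OF B]
          mpow_mono[OF assms(2) B assms(4)]] by simp
  qed
qed

lemma specrad_transp:
  assumes ne: "R \<noteq> {}" and A: "form_bounded R A C"
  shows "specrad R (transp A) = specrad R A"
  using specrad_tendsto[OF ne form_bounded_transp[OF A]] specrad_tendsto[OF ne A]
  by (simp add: opnorm_mpow_transp[OF A] LIMSEQ_unique)

text \<open>The root of order \<open>2 * n\<close> of the norm of \<open>A ^ (2 n)\<close> bounds
  the radius of \<open>A\<close>; its square is the \<open>n\<close>-th root that Gelfand's formula
  takes for the square of \<open>A\<close>.\<close>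

lemma specrad_square_le:
  assumes ne: "R \<noteq> {}" and A: "form_bounded R A C"
  shows "(specrad R A)\<^sup>2 \<le> specrad R (mpow R A 2)"
proof -
  note fb = form_bounded_mpow[OF A, of 2]
  show ?thesis
  proof (rule LIMSEQ_le_const[OF specrad_tendsto[OF ne fb]], intro exI[of _ 1] allI impI)
    fix n :: nat assume n: "1 \<le> n"
    have "specrad R A \<le> root (2 * n) (opnorm R (mpow R A (2 * n)))"
      using n by (intro specrad_le_root[OF ne A]) simp
    then have "(specrad R A)\<^sup>2 \<le> (root (2 * n) (opnorm R (mpow R A (2 * n))))\<^sup>2"
      using specrad_nonneg[OF ne A] by (rule power_mono)
    also have "\<dots> = root n (opnorm R (mpow R A (2 * n)))"
      using n opnorm_nonneg[OF form_bounded_mpow[OF A]]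
      by (simp add: real_root_mult_exp)
    also have "\<dots> = root n (opnorm R (mpow R (mpow R A 2) n))"
      using opnorm_cong[OF mpow_mult[OF A, of 2 n] form_bounded_mpow[OF A]] by simp
    finally show "(specrad R A)\<^sup>2 \<le> root n (opnorm R (mpow R (mpow R A 2) n))" .
  qed
qed

text \<open>Allows estimates with a slack \<open>e\<close> to be made first. At \<open>c = 0\<close>
  the continuity of \<open>powr\<close> rests on \<open>0 < s\<close>.\<close>

lemma le_powr_if_le_above:
  fixes x c s :: real
  assumes c: "0 \<le> c" and s: "0 < s" and le: "\<And>e. 0 < e \<Longrightarrow> x \<le> (c + e) powr s"
  shows "x \<le> c powr s"
proof (rule tendsto_lowerbound)
  have "\<forall>\<^sub>F e in at_right (0::real). 0 \<le> c + e"
    unfolding eventually_at_right_field using c by (intro exI[of _ 1]) auto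
  then have "((\<lambda>e. (c + e) powr s) \<longlongrightarrow> (c + 0) powr s) (at_right 0)"
    using s by (intro tendsto_powr' tendsto_intros) auto
  then show "((\<lambda>e. (c + e) powr s) \<longlongrightarrow> c powr s) (at_right 0)" by simp
  show "\<forall>\<^sub>F e in at_right 0. x \<le> (c + e) powr s"
    unfolding eventually_at_right_field using le by (intro exI[of _ 1]) auto
qed simp

text \<open>A single \<open>n\<close> with both roots below \<open>c + e\<close> is enough, because
  every such root bounds the spectral radius from above: both \<open>n\<close>-th powers have norm
  at most \<open>(c + e) ^ n\<close>, and \<open>hmean\<close> of these powers dominates the
  \<open>n\<close>-th power of \<open>hmean\<close>.\<close>

lemma specrad_hmean_le:
  assumes ab: "0 \<le> a" "0 \<le> b" "1 \<le> a + b" and ne: "R \<noteq> {}"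
    and A: "form_bounded R A C" and B: "form_bounded R B C"
    and cA: "specrad R A \<le> c" and cB: "specrad R B \<le> c"
  shows "specrad R (hmean a b A B) \<le> c powr (a + b)"
proof (rule le_powr_if_le_above)
  show c0: "0 \<le> c" using specrad_nonneg[OF ne A] cA by simp
  show "0 < a + b" using ab by simp
  fix e :: real assume e: "0 < e"
  note H = form_bounded_hmean[OF ab A B]
  have "\<forall>\<^sub>F n in sequentially. root n (opnorm R (mpow R A n)) < c + e \<and>
      root n (opnorm R (mpow R B n)) < c + e \<and> 1 \<le> n"
    using order_tendstoD(2)[OF specrad_tendsto[OF ne A], of "c + e"]
      order_tendstoD(2)[OF specrad_tendsto[OF ne B], of "c + e"] cA cB e
    by (intro eventually_conj eventually_ge_at_top[of 1]) auto
  then obtain n where n: "root n (opnorm R (mpow R A n)) < c + e"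
    "root n (opnorm R (mpow R B n)) < c + e" "1 \<le> n"
    by (auto simp: eventually_sequentially)
  have fb: "form_bounded R (mpow R D n) ((c + e) ^ n)"
    if D: "form_bounded R D C" "root n (opnorm R (mpow R D n)) < c + e" for D
  proof (rule form_bounded_mono[OF form_bounded_opnorm[OF form_bounded_mpow[OF D(1)]]])
    have "opnorm R (mpow R D n) = root n (opnorm R (mpow R D n)) ^ n"
      using n(3) opnorm_nonneg[OF form_bounded_mpow[OF D(1)]] by simp
    also have "\<dots> \<le> (c + e) ^ n"
      using D(2) n(3) opnorm_nonneg[OF form_bounded_mpow[OF D(1)]] by (intro power_mono) auto
    finally show "opnorm R (mpow R D n) \<le> (c + e) ^ n" .
  qed
  have "opnorm R (mpow R (hmean a b A B) n) \<le> ((c + e) ^ n) powr (a + b)"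
    by (intro opnorm_le form_bounded_mat_le[OF form_bounded_hmean[OF ab fb[OF A n(1)] fb[OF B n(2)]]]
        form_bounded_nonneg[OF form_bounded_mpow[OF H]] mpow_hmean_le[OF ab A B])
  also have "\<dots> = ((c + e) powr (a + b)) ^ n"
    using c0 e by (simp add: powr_realpow[symmetric] powr_powr mult.commute)
  finally have "root n (opnorm R (mpow R (hmean a b A B) n)) \<le> root n (((c + e) powr (a + b)) ^ n)"
    using n(3) by simp
  also have "\<dots> = (c + e) powr (a + b)"
    using n(3) by (simp add: real_root_power_cancel)
  finally show "specrad R (hmean a b A B) \<le> (c + e) powr (a + b)"
    using specrad_le_root[OF ne H n(3)] by linarith
qed

section \<open>Sets of matrices and joint radii\<close>

text \<open>Nonnegativity is part of \<open>form_bounded\<close>; nonemptiness passes to all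
  positive powers and keeps the suprema over them meaningful.\<close>

definition mats_bounded :: "nat set \<Rightarrow> real \<Rightarrow> mat set \<Rightarrow> bool" where
  "mats_bounded R M \<Sigma> \<longleftrightarrow> \<Sigma> \<noteq> {} \<and> (\<forall>A\<in>\<Sigma>. form_bounded R A M)"

text \<open>Takes the place of inclusion, since products of Hadamard products are only bounded by
  elements of the other set. It is preserved by products and enough to compare suprema of monotone
  quantities.\<close>

definition dominated :: "nat set \<Rightarrow> mat set \<Rightarrow> mat set \<Rightarrow> bool" where
  "dominated R \<Sigma> \<Sigma>' \<longleftrightarrow> (\<forall>X\<in>\<Sigma>. \<exists>Y\<in>\<Sigma>'. mat_le R X Y)"

lemma mats_boundedD: "mats_bounded R M \<Sigma> \<Longrightarrow> A \<in> \<Sigma> \<Longrightarrow> form_bounded R A M"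
  by (simp add: mats_bounded_def)

lemma mats_bounded_nonneg: "mats_bounded R M \<Sigma> \<Longrightarrow> 0 \<le> M"
  unfolding mats_bounded_def using form_bounded_const_nonneg by blast

lemma dominated_trans: "dominated R \<Sigma> \<Sigma>' \<Longrightarrow> dominated R \<Sigma>' \<Sigma>'' \<Longrightarrow> dominated R \<Sigma> \<Sigma>''"
  unfolding dominated_def by (meson mat_le_trans)

text \<open>The first power is \<open>\<Sigma>\<close> itself and not \<open>idmat\<close> times it,
  so the recursion, and with it every induction over powers, starts at 1.\<close>

lemma setpow_Suc: "1 \<le> k \<Longrightarrow> setpow R \<Sigma> (Suc k) = {matmul R A B | A B. A \<in> setpow R \<Sigma> k \<and> B \<in> \<Sigma>}"
  by (cases k) auto

lemma mats_bounded_setpow: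
  assumes "mats_bounded R M \<Sigma>" "1 \<le> k"
  shows "mats_bounded R (M ^ k) (setpow R \<Sigma> k)"
  using assms(2)
proof (induction k rule: nat_induct_at_least)
  case base
  then show ?case using assms by simp
next
  case (Suc k)
  have "form_bounded R X (M ^ Suc k)" if X: "X \<in> setpow R \<Sigma> (Suc k)" for X
  proof -
    obtain A B where AB: "X = matmul R A B" "A \<in> setpow R \<Sigma> k" "B \<in> \<Sigma>"
      using X Suc(1) by (auto simp: setpow_Suc)
    then show ?thesis
      using form_bounded_matmul[OF mats_boundedD[OF Suc.IH AB(2)] mats_boundedD[OF assms(1) AB(3)]]
      by (simp add: mult.commute)
  qed
  moreover have "setpow R \<Sigma> (Suc k) \<noteq> {}"
    using Suc.IH assms(1) Suc(1) by (auto simp: setpow_Suc mats_bounded_def)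
  ultimately show ?case by (simp add: mats_bounded_def)
qed

lemma setpow_dominated:
  assumes S: "mats_bounded R M \<Sigma>" and S': "mats_bounded R M' \<Sigma>'"
    and dom: "dominated R \<Sigma> \<Sigma>'" and k: "1 \<le> k"
  shows "dominated R (setpow R \<Sigma> k) (setpow R \<Sigma>' k)"
  using k
proof (induction k rule: nat_induct_at_least)
  case base
  then show ?case using dom by simp
next
  case (Suc k)
  show ?case
    unfolding dominated_def
  proof
    fix X assume "X \<in> setpow R \<Sigma> (Suc k)"
    then obtain A B where X: "X = matmul R A B" and AB: "A \<in> setpow R \<Sigma> k" "B \<in> \<Sigma>"
      using Suc(1) by (auto simp: setpow_Suc)
    obtain A' B' where AB': "A' \<in> setpow R \<Sigma>' k" "B' \<in> \<Sigma>'" "mat_le R A A'" "mat_le R B B'"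
      using AB Suc.IH dom unfolding dominated_def by blast
    have "mat_le R (matmul R A B) (matmul R A' B')"
      using AB AB' mats_bounded_setpow[OF S Suc(1)] mats_bounded_setpow[OF S' Suc(1)] S S'
      by (intro matmul_mono form_bounded_nonneg) (auto dest: mats_boundedD)
    then show "\<exists>Y\<in>setpow R \<Sigma>' (Suc k). mat_le R X Y"
      using AB' X Suc(1) by (auto simp: setpow_Suc)
  qed
qed

text \<open>Powers grow on the right, so a product of two of them is regrouped by associativity.
  This holds on \<open>R \<times> R\<close> only, hence \<open>mat_eq\<close> instead of
  membership.\<close>

lemma setpow_matmul:
  assumes S: "mats_bounded R M \<Sigma>" and mn: "1 \<le> m" "1 \<le> n"
    and X: "X \<in> setpow R \<Sigma> m" and Y: "Y \<in> setpow R \<Sigma> n"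
  shows "\<exists>Z\<in>setpow R \<Sigma> (m + n). mat_eq R Z (matmul R X Y)"
  using mn(2) Y
proof (induction n arbitrary: Y rule: nat_induct_at_least)
  case base
  then have "matmul R X Y \<in> setpow R \<Sigma> (m + 1)"
    using X mn(1) by (auto simp: setpow_Suc)
  then show ?case using mat_eq_refl by blast
next
  case (Suc n)
  obtain Y' B where Y: "Y = matmul R Y' B" "Y' \<in> setpow R \<Sigma> n" "B \<in> \<Sigma>"
    using Suc(1) Suc.prems by (auto simp: setpow_Suc)
  obtain Z where Z: "Z \<in> setpow R \<Sigma> (m + n)" "mat_eq R Z (matmul R X Y')"
    using Suc.IH[OF Y(2)] by blast
  have "mat_eq R (matmul R Z B) (matmul R (matmul R X Y') B)"
    using Z(2) by (rule matmul_cong) simp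
  also have "mat_eq R (matmul R (matmul R X Y') B) (matmul R X Y)"
    unfolding Y(1) by (rule matmul_assoc_eq[OF mats_boundedD[OF mats_bounded_setpow[OF S mn(1)] X]
          mats_boundedD[OF mats_bounded_setpow[OF S Suc(1)] Y(2)] mats_boundedD[OF S Y(3)]])
  finally have "mat_eq R (matmul R Z B) (matmul R X Y)" .
  moreover have "matmul R Z B \<in> setpow R \<Sigma> (m + Suc n)"
    using Z(1) Y(3) mn(1) by (auto simp: setpow_Suc)
  ultimately show ?case by blast
qed

lemma setpow_add_split:
  assumes S: "mats_bounded R M \<Sigma>" and mn: "1 \<le> m" "1 \<le> n" and Z: "Z \<in> setpow R \<Sigma> (m + n)"
  shows "\<exists>X\<in>setpow R \<Sigma> m. \<exists>Y\<in>setpow R \<Sigma> n. mat_eq R Z (matmul R X Y)"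
  using mn(2) Z
proof (induction n arbitrary: Z rule: nat_induct_at_least)
  case base
  then obtain A B where "Z = matmul R A B" "A \<in> setpow R \<Sigma> m" "B \<in> setpow R \<Sigma> 1"
    using mn(1) by (auto simp: setpow_Suc)
  then show ?case using mat_eq_refl by blast
next
  case (Suc n)
  obtain Z' B where Z: "Z = matmul R Z' B" "Z' \<in> setpow R \<Sigma> (m + n)" "B \<in> \<Sigma>"
    using mn Suc.prems by (auto simp: setpow_Suc)
  obtain X Y where XY: "X \<in> setpow R \<Sigma> m" "Y \<in> setpow R \<Sigma> n" "mat_eq R Z' (matmul R X Y)"
    using Suc.IH[OF Z(2)] by blast
  have "mat_eq R Z (matmul R (matmul R X Y) B)"
    unfolding Z(1) using XY(3) by (rule matmul_cong) simp
  also have "mat_eq R (matmul R (matmul R X Y) B) (matmul R X (matmul R Y B))"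
    by (rule matmul_assoc_eq[OF mats_boundedD[OF mats_bounded_setpow[OF S mn(1)] XY(1)]
          mats_boundedD[OF mats_bounded_setpow[OF S Suc(1)] XY(2)] mats_boundedD[OF S Z(3)]])
  finally have "mat_eq R Z (matmul R X (matmul R Y B))" .
  moreover have "matmul R Y B \<in> setpow R \<Sigma> (Suc n)"
    using XY(2) Z(3) Suc(1) by (auto simp: setpow_Suc)
  ultimately show ?case using XY(1) by blast
qed

lemma setpow_setpow:
  assumes S: "mats_bounded R M \<Sigma>" and m: "1 \<le> m" and k: "1 \<le> k"
    and Z: "Z \<in> setpow R (setpow R \<Sigma> m) k"
  shows "\<exists>W\<in>setpow R \<Sigma> (m * k). mat_eq R Z W"
  using k Z
proof (induction k arbitrary: Z rule: nat_induct_at_least)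
  case base
  then show ?case by (auto intro!: bexI[of _ Z])
next
  case (Suc k)
  obtain A B where Z: "Z = matmul R A B" "A \<in> setpow R (setpow R \<Sigma> m) k" "B \<in> setpow R \<Sigma> m"
    using Suc(1) Suc.prems by (auto simp: setpow_Suc)
  obtain W where W: "W \<in> setpow R \<Sigma> (m * k)" "mat_eq R A W"
    using Suc.IH[OF Z(2)] by blast
  have mk: "1 \<le> m * k" using m Suc(1) by simp
  obtain V where V: "V \<in> setpow R \<Sigma> (m * k + m)" "mat_eq R V (matmul R W B)"
    using setpow_matmul[OF S mk m W(1) Z(3)] by blast
  have "mat_eq R Z (matmul R W B)"
    unfolding Z(1) using W(2) by (rule matmul_cong) simp
  then have "mat_eq R Z V"
    using V(2) mat_eq_sym mat_eq_trans by blast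
  then show ?case
    using V(1) by (auto simp: add.commute)
qed

lemma setpow_mult_split:
  assumes S: "mats_bounded R M \<Sigma>" and m: "1 \<le> m" and k: "1 \<le> k"
    and Z: "Z \<in> setpow R \<Sigma> (m * k)"
  shows "\<exists>W\<in>setpow R (setpow R \<Sigma> m) k. mat_eq R Z W"
  using k Z
proof (induction k arbitrary: Z rule: nat_induct_at_least)
  case base
  then show ?case by (auto intro!: bexI[of _ Z])
next
  case (Suc k)
  have mk: "1 \<le> m * k" using m Suc(1) by simp
  have "Z \<in> setpow R \<Sigma> (m * k + m)"
    using Suc.prems by (simp add: add.commute)
  then obtain X Y where XY: "X \<in> setpow R \<Sigma> (m * k)" "Y \<in> setpow R \<Sigma> m" "mat_eq R Z (matmul R X Y)"
    using setpow_add_split[OF S mk m] by blast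
  obtain W where W: "W \<in> setpow R (setpow R \<Sigma> m) k" "mat_eq R X W"
    using Suc.IH[OF XY(1)] by blast
  have "mat_eq R (matmul R X Y) (matmul R W Y)"
    using W(2) by (rule matmul_cong) simp
  then have "mat_eq R Z (matmul R W Y)"
    using XY(3) mat_eq_trans by blast
  moreover have "matmul R W Y \<in> setpow R (setpow R \<Sigma> m) (Suc k)"
    using W(1) XY(2) Suc(1) by (auto simp: setpow_Suc)
  ultimately show ?case by blast
qed

section \<open>Products of Hadamard products with transposes\<close>

lemma mem_S_ab: "X \<in> S_ab a b \<Sigma> \<longleftrightarrow> (\<exists>A\<in>\<Sigma>. \<exists>B\<in>\<Sigma>. X = hmean a b A (transp B))"
  by (auto simp: S_ab_def hmean_def)

lemma mats_bounded_S_ab: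
  assumes "0 \<le> a" "0 \<le> b" "1 \<le> a + b" "mats_bounded R M \<Sigma>"
  shows "mats_bounded R (M powr (a + b)) (S_ab a b \<Sigma>)"
  using assms form_bounded_hmean[OF assms(1-3)] form_bounded_transp
  unfolding mats_bounded_def by (auto simp: mem_S_ab ex_in_conv[symmetric])

lemma S_ab_dominated:
  assumes "0 \<le> a" "0 \<le> b" "mats_bounded R M \<Sigma>" "dominated R \<Sigma> \<Sigma>'"
  shows "dominated R (S_ab a b \<Sigma>) (S_ab a b \<Sigma>')"
  unfolding dominated_def
proof
  fix X assume "X \<in> S_ab a b \<Sigma>"
  then obtain A B where AB: "A \<in> \<Sigma>" "B \<in> \<Sigma>" "X = hmean a b A (transp B)"
    by (auto simp: mem_S_ab)
  obtain A' B' where AB': "A' \<in> \<Sigma>'" "B' \<in> \<Sigma>'" "mat_le R A A'" "mat_le R B B'"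
    using assms(4) AB unfolding dominated_def by blast
  have "nonneg_mat R A" "nonneg_mat R B"
    using AB assms(3) form_bounded_nonneg by (auto dest: mats_boundedD)
  then have "mat_le R (hmean a b A (transp B)) (hmean a b A' (transp B'))"
    using AB' by (intro hmean_mono assms(1,2)) (auto simp: nonneg_mat_def mat_le_def transp_def)
  moreover have "hmean a b A' (transp B') \<in> S_ab a b \<Sigma>'"
    using AB' by (auto simp: mem_S_ab)
  ultimately show "\<exists>Y\<in>S_ab a b \<Sigma>'. mat_le R X Y"
    using AB(3) by blast
qed

lemma dominated_if_mat_eq: "(\<And>X. X \<in> \<Sigma> \<Longrightarrow> \<exists>Y\<in>\<Sigma>'. mat_eq R X Y) \<Longrightarrow> dominated R \<Sigma> \<Sigma>'"
  unfolding dominated_def using mat_eq_imp_le by blast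

lemma setpow_S_ab_dominated:
  assumes ab: "0 \<le> a" "0 \<le> b" "1 \<le> a + b" and S: "mats_bounded R M \<Sigma>" and k: "1 \<le> k"
  shows "dominated R (setpow R (S_ab a b \<Sigma>) k) (S_ab a b (setpow R \<Sigma> k))"
  using k
proof (induction k rule: nat_induct_at_least)
  case base
  then show ?case by (auto simp: dominated_def intro: mat_le_refl)
next
  case (Suc k)
  note Sk = mats_bounded_setpow[OF S Suc(1)]
  note SS = mats_bounded_S_ab[OF ab S] and SSk = mats_bounded_S_ab[OF ab Sk]
  show ?case
    unfolding dominated_def
  proof
    fix X assume "X \<in> setpow R (S_ab a b \<Sigma>) (Suc k)"
    then obtain V W where V: "V \<in> setpow R (S_ab a b \<Sigma>) k" and W: "W \<in> S_ab a b \<Sigma>"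
      and X: "X = matmul R V W"
      using Suc(1) by (auto simp: setpow_Suc)
    obtain V' where V': "V' \<in> S_ab a b (setpow R \<Sigma> k)" "mat_le R V V'"
      using Suc.IH V unfolding dominated_def by blast
    obtain A B where AB: "A \<in> setpow R \<Sigma> k" "B \<in> setpow R \<Sigma> k" "V' = hmean a b A (transp B)"
      using V'(1) by (auto simp: mem_S_ab)
    obtain D E where DE: "D \<in> \<Sigma>" "E \<in> \<Sigma>" "W = hmean a b D (transp E)"
      using W by (auto simp: mem_S_ab)
    have 1: "mat_le R X (matmul R V' W)"
      unfolding X
      by (rule matmul_mono[OF V'(2) mat_le_refl
            form_bounded_nonneg[OF mats_boundedD[OF mats_bounded_setpow[OF SS Suc(1)] V]]
            form_bounded_nonneg[OF mats_boundedD[OF SS W]] mats_boundedD[OF SSk V'(1)] mats_boundedD[OF SS W]])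
    define K where "K = max (M ^ k) M"
    have K: "form_bounded R Y K" if "Y \<in> setpow R \<Sigma> k \<or> Y \<in> \<Sigma>" for Y
      using that S Sk unfolding K_def mats_bounded_def
      by (metis form_bounded_mono max.cobounded1 max.cobounded2)
    have 2: "mat_le R (matmul R V' W) (hmean a b (matmul R A D) (matmul R (transp B) (transp E)))"
      unfolding AB(3) DE(3) using AB DE
      by (intro matmul_hmean_le[where C = K] ab form_bounded_transp K) auto
    have AD: "matmul R A D \<in> setpow R \<Sigma> (Suc k)"
      using AB DE Suc(1) by (auto simp: setpow_Suc)
    \<comment> \<open>The order of the second factors is reversed under the transpose: the new
      matrix \<open>E\<close> stands in front of \<open>B\<close>, whereas powers grow at the other
      end. So \<open>E B\<close> is treated as a product of a first and a \<open>k\<close>-th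
      power.\<close>
    have "E \<in> setpow R \<Sigma> 1" using DE by simp
    then obtain Z where Z: "Z \<in> setpow R \<Sigma> (1 + k)" "mat_eq R Z (matmul R E B)"
      using setpow_matmul[OF S _ Suc(1) _ AB(2), of 1 E] by auto
    have "mat_le R (hmean a b (matmul R A D) (transp (matmul R E B))) (hmean a b (matmul R A D) (transp Z))"
      using Z(2) by (simp add: mat_le_def hmean_apply mat_eq_def transp_def)
    then have "mat_le R X (hmean a b (matmul R A D) (transp Z))"
      using 1 2 unfolding transp_matmul by (meson mat_le_trans)
    moreover have "hmean a b (matmul R A D) (transp Z) \<in> S_ab a b (setpow R \<Sigma> (Suc k))"
      using AD Z(1) by (auto simp: mem_S_ab)
    ultimately show "\<exists>Y\<in>S_ab a b (setpow R \<Sigma> (Suc k)). mat_le R X Y"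
      by blast
  qed
qed

text \<open>The \<open>2 * k\<close> factors are grouped into \<open>k\<close> pairs. Each pair is
  dominated by an element of the set built from the power \<open>2 * m\<close>, and domination is
  preserved when the pairs are multiplied.\<close>

lemma setpow_S_ab_double_dominated:
  assumes ab: "0 \<le> a" "0 \<le> b" "1 \<le> a + b" and S: "mats_bounded R M \<Sigma>" and m: "1 \<le> m" and k: "1 \<le> k"
  shows "dominated R (setpow R (S_ab a b (setpow R \<Sigma> m)) (2 * k)) (setpow R (S_ab a b (setpow R \<Sigma> (2 * m))) k)"
proof -
  note Sm = mats_bounded_setpow[OF S m]
  have m2: "1 \<le> 2 * m" "(1::nat) \<le> 2" using m by auto
  note SSm = mats_bounded_S_ab[OF ab Sm]
  have "dominated R (setpow R (S_ab a b (setpow R \<Sigma> m)) 2) (S_ab a b (setpow R (setpow R \<Sigma> m) 2))"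
    by (rule setpow_S_ab_dominated[OF ab Sm m2(2)])
  moreover have "dominated R (setpow R (setpow R \<Sigma> m) 2) (setpow R \<Sigma> (2 * m))"
    using setpow_setpow[OF S m m2(2)] by (intro dominated_if_mat_eq) (simp add: mult.commute)
  then have "dominated R (S_ab a b (setpow R (setpow R \<Sigma> m) 2)) (S_ab a b (setpow R \<Sigma> (2 * m)))"
    by (rule S_ab_dominated[OF ab(1,2) mats_bounded_setpow[OF Sm m2(2)]])
  ultimately have "dominated R (setpow R (S_ab a b (setpow R \<Sigma> m)) 2) (S_ab a b (setpow R \<Sigma> (2 * m)))"
    by (rule dominated_trans)
  then have "dominated R (setpow R (setpow R (S_ab a b (setpow R \<Sigma> m)) 2) k)
      (setpow R (S_ab a b (setpow R \<Sigma> (2 * m))) k)"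
    by (rule setpow_dominated[OF mats_bounded_setpow[OF SSm m2(2)]
          mats_bounded_S_ab[OF ab mats_bounded_setpow[OF S m2(1)]] _ k])
  moreover have "dominated R (setpow R (S_ab a b (setpow R \<Sigma> m)) (2 * k))
      (setpow R (setpow R (S_ab a b (setpow R \<Sigma> m)) 2) k)"
    using setpow_mult_split[OF SSm m2(2) k] by (intro dominated_if_mat_eq)
  ultimately show ?thesis using dominated_trans by blast
qed

lemma setpow_S_ab_mult_dominated:
  assumes ab: "0 \<le> a" "0 \<le> b" "1 \<le> a + b" and S: "mats_bounded R M \<Sigma>" and m: "1 \<le> m" and k: "1 \<le> k"
  shows "dominated R (setpow R (S_ab a b (setpow R \<Sigma> m)) k) (S_ab a b (setpow R \<Sigma> (m * k)))"
proof -
  note Sm = mats_bounded_setpow[OF S m]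
  have "dominated R (setpow R (setpow R \<Sigma> m) k) (setpow R \<Sigma> (m * k))"
    using setpow_setpow[OF S m k] by (intro dominated_if_mat_eq)
  then have "dominated R (S_ab a b (setpow R (setpow R \<Sigma> m) k)) (S_ab a b (setpow R \<Sigma> (m * k)))"
    by (rule S_ab_dominated[OF ab(1,2) mats_bounded_setpow[OF Sm k]])
  with setpow_S_ab_dominated[OF ab Sm k] show ?thesis
    by (rule dominated_trans)
qed

section \<open>The common argument for both radii\<close>

text \<open>\<open>r\<close> is a limit for the operator norm but only an upper limit for the spectral radius. What both
  share is that even powers suffice to bound it from above (\<open>r_le\<close>).\<close>

locale radius =
  fixes R :: "nat set" and N :: "mat \<Rightarrow> real" and r :: "mat set \<Rightarrow> real"
  assumes N_mono: "\<And>A B C. nonneg_mat R A \<Longrightarrow> form_bounded R B C \<Longrightarrow> mat_le R A B \<Longrightarrow> N A \<le> N B"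
    and N_nonneg: "\<And>A C. form_bounded R A C \<Longrightarrow> 0 \<le> N A"
    and N_le: "\<And>A C. form_bounded R A C \<Longrightarrow> N A \<le> C"
    and N_hmean: "\<And>A B C a b c. 0 \<le> a \<Longrightarrow> 0 \<le> b \<Longrightarrow> 1 \<le> a + b \<Longrightarrow>
        form_bounded R A C \<Longrightarrow> form_bounded R B C \<Longrightarrow> N A \<le> c \<Longrightarrow> N B \<le> c \<Longrightarrow>
        N (hmean a b A (transp B)) \<le> c powr (a + b)"
    and r_nonneg: "\<And>M \<Sigma>. mats_bounded R M \<Sigma> \<Longrightarrow> 0 \<le> r \<Sigma>"
    and r_upper: "\<And>M \<Sigma> e. mats_bounded R M \<Sigma> \<Longrightarrow> 0 < e \<Longrightarrow>
        \<forall>\<^sub>F k in sequentially. root k (SUP A\<in>setpow R \<Sigma> k. N A) < r \<Sigma> + e"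
    and r_le: "\<And>M \<Sigma> c. mats_bounded R M \<Sigma> \<Longrightarrow>
        \<forall>\<^sub>F k in sequentially. root (2 * k) (SUP A\<in>setpow R \<Sigma> (2 * k). N A) \<le> c \<Longrightarrow> r \<Sigma> \<le> c"
begin

lemma N_bdd_above: "mats_bounded R M \<Sigma> \<Longrightarrow> bdd_above (N ` \<Sigma>)"
  using N_le by (auto simp: mats_bounded_def intro!: bdd_aboveI2)

lemma SUP_N_nonneg: "mats_bounded R M \<Sigma> \<Longrightarrow> 0 \<le> (SUP A\<in>\<Sigma>. N A)"
  by (metis N_bdd_above N_nonneg cSUP_upper2 ex_in_conv mats_bounded_def)

lemma N_le_SUP_if_dominated:
  assumes "nonneg_mat R X" "mats_bounded R M \<Sigma>" "Y \<in> \<Sigma>" "mat_le R X Y"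
  shows "N X \<le> (SUP A\<in>\<Sigma>. N A)"
  using assms N_mono mats_boundedD N_bdd_above cSUP_upper2 by metis

lemma SUP_N_dominated:
  assumes "mats_bounded R M \<Sigma>" "mats_bounded R M' \<Sigma>'" "dominated R \<Sigma> \<Sigma>'"
  shows "(SUP A\<in>\<Sigma>. N A) \<le> (SUP A\<in>\<Sigma>'. N A)"
proof (rule cSUP_least)
  show "\<Sigma> \<noteq> {}" using assms by (simp add: mats_bounded_def)
  fix X assume "X \<in> \<Sigma>"
  then show "N X \<le> (SUP A\<in>\<Sigma>'. N A)"
    using assms N_le_SUP_if_dominated form_bounded_nonneg mats_boundedD
    unfolding dominated_def by metis
qed

lemma SUP_N_S_ab_le:
  assumes ab: "0 \<le> a" "0 \<le> b" "1 \<le> a + b" and S: "mats_bounded R M \<Sigma>"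
  shows "(SUP A\<in>S_ab a b \<Sigma>. N A) \<le> (SUP A\<in>\<Sigma>. N A) powr (a + b)"
proof (rule cSUP_least)
  show "S_ab a b \<Sigma> \<noteq> {}"
    using mats_bounded_S_ab[OF ab S] by (simp add: mats_bounded_def)
  fix X assume "X \<in> S_ab a b \<Sigma>"
  then obtain A B where AB: "A \<in> \<Sigma>" "B \<in> \<Sigma>" "X = hmean a b A (transp B)"
    by (auto simp: mem_S_ab)
  show "N X \<le> (SUP A\<in>\<Sigma>. N A) powr (a + b)"
    unfolding AB(3) using AB(1,2) S
    by (intro N_hmean ab cSUP_upper N_bdd_above) (auto dest: mats_boundedD)
qed

text \<open>Twice as many factors are needed for the smaller power, and a root of order
  \<open>2 * k\<close> is the square root of one of order \<open>k\<close>. This is the source of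
  the exponents \<open>1 / 2 ^ n\<close> in the chain.\<close>

lemma radius_step:
  assumes ab: "0 \<le> a" "0 \<le> b" "1 \<le> a + b" and S: "mats_bounded R M \<Sigma>" and m: "1 \<le> m"
  shows "r (S_ab a b (setpow R \<Sigma> m)) \<le> root 2 (r (S_ab a b (setpow R \<Sigma> (2 * m))))"
proof -
  have m2: "1 \<le> 2 * m" using m by simp
  define U V where "U = S_ab a b (setpow R \<Sigma> m)" and "V = S_ab a b (setpow R \<Sigma> (2 * m))"
  note bU = mats_bounded_S_ab[OF ab mats_bounded_setpow[OF S m], folded U_def]
  note bV = mats_bounded_S_ab[OF ab mats_bounded_setpow[OF S m2], folded V_def]
  have "r U \<le> root 2 (r V + e)" if e: "0 < e" for e
  proof (rule r_le[OF bU])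
    show "\<forall>\<^sub>F k in sequentially. root (2 * k) (SUP A\<in>setpow R U (2 * k). N A) \<le> root 2 (r V + e)"
      using r_upper[OF bV e] eventually_ge_at_top[of "1::nat"]
    proof eventually_elim
      case (elim k)
      have k2: "1 \<le> 2 * k" using elim by simp
      have "(SUP A\<in>setpow R U (2 * k). N A) \<le> (SUP A\<in>setpow R V k. N A)"
        using SUP_N_dominated[OF mats_bounded_setpow[OF bU k2] mats_bounded_setpow[OF bV elim(2)]]
          setpow_S_ab_double_dominated[OF ab S m elim(2)] by (simp add: U_def V_def)
      then have "root (2 * k) (SUP A\<in>setpow R U (2 * k). N A) \<le> root (2 * k) (SUP A\<in>setpow R V k. N A)"
        using elim(2) by (intro real_root_le_mono) auto
      also have "\<dots> = root 2 (root k (SUP A\<in>setpow R V k. N A))"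
        by (rule real_root_mult_exp)
      also have "\<dots> \<le> root 2 (r V + e)"
        using elim(1) by (intro real_root_le_mono) auto
      finally show ?case .
    qed
  qed
  moreover have "((\<lambda>e. root 2 (r V + e)) \<longlongrightarrow> root 2 (r V + 0)) (at_right 0)"
    by (intro tendsto_intros)
  ultimately have "r U \<le> root 2 (r V + 0)"
    by (intro tendsto_lowerbound[of "\<lambda>e. root 2 (r V + e)" _ "at_right 0"])
      (auto simp: eventually_at_right_field intro!: exI[of _ 1])
  then show ?thesis by (simp add: U_def V_def)
qed

text \<open>\<open>n\<close> factors collapse into one Hadamard product over the power
  \<open>m * n\<close>, to which the bound for a single product applies; late suprema over that
  power are below \<open>(r \<Sigma> + e) ^ (m * n)\<close>. An \<open>n\<close>-th root and then an
  \<open>m\<close>-th root remain to be taken.\<close>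

lemma radius_bound:
  assumes ab: "0 \<le> a" "0 \<le> b" "1 \<le> a + b" and S: "mats_bounded R M \<Sigma>" and m: "1 \<le> m"
  shows "root m (r (S_ab a b (setpow R \<Sigma> m))) \<le> r \<Sigma> powr (a + b)"
proof (rule le_powr_if_le_above)
  show "0 \<le> r \<Sigma>" using r_nonneg[OF S] .
  show "0 < a + b" using ab by simp
  fix e :: real assume e: "0 < e"
  define U where "U = S_ab a b (setpow R \<Sigma> m)"
  note bU = mats_bounded_S_ab[OF ab mats_bounded_setpow[OF S m], folded U_def]
  have "r U \<le> ((r \<Sigma> + e) powr (a + b)) ^ m"
  proof (rule r_le[OF bU])
    have "\<forall>\<^sub>F k in sequentially. root (m * (2 * k)) (SUP A\<in>setpow R \<Sigma> (m * (2 * k)). N A) < r \<Sigma> + e"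
    proof (rule eventually_compose_filterlim[OF r_upper[OF S e]])
      have "strict_mono (\<lambda>k. m * (2 * k))"
        using m by (simp add: strict_mono_def)
      then show "filterlim (\<lambda>k. m * (2 * k)) sequentially sequentially"
        by (rule filterlim_subseq)
    qed
    then show "\<forall>\<^sub>F k in sequentially. root (2 * k) (SUP A\<in>setpow R U (2 * k). N A) \<le> ((r \<Sigma> + e) powr (a + b)) ^ m"
      using eventually_ge_at_top[of "1::nat"]
    proof eventually_elim
      case (elim k)
      define n where "n = 2 * k"
      have n: "1 \<le> n" "1 \<le> m * n" using elim m by (auto simp: n_def)
      define s where "s = (SUP A\<in>setpow R \<Sigma> (m * n). N A)"
      note bs = mats_bounded_setpow[OF S n(2)]
      have s0: "0 \<le> s"
        unfolding s_def by (rule SUP_N_nonneg[OF bs])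
      have "(SUP A\<in>setpow R U n. N A) \<le> (SUP A\<in>S_ab a b (setpow R \<Sigma> (m * n)). N A)"
        using SUP_N_dominated[OF mats_bounded_setpow[OF bU n(1)] mats_bounded_S_ab[OF ab bs]]
          setpow_S_ab_mult_dominated[OF ab S m n(1)] by (simp add: U_def)
      also have "\<dots> \<le> s powr (a + b)"
        unfolding s_def by (rule SUP_N_S_ab_le[OF ab bs])
      also have "s \<le> (r \<Sigma> + e) ^ (m * n)"
      proof -
        have "s = root (m * n) s ^ (m * n)" using n s0 by simp
        also have "\<dots> \<le> (r \<Sigma> + e) ^ (m * n)"
          using elim(1) s0 n by (intro power_mono) (auto simp: s_def n_def)
        finally show ?thesis .
      qed
      then have "s powr (a + b) \<le> ((r \<Sigma> + e) ^ (m * n)) powr (a + b)"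
        using ab s0 by (intro powr_mono2) auto
      also have "\<dots> = (((r \<Sigma> + e) powr (a + b)) ^ m) ^ n"
        using r_nonneg[OF S] e by (simp add: powr_realpow[symmetric] powr_powr mult.commute mult.left_commute)
      finally have "root n (SUP A\<in>setpow R U n. N A) \<le> root n ((((r \<Sigma> + e) powr (a + b)) ^ m) ^ n)"
        using n by (intro real_root_le_mono) auto
      also have "\<dots> = ((r \<Sigma> + e) powr (a + b)) ^ m"
        using n by (intro real_root_power_cancel) auto
      finally show ?case by (simp add: n_def)
    qed
  qed
  then have "root m (r U) \<le> root m (((r \<Sigma> + e) powr (a + b)) ^ m)"
    using m by simp
  also have "\<dots> = (r \<Sigma> + e) powr (a + b)"
    using m by (intro real_root_power_cancel) auto
  finally show "root m (r (S_ab a b (setpow R \<Sigma> m))) \<le> (r \<Sigma> + e) powr (a + b)"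
    by (simp add: U_def)
qed

lemma radius_chain:
  assumes ab: "0 \<le> a" "0 \<le> b" "1 \<le> a + b" and S: "mats_bounded R M \<Sigma>"
  shows "r (S_ab a b \<Sigma>) = root (2 ^ 0) (r (S_ab a b (setpow R \<Sigma> (2 ^ 0))))
       \<and> (\<forall>n::nat. root (2 ^ n) (r (S_ab a b (setpow R \<Sigma> (2 ^ n))))
                  \<le> root (2 ^ Suc n) (r (S_ab a b (setpow R \<Sigma> (2 ^ Suc n)))))
       \<and> (\<forall>n::nat. root (2 ^ n) (r (S_ab a b (setpow R \<Sigma> (2 ^ n)))) \<le> r \<Sigma> powr (a + b))"
proof (intro conjI allI)
  show "r (S_ab a b \<Sigma>) = root (2 ^ 0) (r (S_ab a b (setpow R \<Sigma> (2 ^ 0))))"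
    by simp
  fix n :: nat
  have "root (2 ^ n) (r (S_ab a b (setpow R \<Sigma> (2 ^ n))))
      \<le> root (2 ^ n) (root 2 (r (S_ab a b (setpow R \<Sigma> (2 * 2 ^ n)))))"
    by (intro real_root_le_mono radius_step[OF ab S]) auto
  then show "root (2 ^ n) (r (S_ab a b (setpow R \<Sigma> (2 ^ n))))
      \<le> root (2 ^ Suc n) (r (S_ab a b (setpow R \<Sigma> (2 ^ Suc n))))"
    by (simp only: power_Suc real_root_mult_exp[symmetric] mult.commute[of "2 ^ n"])
  show "root (2 ^ n) (r (S_ab a b (setpow R \<Sigma> (2 ^ n)))) \<le> r \<Sigma> powr (a + b)"
    by (rule radius_bound[OF ab S]) simp
qed

end

text \<open>Suprema of operator norms over powers are submultiplicative, so Fekete's lemma shows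
  that the \<open>lim\<close> in \<open>gsr\<close> exists. A limit is determined by the even
  indices.\<close>

lemma radius_gsr: "radius R (opnorm R) (gsr R)"
proof -
  define f where "f = (\<lambda>\<Sigma> k. SUP A\<in>setpow R \<Sigma> k. opnorm R A)"
  have bdd: "bdd_above (opnorm R ` \<Sigma>)" if "mats_bounded R M \<Sigma>" for M \<Sigma>
    using that opnorm_le by (auto simp: mats_bounded_def intro!: bdd_aboveI2)
  have up: "opnorm R A \<le> f \<Sigma> k" if "mats_bounded R M \<Sigma>" "1 \<le> k" "A \<in> setpow R \<Sigma> k" for M \<Sigma> k A
    unfolding f_def using that bdd[OF mats_bounded_setpow[OF that(1,2)]] by (intro cSUP_upper)
  have f0: "0 \<le> f \<Sigma> k" if S: "mats_bounded R M \<Sigma>" "1 \<le> k" for M \<Sigma> k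
  proof -
    obtain A where "A \<in> setpow R \<Sigma> k"
      using mats_bounded_setpow[OF S] by (auto simp: mats_bounded_def)
    then show ?thesis
      using up[OF S] opnorm_nonneg[OF mats_boundedD[OF mats_bounded_setpow[OF S]]]
      by (meson order_trans)
  qed
  have sub: "f \<Sigma> (m + n) \<le> f \<Sigma> m * f \<Sigma> n" if S: "mats_bounded R M \<Sigma>" and mn: "1 \<le> m" "1 \<le> n" for M \<Sigma> m n
    unfolding f_def
  proof (rule cSUP_least)
    have mn': "1 \<le> m + n" using mn by simp
    show "setpow R \<Sigma> (m + n) \<noteq> {}"
      using mats_bounded_setpow[OF S mn'] by (simp add: mats_bounded_def)
    fix Z assume "Z \<in> setpow R \<Sigma> (m + n)"
    then obtain X Y where XY: "X \<in> setpow R \<Sigma> m" "Y \<in> setpow R \<Sigma> n" "mat_eq R Z (matmul R X Y)"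
      using setpow_add_split[OF S mn] by blast
    note bX = mats_boundedD[OF mats_bounded_setpow[OF S mn(1)] XY(1)]
      and bY = mats_boundedD[OF mats_bounded_setpow[OF S mn(2)] XY(2)]
    have "opnorm R Z = opnorm R (matmul R X Y)"
      by (rule opnorm_cong[OF XY(3) form_bounded_matmul[OF bX bY]])
    also have "\<dots> \<le> opnorm R X * opnorm R Y"
      by (rule opnorm_matmul_le[OF bX bY])
    also have "\<dots> \<le> f \<Sigma> m * f \<Sigma> n"
      using up[OF S mn(1) XY(1)] up[OF S mn(2) XY(2)] f0[OF S mn(1)] opnorm_nonneg[OF bY]
      by (intro mult_mono)
    finally show "opnorm R Z \<le> (SUP A\<in>setpow R \<Sigma> m. opnorm R A) * (SUP A\<in>setpow R \<Sigma> n. opnorm R A)"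
      by (simp add: f_def)
  qed
  have lim: "0 \<le> gsr R \<Sigma> \<and> (\<lambda>k. root k (f \<Sigma> k)) \<longlonglongrightarrow> gsr R \<Sigma>" if S: "mats_bounded R M \<Sigma>" for M \<Sigma>
  proof -
    \<comment> \<open>Index 0 is reset because \<open>f0\<close> covers positive indices only. The
      roots do not change, as \<open>root 0\<close> is 0 in any case.\<close>
    define c where "c = (\<lambda>k. if k = 0 then 0 else f \<Sigma> k)"
    have "0 \<le> c n" for n
      using f0[OF S, of n] by (simp add: c_def)
    moreover have "c (m + n) \<le> c m * c n" if "1 \<le> m" "1 \<le> n" for m n
      using sub[OF S that] that by (simp add: c_def)
    ultimately obtain L where L: "0 \<le> L" "(\<lambda>k. root k (c k)) \<longlonglongrightarrow> L"
      using root_submultiplicative_tendsto[of c] by metis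
    have "(\<lambda>k. root k (c k)) = (\<lambda>k. root k (f \<Sigma> k))"
      by (auto simp: c_def fun_eq_iff)
    then have L': "(\<lambda>k. root k (f \<Sigma> k)) \<longlonglongrightarrow> L" using L by simp
    then have "gsr R \<Sigma> = L"
      unfolding gsr_def f_def by (rule limI)
    then show ?thesis using L' L by simp
  qed
  show ?thesis
  proof
    show "opnorm R (hmean a b A (transp B)) \<le> c powr (a + b)"
      if ab: "0 \<le> a" "0 \<le> b" "1 \<le> a + b" and "form_bounded R A C" "form_bounded R B C"
        "opnorm R A \<le> c" "opnorm R B \<le> c" for A B C a b c
      using that by (intro opnorm_le form_bounded_hmean ab form_bounded_transp)
        (blast intro: form_bounded_mono form_bounded_opnorm)+
    show "\<forall>\<^sub>F k in sequentially. root k (SUP A\<in>setpow R \<Sigma> k. opnorm R A) < gsr R \<Sigma> + e"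
      if "mats_bounded R M \<Sigma>" "0 < e" for M \<Sigma> e
      using order_tendstoD(2)[OF conjunct2[OF lim[OF that(1)]], of "gsr R \<Sigma> + e"] that(2)
      by (simp add: f_def)
    show "gsr R \<Sigma> \<le> c" if "mats_bounded R M \<Sigma>"
      "\<forall>\<^sub>F k in sequentially. root (2 * k) (SUP A\<in>setpow R \<Sigma> (2 * k). opnorm R A) \<le> c" for M \<Sigma> c
    proof (rule tendsto_upperbound)
      have "strict_mono (\<lambda>k::nat. 2 * k)" by (simp add: strict_mono_def)
      then show "(\<lambda>k. root (2 * k) (SUP A\<in>setpow R \<Sigma> (2 * k). opnorm R A)) \<longlonglongrightarrow> gsr R \<Sigma>"
        using LIMSEQ_subseq_LIMSEQ[OF conjunct2[OF lim[OF that(1)]]] by (auto simp: o_def f_def)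
    qed (use that in auto)
  qed (use opnorm_mono opnorm_nonneg opnorm_le lim in blast)+
qed

lemma radius_jsr:
  assumes ne: "R \<noteq> {}"
  shows "radius R (specrad R) (jsr R)"
proof -
  define f where "f = (\<lambda>\<Sigma> k. SUP A\<in>setpow R \<Sigma> k. specrad R A)"
  have bdd: "bdd_above (specrad R ` \<Sigma>)" if "mats_bounded R M \<Sigma>" for M \<Sigma>
    using that specrad_le_opnorm[OF ne] by (auto simp: mats_bounded_def intro!: bdd_aboveI2)
  have up: "specrad R A \<le> f \<Sigma> k" if "mats_bounded R M \<Sigma>" "1 \<le> k" "A \<in> setpow R \<Sigma> k" for M \<Sigma> k A
    unfolding f_def using that bdd[OF mats_bounded_setpow[OF that(1,2)]] by (intro cSUP_upper)
  have f0: "0 \<le> f \<Sigma> k" if S: "mats_bounded R M \<Sigma>" "1 \<le> k" for M \<Sigma> k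
  proof -
    obtain A where "A \<in> setpow R \<Sigma> k"
      using mats_bounded_setpow[OF S] by (auto simp: mats_bounded_def)
    then show ?thesis
      using up[OF S] specrad_nonneg[OF ne mats_boundedD[OF mats_bounded_setpow[OF S]]]
      by (meson order_trans)
  qed
  have fM: "root k (f \<Sigma> k) \<le> M" if S: "mats_bounded R M \<Sigma>" "1 \<le> k" for M \<Sigma> k
  proof -
    have "f \<Sigma> k \<le> M ^ k"
      unfolding f_def using mats_bounded_setpow[OF S] specrad_le_opnorm[OF ne]
      by (intro cSUP_least) (auto simp: mats_bounded_def)
    then have "root k (f \<Sigma> k) \<le> root k (M ^ k)" using S by simp
    then show ?thesis
      using mats_bounded_nonneg[OF S(1)] S(2) by (simp add: real_root_power_cancel)
  qed
  \<comment> \<open>The square of an element of the \<open>k\<close>-th power represents an element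
    of the \<open>2 * k\<close>-th, so doubling the index does not decrease the root. Bounds along
    even indices therefore hold along all positive ones.\<close>
  have sq: "root k (f \<Sigma> k) \<le> root (2 * k) (f \<Sigma> (2 * k))" if S: "mats_bounded R M \<Sigma>" and k: "1 \<le> k" for M \<Sigma> k
  proof -
    have k2: "1 \<le> k + k" using k by simp
    have "f \<Sigma> k \<le> sqrt (f \<Sigma> (2 * k))"
      unfolding f_def[THEN fun_cong, THEN fun_cong, of \<Sigma> k]
    proof (rule cSUP_least)
      show "setpow R \<Sigma> k \<noteq> {}"
        using mats_bounded_setpow[OF S k] by (simp add: mats_bounded_def)
      fix X assume X: "X \<in> setpow R \<Sigma> k"
      note bX = mats_boundedD[OF mats_bounded_setpow[OF S k] X]
      obtain Z where Z: "Z \<in> setpow R \<Sigma> (k + k)" "mat_eq R Z (matmul R X X)"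
        using setpow_matmul[OF S k k X X] by blast
      have "mat_eq R (mpow R X 2) (matmul R X X)"
        using matmul_cong[OF mat_eq_refl matmul_idmat] by (simp add: numeral_2_eq_2)
      then have le: "mat_le R (mpow R X 2) Z"
        using Z(2) mat_eq_imp_le mat_eq_sym mat_eq_trans by blast
      have "(specrad R X)\<^sup>2 \<le> specrad R (mpow R X 2)"
        by (rule specrad_square_le[OF ne bX])
      also have "\<dots> \<le> specrad R Z"
        by (rule specrad_mono[OF ne form_bounded_nonneg[OF form_bounded_mpow[OF bX]]
              mats_boundedD[OF mats_bounded_setpow[OF S k2] Z(1)] le])
      also have "\<dots> \<le> f \<Sigma> (2 * k)"
        using up[OF S k2 Z(1)] by (simp add: mult_2)
      finally show "specrad R X \<le> sqrt (f \<Sigma> (2 * k))"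
        by (rule real_le_rsqrt)
    qed
    then have "root k (f \<Sigma> k) \<le> root k (sqrt (f \<Sigma> (2 * k)))"
      using k by simp
    then show ?thesis
      by (simp add: sqrt_def real_root_mult_exp[symmetric] mult.commute[of k])
  qed
  \<comment> \<open>The upper limit lies between 0 and \<open>M\<close>, so
    \<open>real_of_ereal\<close>, which sends infinite values to 0, loses nothing.\<close>
  have lims: "0 \<le> jsr R \<Sigma> \<and> ereal (jsr R \<Sigma>) = limsup (\<lambda>k. ereal (root k (f \<Sigma> k)))"
    if S: "mats_bounded R M \<Sigma>" for M \<Sigma>
  proof -
    define l where "l = limsup (\<lambda>k. ereal (root k (f \<Sigma> k)))"
    have "l \<le> ereal M"
      unfolding l_def using fM[OF S]
      by (intro Limsup_bounded eventually_sequentiallyI[of 1]) auto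
    moreover have "0 \<le> l"
      unfolding l_def
    proof (rule le_Limsup)
      show "\<forall>\<^sub>F k in sequentially. 0 \<le> ereal (root k (f \<Sigma> k))"
        using f0[OF S] by (intro eventually_sequentiallyI[of 1]) auto
    qed simp
    ultimately obtain x where x: "l = ereal x" "0 \<le> x"
      by (cases l) auto
    have "jsr R \<Sigma> = real_of_ereal l"
      by (simp add: jsr_def l_def f_def)
    then show ?thesis using x by (simp add: l_def)
  qed
  show ?thesis
  proof
    show "specrad R (hmean a b A (transp B)) \<le> c powr (a + b)"
      if ab: "0 \<le> a" "0 \<le> b" "1 \<le> a + b" and "form_bounded R A C" "form_bounded R B C"
        "specrad R A \<le> c" "specrad R B \<le> c" for A B C a b c
      using that specrad_transp[OF ne that(5)]
      by (intro specrad_hmean_le[OF ab ne that(4) form_bounded_transp[OF that(5)]]) auto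
    show "\<forall>\<^sub>F k in sequentially. root k (SUP A\<in>setpow R \<Sigma> k. specrad R A) < jsr R \<Sigma> + e"
      if "mats_bounded R M \<Sigma>" "0 < e" for M \<Sigma> e
    proof -
      have "limsup (\<lambda>k. ereal (root k (f \<Sigma> k))) < ereal (jsr R \<Sigma> + e)"
        using lims[OF that(1)] that(2) by (metis ereal_less(2) less_add_same_cancel1 less_ereal.simps(1))
      then show ?thesis
        using Limsup_lessD by (fastforce simp: f_def)
    qed
    show "jsr R \<Sigma> \<le> c" if S: "mats_bounded R M \<Sigma>"
      and ev: "\<forall>\<^sub>F k in sequentially. root (2 * k) (SUP A\<in>setpow R \<Sigma> (2 * k). specrad R A) \<le> c" for M \<Sigma> c
    proof -
      have "\<forall>\<^sub>F k in sequentially. ereal (root k (f \<Sigma> k)) \<le> ereal c"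
        using ev eventually_ge_at_top[of "1::nat"]
      proof eventually_elim
        case (elim k)
        then show ?case using sq[OF S, of k] by (simp add: f_def)
      qed
      then have "limsup (\<lambda>k. ereal (root k (f \<Sigma> k))) \<le> ereal c"
        by (rule Limsup_bounded)
      then show ?thesis using lims[OF S] by (metis ereal_less_eq(3))
    qed
  qed (use specrad_mono[OF ne] specrad_nonneg[OF ne] specrad_le_opnorm[OF ne] lims in blast)+
qed

theorem theorem4p3:
  fixes R :: "nat set" and \<Psi> :: "mat set" and \<alpha> \<beta> :: real
    and r :: "mat set \<Rightarrow> real"
  assumes "index_set R"
    and "bounded_matset R \<Psi>"
    and "\<forall>A\<in>\<Psi>. nonneg_mat R A"
    and "r = jsr R \<or> r = gsr R"
    and "0 \<le> \<alpha>" and "0 \<le> \<beta>" and "\<alpha> + \<beta> \<ge> 1"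
  shows "r (S_ab \<alpha> \<beta> \<Psi>) = root (2 ^ 0) (r (S_ab \<alpha> \<beta> (setpow R \<Psi> (2 ^ 0))))
       \<and> (\<forall>n::nat. root (2 ^ n) (r (S_ab \<alpha> \<beta> (setpow R \<Psi> (2 ^ n))))
                  \<le> root (2 ^ Suc n) (r (S_ab \<alpha> \<beta> (setpow R \<Psi> (2 ^ Suc n)))))
       \<and> (\<forall>n::nat. root (2 ^ n) (r (S_ab \<alpha> \<beta> (setpow R \<Psi> (2 ^ n)))) \<le> r \<Psi> powr (\<alpha> + \<beta>))"
proof -
  have ne: "R \<noteq> {}"
    using assms(1) by (auto simp: index_set_def)
  obtain M where M: "opnorm R A \<le> M" if "A \<in> \<Psi>" for A
    using assms(2) by (auto simp: bounded_matset_def bdd_above_def)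
  \<comment> \<open>Automatic boundedness gives a constant depending on \<open>A\<close>; passing
    through the operator norm replaces it by the common bound \<open>M\<close>.\<close>
  have "form_bounded R A M" if A: "A \<in> \<Psi>" for A
  proof -
    obtain C where "form_bounded R A C"
      using assms(2,3) A defines_op_imp_form_bounded unfolding bounded_matset_def by blast
    then show ?thesis
      using form_bounded_opnorm form_bounded_mono M[OF A] by blast
  qed
  then have S: "mats_bounded R M \<Psi>"
    using assms(2) by (simp add: mats_bounded_def bounded_matset_def)
  from assms(4) show ?thesis
    using radius.radius_chain[OF radius_jsr[OF ne] assms(5-7) S]
      radius.radius_chain[OF radius_gsr assms(5-7) S]
    by fastforce
qed

end
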